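(* Let $(A,\Delta)$ be an algebraic quantum group with dual $B=\widehat A$, let $V\in M(B\otimes A)$ be the unique element with $\langle V,a\otimes b\rangle=\langle a,b\rangle$ for all $a\in A$, $b\in B$, and let $AB$ be the Heisenberg algebra of the pair $(A,B)$. For all $a\in A$ and $b\in B$ we have $$\Delta(a)V=V(a\otimes1)\qquad\text{and}\qquad V\Delta(b)=(1\otimes b)V.$$ The first formula holds in the multiplier algebra $M(AB\otimes A)$ and the second one in the multiplier algebra $M(B\otimes AB)$.
   Context: All algebras are associative algebras over $\mathbb C$, possibly non-unital, with non-degenerate product; $M(A)$ is the multiplier algebra of $A$; $\iota$ denotes identity maps. Regular multiplier Hopf algebra: an algebra $A$ with a homomorphism $\Delta:A\to M(A\otimes A)$ such that $\Delta(a)(1\otimes a')$, $(a\otimes 1)\Delta(a')$, $\Delta(a)(a'\otimes 1)$ and $(1\otimes a)\Delta(a')$ lie in $A\otimes A$ for all $a,a'$; $\Delta$ is coassociative, $(a\otimes1\otimes1)(\Delta\otimes\iota)(\Delta(c)(1\otimes a'))=((\iota\otimes\Delta)((a\otimes1)\Delta(c)))(1\otimes1\otimes a')$; and the maps $a\otimes a'\mapsto\Delta(a)(1\otimes a')$, $a\otimes a'\mapsto(a\otimes1)\Delta(a')$, and the same two maps for the flipped coproduct, are bijections of $A\otimes A$. It has a unique counit $\varepsilon$ and a bijective antipode $S$. A left integral is a non-zero linear functional $\varphi$ on $A$ with $(\iota\otimes\varphi)\Delta(a)=\varphi(a)1$ in $M(A)$ for all $a$. An algebraic quantum group is a regular multiplier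 Hopf algebra with (left and right) integrals. Fix a left integral $\varphi$. Sweedler notation $\Delta(a)=\sum_{(a)}a_{(1)}\otimes a_{(2)}$ is used. Dual: $B=\widehat A=\{\varphi(\,\cdot\,c):c\in A\}$, with $\langle a,b\rangle=b(a)$. Its product is $\langle a,bb'\rangle=\langle\Delta(a),b\otimes b'\rangle$; its coproduct $\Delta:B\to M(B\otimes B)$ is determined by $\langle a\otimes a',(b'\otimes1)\Delta(b)\rangle=\langle\Delta(a)(1\otimes a'),b'\otimes b\rangle$ and $\langle a\otimes a',\Delta(b)(1\otimes b')\rangle=\langle(a\otimes1)\Delta(a'),b\otimes b'\rangle$. $(B,\Delta)$ is again an algebraic quantum group. There are unital left actions given by $\langle a',a\triangleright b\rangle=\langle a'a,b\rangle$ and $\langle b\triangleright a,b'\rangle=\langle a,b'b\rangle$. The pairing of $B\otimes A$ with $A\otimes B$ is $\langle b\otimes a,a'\otimes b'\rangle=\langle a',b\rangle\langle a,b'\rangle$; it extends uniquely to $M(B\otimes A)\times(A\otimes B)$ by $\langle m,(b\triangleright a')\otimes(a\triangleright b')\rangle=\langle m(b\otimes a),a'\otimes b'\rangle$. This is the pairing in the definition of $V$; existence and uniqueness of $V$ are known. Heisenberg algebra $AB$: the vector space $A\otimes B$ with the associative product $(a\otimes b)(a'\otimes b')=\sum_{(a')(b)}\langle a'_{(2)},b_{(1)}\rangle\,aa'_{(1)}\otimes b_{(2)}b'$ (where $R(a'\otimes b)=\sum\langle a'_{(2)},b_{(1)}\rangle a'_{(1)}\otimes b_{(2)}$ is a well-defined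 bijective map of $A\otimes B$). It acts faithfully on $A$ by $(a\otimes b)\triangleright x=a(b\triangleright x)$. There are non-degenerate embeddings of $A$ and $B$ in $M(AB)$ such that $a\otimes b$ is the product $ab$ of the images of $a$ and $b$; $A$ and $B$ are identified with their images, so that in $M(AB)$, $ba=\sum_{(a)(b)}\langle a_{(2)},b_{(1)}\rangle a_{(1)}b_{(2)}$. Using these embeddings, $M(B\otimes A)$ and $M(A\otimes A)$ are viewed in $M(AB\otimes A)$, and $M(B\otimes A)$ and $M(B\otimes B)$ in $M(B\otimes AB)$. *)

theory Defs
  imports Complex_Main
begin

section \<open>Complex vector spaces and algebras\<close>

class scaleC =
  fixes scaleC :: "complex \<Rightarrow> 'a \<Rightarrow> 'a" (infixr "*\<^sub>C" 75)

class complex_vector = scaleC + ab_group_add +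
  assumes scaleC_add_right: "c *\<^sub>C (x + y) = c *\<^sub>C x + c *\<^sub>C y"
    and scaleC_add_left: "(c + d) *\<^sub>C x = c *\<^sub>C x + d *\<^sub>C x"
    and scaleC_scaleC: "c *\<^sub>C d *\<^sub>C x = (c * d) *\<^sub>C x"
    and scaleC_one: "1 *\<^sub>C x = x"

global_interpretation complex_vector: vector_space "scaleC :: complex \<Rightarrow> 'a \<Rightarrow> 'a::complex_vector"
  by unfold_locales (simp_all add: scaleC_add_right scaleC_add_left scaleC_scaleC scaleC_one)

instantiation complex :: complex_vector
begin

definition scaleC_complex :: "complex \<Rightarrow> complex \<Rightarrow> complex"
  where "scaleC_complex c x = c * x"

instance
  by standard (simp_all add: scaleC_complex_def algebra_simps)

end

abbreviation clinear :: "('a::complex_vector \<Rightarrow> 'b::complex_vector) \<Rightarrow> bool"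
  where "clinear \<equiv> Vector_Spaces.linear scaleC scaleC"

definition cbilinear :: "('a::complex_vector \<Rightarrow> 'b::complex_vector \<Rightarrow> 'c::complex_vector) \<Rightarrow> bool"
  where "cbilinear f \<longleftrightarrow> (\<forall>y. clinear (\<lambda>x. f x y)) \<and> (\<forall>x. clinear (f x))"

text \<open>Associative complex algebras, possibly without unit, and those with non-degenerate product.\<close>

class complex_algebra = complex_vector + ring +
  assumes mult_scaleC_left: "(c *\<^sub>C x) * y = c *\<^sub>C (x * y)"
    and mult_scaleC_right: "x * (c *\<^sub>C y) = c *\<^sub>C (x * y)"

class nondegenerate_algebra = complex_algebra +
  assumes nondegenerate_left: "(\<And>y. x * y = 0) \<Longrightarrow> x = 0"
    and nondegenerate_right: "(\<And>y. y * x = 0) \<Longrightarrow> x = 0"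

lemma clinearI:
  assumes "\<And>x y. f (x + y) = f x + f y" and "\<And>c x. f (c *\<^sub>C x) = c *\<^sub>C f x"
  shows "clinear f"
  using assms by unfold_locales

lemma clinearD:
  assumes "clinear f"
  shows "f (x + y) = f x + f y" and "f (c *\<^sub>C x) = c *\<^sub>C f x" and "f 0 = 0"
proof -
  interpret Vector_Spaces.linear scaleC scaleC f by fact
  show "f (x + y) = f x + f y" "f (c *\<^sub>C x) = c *\<^sub>C f x" "f 0 = 0"
    by (rule add scale zero)+
qed

lemma cbilinearD:
  assumes "cbilinear f"
  shows "f (x + x') y = f x y + f x' y" and "f x (y + y') = f x y + f x y'"
    and "f (c *\<^sub>C x) y = c *\<^sub>C f x y" and "f x (c *\<^sub>C y) = c *\<^sub>C f x y"
    and "f 0 y = 0" and "f x 0 = 0"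
  using assms unfolding cbilinear_def by (auto simp: clinearD clinearD[where f="\<lambda>x. f x y"])

lemma cbilinearI:
  assumes "\<And>x x' y. f (x + x') y = f x y + f x' y" and "\<And>x y y'. f x (y + y') = f x y + f x y'"
    and "\<And>c x y. f (c *\<^sub>C x) y = c *\<^sub>C f x y" and "\<And>c x y. f x (c *\<^sub>C y) = c *\<^sub>C f x y"
  shows "cbilinear f"
  unfolding cbilinear_def by (auto intro!: clinearI assms)


section \<open>Algebraic tensor products\<close>

text \<open>
  A list \<open>[(x\<^sub>1, y\<^sub>1), \<dots>, (x\<^sub>n, y\<^sub>n)]\<close> stands for the formal sum of the symbols
  \<open>x\<^sub>i \<otimes> y\<^sub>i\<close>; the tensor product is the quotient by the congruence generated by
  commutativity and the bilinearity relations.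
\<close>

inductive tensor_eq ::
    "('a::complex_vector \<times> 'b::complex_vector) list \<Rightarrow> ('a \<times> 'b) list \<Rightarrow> bool"
  where
    tensor_eq_refl: "tensor_eq u u"
  | tensor_eq_sym: "tensor_eq u v \<Longrightarrow> tensor_eq v u"
  | tensor_eq_trans: "tensor_eq u v \<Longrightarrow> tensor_eq v w \<Longrightarrow> tensor_eq u w"
  | tensor_eq_append: "tensor_eq u u' \<Longrightarrow> tensor_eq v v' \<Longrightarrow> tensor_eq (u @ v) (u' @ v')"
  | tensor_eq_commute: "tensor_eq (u @ v) (v @ u)"
  | tensor_eq_add_left: "tensor_eq [(x + x', y)] [(x, y), (x', y)]"
  | tensor_eq_add_right: "tensor_eq [(x, y + y')] [(x, y), (x, y')]"
  | tensor_eq_scaleC: "tensor_eq [(c *\<^sub>C x, y)] [(x, c *\<^sub>C y)]"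
  | tensor_eq_zero: "tensor_eq [(0, y)] []"

quotient_type (overloaded) ('a, 'b) tensor =
  "('a::complex_vector \<times> 'b::complex_vector) list" / tensor_eq
  by (intro equivpI reflpI sympI transpI) (blast intro: tensor_eq.intros)+

lift_definition tensor :: "'a::complex_vector \<Rightarrow> 'b::complex_vector \<Rightarrow> ('a, 'b) tensor"
  (infixl "\<otimes>" 71) is "\<lambda>x y. [(x, y)]" .

lemma tensor_eq_map_scaleC:
  "tensor_eq u v \<Longrightarrow> tensor_eq (map (\<lambda>(x, y). (c *\<^sub>C x, y)) u) (map (\<lambda>(x, y). (c *\<^sub>C x, y)) v)"
proof (induction rule: tensor_eq.induct)
  case (tensor_eq_trans u v w)
  then show ?case by (blast intro: tensor_eq.intros)
next
  case (tensor_eq_scaleC d x y)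
  have "tensor_eq [(d *\<^sub>C c *\<^sub>C x, y)] [(c *\<^sub>C x, d *\<^sub>C y)]" by (rule tensor_eq.intros)
  then show ?case by (simp add: scaleC_scaleC mult.commute)
qed (auto simp: scaleC_add_right intro: tensor_eq.intros)

instantiation tensor :: (complex_vector, complex_vector) complex_vector
begin

lift_definition zero_tensor :: "('a, 'b) tensor" is "[]" .

lift_definition plus_tensor :: "('a, 'b) tensor \<Rightarrow> ('a, 'b) tensor \<Rightarrow> ('a, 'b) tensor"
  is "(@)" by (rule tensor_eq_append)

lift_definition scaleC_tensor :: "complex \<Rightarrow> ('a, 'b) tensor \<Rightarrow> ('a, 'b) tensor"
  is "\<lambda>c. map (\<lambda>(x, y). (c *\<^sub>C x, y))" by (rule tensor_eq_map_scaleC)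

definition uminus_tensor :: "('a, 'b) tensor \<Rightarrow> ('a, 'b) tensor"
  where "uminus_tensor t = (- 1) *\<^sub>C t"

definition minus_tensor :: "('a, 'b) tensor \<Rightarrow> ('a, 'b) tensor \<Rightarrow> ('a, 'b) tensor"
  where "minus_tensor s t = s + (- 1) *\<^sub>C t"

instance
proof
  have cons: "tensor_eq (p # u) (p # v)" if "tensor_eq u v" for p and u v :: "('a \<times> 'b) list"
    using tensor_eq_append[OF tensor_eq_refl[of "[p]"] that] by simp
  have cons2: "tensor_eq (p # u) (q # r # v)"
    if "tensor_eq [p] [q, r]" "tensor_eq u v" for p q r and u v :: "('a \<times> 'b) list"
    using tensor_eq_append[OF that] by simp
  have zeros: "tensor_eq (map (\<lambda>(x, y). (0 *\<^sub>C x, y)) u) []" for u :: "('a \<times> 'b) list"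
  proof (induction u)
    case (Cons p u)
    show ?case
      using tensor_eq_append[OF tensor_eq_zero[of "snd p"] Cons] by (cases p) simp
  qed (simp add: tensor_eq_refl)
  have split: "tensor_eq (map (\<lambda>(x, y). ((c + d) *\<^sub>C x, y)) u)
      (map (\<lambda>(x, y). (c *\<^sub>C x, y)) u @ map (\<lambda>(x, y). (d *\<^sub>C x, y)) u)"
    for c d and u :: "('a \<times> 'b) list"
  proof (induction u)
    case (Cons p u)
    obtain x y where p: "p = (x, y)" by (cases p)
    let ?f = "\<lambda>c. (\<lambda>(x, y). (c *\<^sub>C x, y)) :: 'a \<times> 'b \<Rightarrow> 'a \<times> 'b"
    have "tensor_eq [?f (c + d) p] [?f c p, ?f d p]"
      unfolding p by (simp add: scaleC_add_left tensor_eq_add_left)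
    from tensor_eq_append[OF this Cons]
    have "tensor_eq (map (?f (c + d)) (p # u)) (?f c p # (?f d p # map (?f c) u) @ map (?f d) u)"
      by simp
    moreover have "tensor_eq ((?f d p # map (?f c) u) @ map (?f d) u)
        ((map (?f c) u @ [?f d p]) @ map (?f d) u)"
      using tensor_eq_append[OF tensor_eq_commute[of "[?f d p]" "map (?f c) u"] tensor_eq_refl] by simp
    ultimately show ?case using cons tensor_eq_trans by fastforce
  qed (simp add: tensor_eq_refl)
  fix r s t :: "('a, 'b) tensor" and c d :: complex
  show "r + s + t = r + (s + t)" by transfer (simp add: tensor_eq_refl)
  show "r + s = s + r" by transfer (rule tensor_eq_commute)
  show "0 + r = r" by transfer (simp add: tensor_eq_refl)
  show "c *\<^sub>C (r + s) = c *\<^sub>C r + c *\<^sub>C s" by transfer (simp add: tensor_eq_refl)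
  show add: "(c + d) *\<^sub>C r = c *\<^sub>C r + d *\<^sub>C r" for c d by transfer (rule split)
  show "c *\<^sub>C d *\<^sub>C r = (c * d) *\<^sub>C r"
    by transfer (simp add: o_def case_prod_unfold scaleC_scaleC tensor_eq_refl)
  show one: "1 *\<^sub>C r = r"
    by transfer (simp add: scaleC_one tensor_eq_refl)
  have "0 *\<^sub>C r = 0" by transfer (rule zeros)
  with add[of "- 1" 1] one show "- r + r = 0" by (simp add: uminus_tensor_def)
  show "r - s = r + - s" by (simp add: uminus_tensor_def minus_tensor_def)
qed

end

text \<open>
  The linear map on the tensor product induced by \<open>f\<close>; meaningful for bilinear \<open>f\<close>, as
  \<open>tlift_tensor\<close> and \<open>clinear_tlift\<close> below show.
\<close>

definition tlift ::
    "('a::complex_vector \<Rightarrow> 'b::complex_vector \<Rightarrow> 'c::complex_vector) \<Rightarrow> ('a, 'b) tensor \<Rightarrow> 'c"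
  where "tlift f t = (\<Sum>(x, y)\<leftarrow>rep_tensor t. f x y)"

lemma tensor_eq_sum_list:
  assumes "cbilinear f" and "tensor_eq u v"
  shows "(\<Sum>(x, y)\<leftarrow>u. f x y) = (\<Sum>(x, y)\<leftarrow>v. f x y)"
  using assms(2) by (induction rule: tensor_eq.induct) (simp_all add: cbilinearD[OF assms(1)] add.commute)

lemma tlift_abs:
  assumes "cbilinear f"
  shows "tlift f (abs_tensor u) = (\<Sum>(x, y)\<leftarrow>u. f x y)"
  unfolding tlift_def
  by (rule tensor_eq_sum_list[OF assms])
    (meson Quotient3_rep_abs Quotient3_tensor tensor_eq_refl)

lemma tlift_tensor: "cbilinear f \<Longrightarrow> tlift f (x \<otimes> y) = f x y"
  by (simp add: tensor.abs_eq tlift_abs)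

lemma tlift_add: "cbilinear f \<Longrightarrow> tlift f (s + t) = tlift f s + tlift f t"
  by (induction s; induction t) (simp add: plus_tensor.abs_eq tlift_abs)

lemma tlift_scaleC: "cbilinear f \<Longrightarrow> tlift f (c *\<^sub>C t) = c *\<^sub>C tlift f t"
proof (induction t)
  case (1 u)
  have "(\<Sum>(x, y)\<leftarrow>map (\<lambda>(x, y). (c *\<^sub>C x, y)) u. f x y) = c *\<^sub>C (\<Sum>(x, y)\<leftarrow>u. f x y)"
    by (induction u) (auto simp: cbilinearD[OF 1] scaleC_add_right)
  then show ?case by (simp add: scaleC_tensor.abs_eq tlift_abs 1)
qed

lemma clinear_tlift: "cbilinear f \<Longrightarrow> clinear (tlift f)"
  by (intro clinearI tlift_add tlift_scaleC)

lemma tensor_bilinear: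
  "(x + x') \<otimes> y = x \<otimes> y + x' \<otimes> y" "x \<otimes> (y + y') = x \<otimes> y + x \<otimes> y'"
  "(c *\<^sub>C x) \<otimes> y = c *\<^sub>C (x \<otimes> y)" "x \<otimes> (c *\<^sub>C y) = c *\<^sub>C (x \<otimes> y)"
  by (transfer, auto intro: tensor_eq.intros)+

lemma tensor_induct [case_names tensor add, induct type: tensor]:
  assumes "\<And>x y. P (x \<otimes> y)" and "\<And>s t. P s \<Longrightarrow> P t \<Longrightarrow> P (s + t)"
  shows "P t"
proof -
  have "P (abs_tensor u)" for u
  proof (induction u)
    case Nil
    have "abs_tensor [] = (0::('a, 'b) tensor)" by (simp add: zero_tensor.abs_eq)
    also have "\<dots> = 0 *\<^sub>C (0 \<otimes> 0)" by simp
    also have "\<dots> = (0 *\<^sub>C 0) \<otimes> 0" by (simp only: tensor_bilinear)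
    finally show ?case using assms(1) by simp
  next
    case (Cons p u)
    have "abs_tensor (p # u) = fst p \<otimes> snd p + abs_tensor u"
      by (simp add: tensor.abs_eq plus_tensor.abs_eq)
    then show ?case using assms Cons by simp
  qed
  then show ?thesis by (induction t rule: tensor.abs_induct)
qed

lemma clinear_eq_tensor:
  assumes "clinear f" "clinear g" and "\<And>x y. f (x \<otimes> y) = g (x \<otimes> y)"
  shows "f t = g t"
  by (induction t) (simp_all add: assms clinearD)

instantiation tensor :: ("{complex_vector, times}", "{complex_vector, times}") times
begin

definition times_tensor :: "('a, 'b) tensor \<Rightarrow> ('a, 'b) tensor \<Rightarrow> ('a, 'b) tensor"
  where "times_tensor s t = tlift (\<lambda>x y. tlift (\<lambda>x' y'. (x * x') \<otimes> (y * y')) t) s"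

instance ..

end

lemma cbilinear_times_tensor:
  fixes x :: "'a::complex_algebra" and y :: "'b::complex_algebra"
  shows "cbilinear (\<lambda>x' y'. (x * x') \<otimes> (y * y'))"
    and "cbilinear (\<lambda>x' y'. (x' * x) \<otimes> (y' * y))"
    and "cbilinear (\<lambda>(x::'a) (y::'b). tlift (\<lambda>x' y'. (x * x') \<otimes> (y * y')) t)"
proof -
  show *: "cbilinear (\<lambda>x' y'. (x * x') \<otimes> (y * y'))"
    and **: "cbilinear (\<lambda>x' y'. (x' * x) \<otimes> (y' * y))" for x :: 'a and y :: 'b
    by (rule cbilinearI;
        simp add: tensor_bilinear distrib_left distrib_right mult_scaleC_left mult_scaleC_right)+
  show "cbilinear (\<lambda>(x::'a) (y::'b). tlift (\<lambda>x' y'. (x * x') \<otimes> (y * y')) t)"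
  proof (induction t)
    case (tensor x y)
    then show ?case by (simp add: * ** tlift_tensor)
  next
    case (add s t)
    then show ?case
      by (auto intro!: cbilinearI simp: * tlift_add cbilinearD[OF add(1)] cbilinearD[OF add(2)]
          scaleC_add_right)
  qed
qed

lemma tensor_times:
  fixes x :: "'a::complex_algebra" and y :: "'b::complex_algebra"
  shows "(x \<otimes> y) * t = tlift (\<lambda>x' y'. (x * x') \<otimes> (y * y')) t"
  unfolding times_tensor_def by (rule tlift_tensor) (rule cbilinear_times_tensor)

lemma tensor_times_tensor:
  fixes x x' :: "'a::complex_algebra" and y y' :: "'b::complex_algebra"
  shows "(x \<otimes> y) * (x' \<otimes> y') = (x * x') \<otimes> (y * y')"
  unfolding tensor_times by (rule tlift_tensor) (rule cbilinear_times_tensor)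

instance tensor :: (complex_algebra, complex_algebra) complex_algebra
proof
  fix r s t :: "('a, 'b) tensor" and c :: complex
  show l: "(r + s) * t = r * t + s * t" for r s t :: "('a, 'b) tensor"
    by (simp add: times_tensor_def cbilinear_times_tensor tlift_add)
  show "(c *\<^sub>C r) * s = c *\<^sub>C (r * s)"
    by (simp add: times_tensor_def cbilinear_times_tensor tlift_scaleC)
  show r: "r * (s + t) = r * s + r * t" for r s t :: "('a, 'b) tensor"
  proof (induction r)
    case (tensor x y)
    show ?case by (simp add: tensor_times cbilinear_times_tensor tlift_add)
  qed (simp add: l add_ac)
  show "r * (c *\<^sub>C s) = c *\<^sub>C (r * s)"
  proof (induction r)
    case (tensor x y)
    show ?case by (simp add: tensor_times cbilinear_times_tensor tlift_scaleC)
  qed (simp add: l scaleC_add_right)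
  have tt: "x \<otimes> y * (x' \<otimes> y') * t = x \<otimes> y * (x' \<otimes> y' * t)" for x x' :: 'a and y y' :: 'b and t
    by (induction t) (simp_all add: r tensor_times_tensor mult.assoc)
  have tt': "x \<otimes> y * s * t = x \<otimes> y * (s * t)" for x :: 'a and y :: 'b and s t
    by (induction s) (simp_all add: l r tt)
  show "r * s * t = r * (s * t)"
    by (induction r) (simp_all add: l tt')
qed

definition tensor_flip :: "('a::complex_vector, 'b::complex_vector) tensor \<Rightarrow> ('b, 'a) tensor"
  where "tensor_flip = tlift (\<lambda>x y. y \<otimes> x)"

definition tensor_assoc ::
    "(('a::complex_vector, 'b::complex_vector) tensor, 'c::complex_vector) tensor
      \<Rightarrow> ('a, ('b, 'c) tensor) tensor"
  where "tensor_assoc = tlift (\<lambda>s z. tlift (\<lambda>x y. x \<otimes> (y \<otimes> z)) s)"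

definition tensor_map ::
    "('a::complex_vector \<Rightarrow> 'c::complex_vector) \<Rightarrow> ('b::complex_vector \<Rightarrow> 'd::complex_vector)
      \<Rightarrow> ('a, 'b) tensor \<Rightarrow> ('c, 'd) tensor"
  where "tensor_map f g = tlift (\<lambda>x y. f x \<otimes> g y)"


section \<open>Multipliers\<close>

text \<open>
  A multiplier is a pair of a left multiplier \<open>L\<close> (written \<open>x \<mapsto> m x\<close>) and a right multiplier
  \<open>R\<close> (written \<open>x \<mapsto> x m\<close>) with \<open>x (m y) = (x m) y\<close>.  The type is formed over any complex
  vector space with a multiplication symbol, because for the dual and the Heisenberg algebra
  below the algebra laws are theorems rather than part of the definition.
\<close>

typedef (overloaded) 'a multiplier =
  "{(L, R). clinear L \<and> clinear R \<and> (\<forall>x y. L (x * y) = L x * y) \<and>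
     (\<forall>x y. R (x * y) = x * R y) \<and> (\<forall>x y::'a::{complex_vector, times}. x * L y = R x * y)}"
proof
  show "(\<lambda>x. x, \<lambda>x. x) \<in> {(L, R). clinear L \<and> clinear R \<and> (\<forall>x y. L (x * y) = L x * y) \<and>
     (\<forall>x y. R (x * y) = x * R y) \<and> (\<forall>x y::'a. x * L y = R x * y)}"
    by (simp add: clinearI)
qed

setup_lifting type_definition_multiplier

lift_definition lapp :: "'a::{complex_vector, times} multiplier \<Rightarrow> 'a \<Rightarrow> 'a" is fst .

lift_definition rapp :: "'a::{complex_vector, times} \<Rightarrow> 'a multiplier \<Rightarrow> 'a" is "\<lambda>x m. snd m x" .

instantiation multiplier :: ("{complex_vector, times}") monoid_mult
begin

lift_definition one_multiplier :: "'a multiplier" is "(\<lambda>x. x, \<lambda>x. x)"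
  by (simp add: clinearI)

lift_definition times_multiplier :: "'a multiplier \<Rightarrow> 'a multiplier \<Rightarrow> 'a multiplier"
  is "\<lambda>(L, R) (L', R'). (\<lambda>x. L (L' x), \<lambda>x. R' (R x))"
  by (force intro!: clinearI simp: clinearD)

instance
  by standard (transfer, auto)+

end

instantiation multiplier :: (complex_algebra) complex_algebra
begin

lift_definition zero_multiplier :: "'a multiplier" is "(\<lambda>x. 0, \<lambda>x. 0)"
  by (simp add: clinearI)

lift_definition plus_multiplier :: "'a multiplier \<Rightarrow> 'a multiplier \<Rightarrow> 'a multiplier"
  is "\<lambda>(L, R) (L', R'). (\<lambda>x. L x + L' x, \<lambda>x. R x + R' x)"
  by (force intro!: clinearI simp: clinearD distrib_left distrib_right scaleC_add_right)

lift_definition scaleC_multiplier :: "complex \<Rightarrow> 'a multiplier \<Rightarrow> 'a multiplier"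
  is "\<lambda>c (L, R). (\<lambda>x. c *\<^sub>C L x, \<lambda>x. c *\<^sub>C R x)"
  by (force intro!: clinearI
      simp: clinearD mult_scaleC_left mult_scaleC_right scaleC_add_right scaleC_scaleC mult.commute)

definition uminus_multiplier :: "'a multiplier \<Rightarrow> 'a multiplier"
  where "uminus_multiplier m = (- 1) *\<^sub>C m"

definition minus_multiplier :: "'a multiplier \<Rightarrow> 'a multiplier \<Rightarrow> 'a multiplier"
  where "minus_multiplier m n = m + (- 1) *\<^sub>C n"

instance
proof
  fix m n k :: "'a multiplier" and c d :: complex
  show "m + n + k = m + (n + k)" "m + n = n + m" "0 + m = m"
    by (transfer, auto simp: add_ac)+
  show "c *\<^sub>C (m + n) = c *\<^sub>C m + c *\<^sub>C n" "c *\<^sub>C d *\<^sub>C m = (c * d) *\<^sub>C m" "1 *\<^sub>C m = m"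
    by (transfer, auto simp: scaleC_add_right scaleC_scaleC scaleC_one)+
  show "(c + d) *\<^sub>C m = c *\<^sub>C m + d *\<^sub>C m"
    by (transfer, auto simp: scaleC_add_left)
  show "- m + m = 0" unfolding uminus_multiplier_def by (transfer, auto)
  show "m - n = m + - n" unfolding uminus_multiplier_def minus_multiplier_def ..
  show "(m + n) * k = m * k + n * k" "m * (n + k) = m * n + m * k"
    "(c *\<^sub>C m) * n = c *\<^sub>C (m * n)" "m * (c *\<^sub>C n) = c *\<^sub>C (m * n)"
    by (transfer, auto simp: clinearD)+
qed

end

definition of_alg :: "'a::{complex_vector, times} \<Rightarrow> 'a multiplier"
  where "of_alg x = Abs_multiplier (\<lambda>y. x * y, \<lambda>y. y * x)"

text \<open>For a multiplier that lies in the algebra, \<open>alg_elem\<close> is the element it comes from.\<close>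

definition alg_elem :: "'a::{complex_vector, times} multiplier \<Rightarrow> 'a"
  where "alg_elem m = (THE x. of_alg x = m)"

definition mult_tensor ::
    "'a::{complex_vector, times} multiplier \<Rightarrow> 'b::{complex_vector, times} multiplier
      \<Rightarrow> ('a, 'b) tensor multiplier"  (infixl "\<otimes>\<^sub>m" 71)
  where "m \<otimes>\<^sub>m n = Abs_multiplier
    (tensor_map (lapp m) (lapp n), tensor_map (\<lambda>x. rapp x m) (\<lambda>y. rapp y n))"

definition mult_flip ::
    "('a::{complex_vector, times}, 'b::{complex_vector, times}) tensor multiplier
      \<Rightarrow> ('b, 'a) tensor multiplier"
  where "mult_flip m = Abs_multiplier
    (\<lambda>t. tensor_flip (lapp m (tensor_flip t)), \<lambda>t. tensor_flip (rapp (tensor_flip t) m))"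

text \<open>
  Let \<open>j : X \<rightarrow> M(U)\<close> and \<open>k : Y \<rightarrow> M(W)\<close> be non-degenerate homomorphisms.  Then
  \<open>j \<otimes> k : X \<otimes> Y \<rightarrow> M(U \<otimes> W)\<close> is non-degenerate as well; \<open>mult_extend j k\<close> is its unique
  extension \<open>E : M(X \<otimes> Y) \<rightarrow> M(U \<otimes> W)\<close>, determined by \<open>E(m) (j \<otimes> k)(t) = (j \<otimes> k)(m t)\<close> and
  \<open>(j \<otimes> k)(t) E(m) = (j \<otimes> k)(t m)\<close>.  The two auxiliary functions give \<open>(j \<otimes> k)(t) z\<close> and
  \<open>z (j \<otimes> k)(t)\<close>.
\<close>

definition tensor_hom_left ::
    "('x::complex_vector \<Rightarrow> 'u::{complex_vector, times} multiplier)
      \<Rightarrow> ('y::complex_vector \<Rightarrow> 'w::{complex_vector, times} multiplier)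
      \<Rightarrow> ('x, 'y) tensor \<Rightarrow> ('u, 'w) tensor \<Rightarrow> ('u, 'w) tensor"
  where "tensor_hom_left j k t z = tlift (\<lambda>x y. lapp (j x \<otimes>\<^sub>m k y) z) t"

definition tensor_hom_right ::
    "('x::complex_vector \<Rightarrow> 'u::{complex_vector, times} multiplier)
      \<Rightarrow> ('y::complex_vector \<Rightarrow> 'w::{complex_vector, times} multiplier)
      \<Rightarrow> ('u, 'w) tensor \<Rightarrow> ('x, 'y) tensor \<Rightarrow> ('u, 'w) tensor"
  where "tensor_hom_right j k z t = tlift (\<lambda>x y. rapp z (j x \<otimes>\<^sub>m k y)) t"

definition mult_extend ::
    "('x::{complex_vector, times} \<Rightarrow> 'u::{complex_vector, times} multiplier)
      \<Rightarrow> ('y::{complex_vector, times} \<Rightarrow> 'w::{complex_vector, times} multiplier)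
      \<Rightarrow> ('x, 'y) tensor multiplier \<Rightarrow> ('u, 'w) tensor multiplier"
  where "mult_extend j k m = (THE n. \<forall>t z.
    lapp n (tensor_hom_left j k t z) = tensor_hom_left j k (lapp m t) z \<and>
    rapp (tensor_hom_right j k z t) n = tensor_hom_right j k z (rapp t m))"

lemma of_alg_app:
  fixes x :: "'a::complex_algebra"
  shows "lapp (of_alg x) y = x * y" and "rapp y (of_alg x) = y * x"
proof -
  have "(\<lambda>y. x * y, \<lambda>y. y * x) \<in> {(L, R). clinear L \<and> clinear R \<and> (\<forall>x y. L (x * y) = L x * y) \<and>
     (\<forall>x y. R (x * y) = x * R y) \<and> (\<forall>x y::'a. x * L y = R x * y)}"
    by (auto intro!: clinearI
        simp: distrib_left distrib_right mult_scaleC_left mult_scaleC_right mult.assoc)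
  then show "lapp (of_alg x) y = x * y" and "rapp y (of_alg x) = y * x"
    by (simp_all add: lapp.rep_eq rapp.rep_eq of_alg_def Abs_multiplier_inverse)
qed

lemma multiplierD:
  shows "clinear (lapp m)" and "clinear (\<lambda>x. rapp x m)"
    and "lapp m (x * y) = lapp m x * y" and "rapp (x * y) m = x * rapp y m"
    and "x * lapp m y = rapp x m * y"
  by (transfer, force)+

lemma cbilinear_tensor_map: "clinear f \<Longrightarrow> clinear g \<Longrightarrow> cbilinear (\<lambda>x y. f x \<otimes> g y)"
  by (auto intro!: cbilinearI simp: clinearD tensor_bilinear)

lemma tensor_map_tensor: "clinear f \<Longrightarrow> clinear g \<Longrightarrow> tensor_map f g (x \<otimes> y) = f x \<otimes> g y"
  unfolding tensor_map_def by (rule tlift_tensor) (rule cbilinear_tensor_map)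

lemma clinear_tensor_map: "clinear f \<Longrightarrow> clinear g \<Longrightarrow> clinear (tensor_map f g)"
  unfolding tensor_map_def by (intro clinear_tlift cbilinear_tensor_map)

lemma tensor_flip_tensor: "tensor_flip (x \<otimes> y) = y \<otimes> x"
  and clinear_tensor_flip: "clinear tensor_flip"
proof -
  have "cbilinear (\<lambda>x y. y \<otimes> x)" by (rule cbilinearI) (simp_all add: tensor_bilinear)
  then show "tensor_flip (x \<otimes> y) = y \<otimes> x" and "clinear tensor_flip"
    unfolding tensor_flip_def by (rule tlift_tensor, rule clinear_tlift)
qed

lemma tensor_mult_eqI:
  fixes f g :: "('a::complex_algebra, 'b::complex_algebra) tensor \<Rightarrow> ('a, 'b) tensor"
  assumes "clinear f" "clinear g"
    and "\<And>x y x' y'. f (x \<otimes> y) * (x' \<otimes> y') = (x \<otimes> y) * g (x' \<otimes> y')"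
  shows "f s * t = s * g t"
proof -
  have *: "f (x \<otimes> y) * t = (x \<otimes> y) * g t" for x y
    by (induction t) (simp_all add: assms clinearD distrib_left)
  show ?thesis by (induction s) (simp_all add: * assms clinearD distrib_right)
qed

lemma mult_tensor_app:
  fixes m :: "'a::complex_algebra multiplier" and n :: "'b::complex_algebra multiplier"
  shows "lapp (m \<otimes>\<^sub>m n) (x \<otimes> y) = lapp m x \<otimes> lapp n y"
    and "rapp (x \<otimes> y) (m \<otimes>\<^sub>m n) = rapp x m \<otimes> rapp y n"
proof -
  let ?L = "tensor_map (lapp m) (lapp n)" and ?R = "tensor_map (\<lambda>x. rapp x m) (\<lambda>y. rapp y n)"
  note l = multiplierD(1)[of m] multiplierD(1)[of n] multiplierD(2)[of m] multiplierD(2)[of n]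
  have "?L (s * t) = ?L s * t" "?R (s * t) = s * ?R t" "s * ?L t = ?R s * t" for s t
  proof -
    have "?L ((x \<otimes> y) * t) = ?L (x \<otimes> y) * t" for x y
      by (induction t) (simp_all add: distrib_left clinearD[OF clinear_tensor_map[OF l(1,2)]]
          tensor_map_tensor[OF l(1,2)] tensor_times_tensor multiplierD)
    then show "?L (s * t) = ?L s * t"
      by (induction s) (simp_all add: distrib_right clinearD[OF clinear_tensor_map[OF l(1,2)]])
    have "?R ((x \<otimes> y) * t) = (x \<otimes> y) * ?R t" for x y
      by (induction t) (simp_all add: distrib_left clinearD[OF clinear_tensor_map[OF l(3,4)]]
          tensor_map_tensor[OF l(3,4)] tensor_times_tensor multiplierD)
    then show "?R (s * t) = s * ?R t"
      by (induction s) (simp_all add: distrib_right clinearD[OF clinear_tensor_map[OF l(3,4)]])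
    show "s * ?L t = ?R s * t"
      by (rule tensor_mult_eqI[symmetric])
        (simp_all add: clinear_tensor_map l tensor_map_tensor tensor_times_tensor multiplierD(5))
  qed
  then have "(?L, ?R) \<in> {(L, R). clinear L \<and> clinear R \<and> (\<forall>s t. L (s * t) = L s * t) \<and>
     (\<forall>s t. R (s * t) = s * R t) \<and> (\<forall>s t. s * L t = R s * t)}"
    by (simp add: clinear_tensor_map l)
  then have "Rep_multiplier (m \<otimes>\<^sub>m n) = (?L, ?R)"
    unfolding mult_tensor_def by (rule Abs_multiplier_inverse)
  then show "lapp (m \<otimes>\<^sub>m n) (x \<otimes> y) = lapp m x \<otimes> lapp n y"
    and "rapp (x \<otimes> y) (m \<otimes>\<^sub>m n) = rapp x m \<otimes> rapp y n"
    by (simp_all only: lapp.rep_eq[of "m \<otimes>\<^sub>m n"] rapp.rep_eq[of _ "m \<otimes>\<^sub>m n"]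
        fst_conv snd_conv tensor_map_tensor l)
qed


section \<open>Algebraic quantum groups\<close>

text \<open>The elements \<open>\<Delta>(a)(1 \<otimes> a')\<close> and \<open>(a \<otimes> 1)\<Delta>(a')\<close> of \<open>A \<otimes> A\<close>.\<close>

definition comult_right ::
    "('a::complex_algebra \<Rightarrow> ('a, 'a) tensor multiplier) \<Rightarrow> 'a \<Rightarrow> 'a \<Rightarrow> ('a, 'a) tensor"
  where "comult_right \<Delta> a a' = alg_elem (\<Delta> a * (1 \<otimes>\<^sub>m of_alg a'))"

definition comult_left ::
    "('a::complex_algebra \<Rightarrow> ('a, 'a) tensor multiplier) \<Rightarrow> 'a \<Rightarrow> 'a \<Rightarrow> ('a, 'a) tensor"
  where "comult_left \<Delta> a a' = alg_elem ((of_alg a \<otimes>\<^sub>m 1) * \<Delta> a')"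

text \<open>
  In coassociativity both sides are written as elements of \<open>A \<otimes> A \<otimes> A\<close>: with
  \<open>\<Delta>(c)(1 \<otimes> a') = \<Sum> p \<otimes> q\<close>, the left-hand side \<open>(a \<otimes> 1 \<otimes> 1)(\<Delta> \<otimes> \<iota>)(\<Delta>(c)(1 \<otimes> a'))\<close> is
  \<open>\<Sum> (a \<otimes> 1)\<Delta>(p) \<otimes> q\<close>, and similarly for the right-hand side.
\<close>

definition regular_multiplier_hopf_algebra ::
    "('a::nondegenerate_algebra \<Rightarrow> ('a, 'a) tensor multiplier) \<Rightarrow> bool"
  where "regular_multiplier_hopf_algebra \<Delta> \<longleftrightarrow>
    clinear \<Delta> \<and> (\<forall>a a'. \<Delta> (a * a') = \<Delta> a * \<Delta> a') \<and>
    (\<forall>a a'. \<Delta> a * (1 \<otimes>\<^sub>m of_alg a') \<in> range of_alg \<and>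
       (of_alg a \<otimes>\<^sub>m 1) * \<Delta> a' \<in> range of_alg \<and>
       \<Delta> a * (of_alg a' \<otimes>\<^sub>m 1) \<in> range of_alg \<and>
       (1 \<otimes>\<^sub>m of_alg a) * \<Delta> a' \<in> range of_alg) \<and>
    (\<forall>a c a'. tensor_assoc (tlift (\<lambda>p q. comult_left \<Delta> a p \<otimes> q) (comult_right \<Delta> c a'))
       = tlift (\<lambda>p q. p \<otimes> comult_right \<Delta> q a') (comult_left \<Delta> a c)) \<and>
    bij (tlift (comult_right \<Delta>)) \<and> bij (tlift (comult_left \<Delta>)) \<and>
    bij (tlift (comult_right (\<lambda>a. mult_flip (\<Delta> a)))) \<and>
    bij (tlift (comult_left (\<lambda>a. mult_flip (\<Delta> a))))"

definition slice_right :: "('b::complex_vector \<Rightarrow> complex) \<Rightarrow> ('a::complex_vector, 'b) tensor \<Rightarrow> 'a"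
  where "slice_right \<phi> = tlift (\<lambda>x y. \<phi> y *\<^sub>C x)"

definition slice_left :: "('a::complex_vector \<Rightarrow> complex) \<Rightarrow> ('a, 'b::complex_vector) tensor \<Rightarrow> 'b"
  where "slice_left \<psi> = tlift (\<lambda>x y. \<psi> x *\<^sub>C y)"

text \<open>
  \<open>(\<iota> \<otimes> \<phi>)\<Delta>(a)\<close> is the multiplier given by \<open>x \<mapsto> (\<iota> \<otimes> \<phi>)(\<Delta>(a)(x \<otimes> 1))\<close> and
  \<open>x \<mapsto> (\<iota> \<otimes> \<phi>)((x \<otimes> 1)\<Delta>(a))\<close>; invariance says that it equals \<open>\<phi>(a) 1\<close>.
\<close>

definition left_integral ::
    "('a::complex_algebra \<Rightarrow> ('a, 'a) tensor multiplier) \<Rightarrow> ('a \<Rightarrow> complex) \<Rightarrow> bool"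
  where "left_integral \<Delta> \<phi> \<longleftrightarrow> clinear \<phi> \<and> (\<exists>a. \<phi> a \<noteq> 0) \<and>
    (\<forall>a x. slice_right \<phi> (alg_elem (\<Delta> a * (of_alg x \<otimes>\<^sub>m 1))) = \<phi> a *\<^sub>C x \<and>
       slice_right \<phi> (alg_elem ((of_alg x \<otimes>\<^sub>m 1) * \<Delta> a)) = \<phi> a *\<^sub>C x)"

definition right_integral ::
    "('a::complex_algebra \<Rightarrow> ('a, 'a) tensor multiplier) \<Rightarrow> ('a \<Rightarrow> complex) \<Rightarrow> bool"
  where "right_integral \<Delta> \<psi> \<longleftrightarrow> clinear \<psi> \<and> (\<exists>a. \<psi> a \<noteq> 0) \<and>
    (\<forall>a x. slice_left \<psi> (alg_elem (\<Delta> a * (1 \<otimes>\<^sub>m of_alg x))) = \<psi> a *\<^sub>C x \<and>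
       slice_left \<psi> (alg_elem ((1 \<otimes>\<^sub>m of_alg x) * \<Delta> a)) = \<psi> a *\<^sub>C x)"

text \<open>
  Algebraic quantum groups \<open>(A, \<Delta>)\<close> with a fixed left integral.  The superclass
  \<^class>\<open>nondegenerate_algebra\<close> is inferred from the sort of
  \<^const>\<open>regular_multiplier_hopf_algebra\<close>; it cannot be written down, because class axioms
  may not mention predicates with a sort constraint once a superclass is named.
\<close>

class algebraic_quantum_group =
  fixes comult :: "_ \<Rightarrow> (_, _) tensor multiplier"
    and left_int :: "_ \<Rightarrow> complex"
  assumes regular_multiplier_hopf_algebra_comult: "regular_multiplier_hopf_algebra comult"
    and left_integral_left_int: "left_integral comult left_int"
    and right_integral_exists: "\<exists>\<psi>. right_integral comult \<psi>"


section \<open>The dual\<close>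

typedef (overloaded) 'a dual =
  "{\<omega>. \<exists>c::'a::algebraic_quantum_group. \<omega> = (\<lambda>a. left_int (a * c))}"
  by blast

setup_lifting type_definition_dual

lift_definition pairing :: "'a::algebraic_quantum_group \<Rightarrow> 'a dual \<Rightarrow> complex" is "\<lambda>a \<omega>. \<omega> a" .

lemma clinear_left_int: "clinear (left_int :: 'a::algebraic_quantum_group \<Rightarrow> complex)"
  using left_integral_left_int by (auto simp: left_integral_def)

instantiation dual :: (algebraic_quantum_group) complex_vector
begin

lift_definition zero_dual :: "'a dual" is "\<lambda>a. 0"
  by (rule exI[of _ 0]) (simp add: clinearD[OF clinear_left_int])

lift_definition plus_dual :: "'a dual \<Rightarrow> 'a dual \<Rightarrow> 'a dual" is "\<lambda>\<omega> \<omega>' a. \<omega> a + \<omega>' a"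
proof clarify
  fix c d :: 'a
  show "\<exists>e. (\<lambda>a. left_int (a * c) + left_int (a * d)) = (\<lambda>a. left_int (a * e))"
    by (rule exI[of _ "c + d"]) (simp add: clinearD[OF clinear_left_int] distrib_left)
qed

lift_definition scaleC_dual :: "complex \<Rightarrow> 'a dual \<Rightarrow> 'a dual" is "\<lambda>c \<omega> a. c * \<omega> a"
proof clarify
  fix c and d :: 'a
  show "\<exists>e. (\<lambda>a. c * left_int (a * d)) = (\<lambda>a. left_int (a * e))"
    by (rule exI[of _ "c *\<^sub>C d"])
      (simp add: clinearD[OF clinear_left_int] mult_scaleC_right scaleC_complex_def)
qed

definition uminus_dual :: "'a dual \<Rightarrow> 'a dual"
  where "uminus_dual b = (- 1) *\<^sub>C b"

definition minus_dual :: "'a dual \<Rightarrow> 'a dual \<Rightarrow> 'a dual"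
  where "minus_dual b d = b + (- 1) *\<^sub>C d"

instance
proof
  fix b d e :: "'a dual" and x y :: complex
  show "b + d + e = b + (d + e)" "b + d = d + b" "0 + b = b"
    "x *\<^sub>C (b + d) = x *\<^sub>C b + x *\<^sub>C d" "(x + y) *\<^sub>C b = x *\<^sub>C b + y *\<^sub>C b"
    "x *\<^sub>C y *\<^sub>C b = (x * y) *\<^sub>C b" "1 *\<^sub>C b = b"
    by (transfer, simp add: algebra_simps)+
  show "- b + b = 0" unfolding uminus_dual_def by (transfer, simp)
  show "b - d = b + - d" unfolding uminus_dual_def minus_dual_def ..
qed

end

text \<open>
  \<open>dual_rep b\<close> is the element \<open>c\<close> with \<open>b = \<phi>( \<cdot> c)\<close>.  For \<open>b = \<phi>( \<cdot> c)\<close> and \<open>b' = \<phi>( \<cdot> c')\<close> the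
  functional \<open>b \<otimes> b'\<close> is extended to \<open>M(A \<otimes> A)\<close> by \<open>\<langle>m, b \<otimes> b'\<rangle> = (\<phi> \<otimes> \<phi>)(m (c \<otimes> c'))\<close>.
\<close>

definition dual_rep :: "'a::algebraic_quantum_group dual \<Rightarrow> 'a"
  where "dual_rep b = (SOME c. \<forall>a. pairing a b = left_int (a * c))"

definition mult_pairing ::
    "('a::algebraic_quantum_group, 'a) tensor multiplier \<Rightarrow> 'a dual \<Rightarrow> 'a dual \<Rightarrow> complex"
  where "mult_pairing m b b' =
    tlift (\<lambda>x y. left_int x * left_int y) (lapp m (dual_rep b \<otimes> dual_rep b'))"

instantiation dual :: (algebraic_quantum_group) times
begin

definition times_dual :: "'a dual \<Rightarrow> 'a dual \<Rightarrow> 'a dual"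
  where "times_dual b b' = (THE d. \<forall>a. pairing a d = mult_pairing (comult a) b b')"

instance ..

end

definition tensor_pairing ::
    "('a::algebraic_quantum_group, 'a) tensor \<Rightarrow> ('a dual, 'a dual) tensor \<Rightarrow> complex"
  where "tensor_pairing s t =
    tlift (\<lambda>a a'. tlift (\<lambda>b b'. pairing a b * pairing a' b') t) s"

definition dual_comult ::
    "'a::algebraic_quantum_group dual \<Rightarrow> ('a dual, 'a dual) tensor multiplier"
  where "dual_comult b = (THE m. \<forall>b'.
    (\<exists>t. (of_alg b' \<otimes>\<^sub>m 1) * m = of_alg t \<and>
       (\<forall>a a'. tensor_pairing (a \<otimes> a') t = tensor_pairing (comult_right comult a a') (b' \<otimes> b))) \<and>
    (\<exists>t. m * (1 \<otimes>\<^sub>m of_alg b') = of_alg t \<and>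
       (\<forall>a a'. tensor_pairing (a \<otimes> a') t = tensor_pairing (comult_left comult a a') (b \<otimes> b'))))"


section \<open>The pairing of multipliers with tensors\<close>

definition act_dual :: "'a::algebraic_quantum_group \<Rightarrow> 'a dual \<Rightarrow> 'a dual"  (infixr "\<triangleright>\<^sub>B" 72)
  where "a \<triangleright>\<^sub>B b = (THE d. \<forall>a'. pairing a' d = pairing (a' * a) b)"

definition act_alg :: "'a::algebraic_quantum_group dual \<Rightarrow> 'a \<Rightarrow> 'a"  (infixr "\<triangleright>\<^sub>A" 72)
  where "b \<triangleright>\<^sub>A a = (THE x. \<forall>b'. pairing x b' = pairing a (b' * b))"

definition cross_pairing ::
    "('a::algebraic_quantum_group dual, 'a) tensor \<Rightarrow> ('a, 'a dual) tensor \<Rightarrow> complex"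
  where "cross_pairing s t =
    tlift (\<lambda>b a. tlift (\<lambda>a' b'. pairing a' b * pairing a b') t) s"

definition mult_cross_pairing ::
    "('a::algebraic_quantum_group dual, 'a) tensor multiplier \<Rightarrow> ('a, 'a dual) tensor \<Rightarrow> complex"
  where "mult_cross_pairing m = (THE F. clinear F \<and>
    (\<forall>a a' b b'. F ((b \<triangleright>\<^sub>A a') \<otimes> (a \<triangleright>\<^sub>B b')) = cross_pairing (lapp m (b \<otimes> a)) (a' \<otimes> b')))"


section \<open>The Heisenberg algebra\<close>

text \<open>
  \<open>heisenberg_twist a b\<close> is \<open>R(a \<otimes> b) = \<Sum> \<langle>a\<^sub>2, b\<^sub>1\<rangle> a\<^sub>1 \<otimes> b\<^sub>2\<close>.  Pairing the Sweedler expression with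
  \<open>b' \<otimes> a'\<close> gives \<open>\<Sum> \<langle>a\<^sub>1, b'\<rangle> \<langle>a\<^sub>2, b\<^sub>1\<rangle> \<langle>a', b\<^sub>2\<rangle>\<close>, and by the definition of the coproduct of \<open>B\<close> this
  is \<open>\<Sum> \<langle>a\<^sub>1, b'\<rangle> \<langle>a\<^sub>2 a', b\<rangle> = \<langle>\<Delta>(a)(1 \<otimes> a'), b' \<otimes> b\<rangle>\<close>, where the coproduct is covered.
\<close>

definition heisenberg_twist ::
    "'a::algebraic_quantum_group \<Rightarrow> 'a dual \<Rightarrow> ('a, 'a dual) tensor"
  where "heisenberg_twist a b = (THE r. \<forall>a' b'.
    cross_pairing (b' \<otimes> a') r = tensor_pairing (comult_right comult a a') (b' \<otimes> b))"

typedef (overloaded) 'a heisenberg = "UNIV :: ('a::algebraic_quantum_group, 'a dual) tensor set"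
  by blast

definition heis :: "'a::algebraic_quantum_group \<Rightarrow> 'a dual \<Rightarrow> 'a heisenberg"
  where "heis a b = Abs_heisenberg (a \<otimes> b)"

instantiation heisenberg :: (algebraic_quantum_group) "{complex_vector, times}"
begin

definition zero_heisenberg :: "'a heisenberg"
  where "zero_heisenberg = Abs_heisenberg 0"

definition plus_heisenberg :: "'a heisenberg \<Rightarrow> 'a heisenberg \<Rightarrow> 'a heisenberg"
  where "plus_heisenberg s t = Abs_heisenberg (Rep_heisenberg s + Rep_heisenberg t)"

definition minus_heisenberg :: "'a heisenberg \<Rightarrow> 'a heisenberg \<Rightarrow> 'a heisenberg"
  where "minus_heisenberg s t = Abs_heisenberg (Rep_heisenberg s - Rep_heisenberg t)"

definition uminus_heisenberg :: "'a heisenberg \<Rightarrow> 'a heisenberg"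
  where "uminus_heisenberg t = Abs_heisenberg (- Rep_heisenberg t)"

definition scaleC_heisenberg :: "complex \<Rightarrow> 'a heisenberg \<Rightarrow> 'a heisenberg"
  where "scaleC_heisenberg c t = Abs_heisenberg (c *\<^sub>C Rep_heisenberg t)"

text \<open>\<open>(a \<otimes> b)(a' \<otimes> b') = \<Sum> a p \<otimes> q b'\<close>, where \<open>R(a' \<otimes> b) = \<Sum> p \<otimes> q\<close>.\<close>

definition times_heisenberg :: "'a heisenberg \<Rightarrow> 'a heisenberg \<Rightarrow> 'a heisenberg"
  where "times_heisenberg s t = Abs_heisenberg
    (tlift (\<lambda>a b. tlift (\<lambda>a' b'.
       tlift (\<lambda>p q. (a * p) \<otimes> (q * b')) (heisenberg_twist a' b))
       (Rep_heisenberg t)) (Rep_heisenberg s))"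

instance
  by standard
    (simp_all add: zero_heisenberg_def plus_heisenberg_def minus_heisenberg_def
      uminus_heisenberg_def scaleC_heisenberg_def Abs_heisenberg_inverse Rep_heisenberg_inverse
      scaleC_add_left scaleC_add_right scaleC_scaleC scaleC_one add_ac)

end

text \<open>
  The embeddings of \<open>A\<close> and \<open>B\<close> in \<open>M(AB)\<close>.  As \<open>AB\<close> is non-degenerate, a multiplier is determined
  by its left (or by its right) component, so \<open>a (a' b') = (a a') b'\<close> and \<open>(a' b') b = a' (b' b)\<close>
  determine them; the other components involve \<open>heisenberg_twist\<close>.
\<close>

definition heis_alg :: "'a::algebraic_quantum_group \<Rightarrow> 'a heisenberg multiplier"
  where "heis_alg a = (THE m. \<forall>a' b'. lapp m (heis a' b') = heis (a * a') b')"

definition heis_dual :: "'a::algebraic_quantum_group dual \<Rightarrow> 'a heisenberg multiplier"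
  where "heis_dual b = (THE m. \<forall>a' b'. rapp (heis a' b') m = heis a' (b' * b))"

end

theory Submission
  imports Defs
begin

text \<open>
  Both identities are computed on \<open>A \<otimes> A\<close>.  The algebra \<open>A\<close> acts on itself by left multiplication, the
  dual \<open>B\<close> acts on \<open>A\<close> by \<open>b \<triangleright> x = x\<^sub>1 \<langle>x\<^sub>2, b\<rangle>\<close>, and together they give the faithful action of the
  Heisenberg algebra \<open>AB\<close> on \<open>A\<close>.  So \<open>AB \<otimes> A\<close> and \<open>B \<otimes> AB\<close> act faithfully on \<open>A \<otimes> A\<close>, and an
  equation between multipliers may be checked there.

  The condition \<open>\<langle>V, a \<otimes> b\<rangle> = \<langle>a, b\<rangle>\<close> says that \<open>V\<close> acts on \<open>A \<otimes> A\<close> as the canonical map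
  \<open>T1 (x \<otimes> y) = \<Delta>(x)(1 \<otimes> y)\<close> (\<open>canonical_element_act\<close>).  The first formula then reads
  \<open>\<Delta>(a) \<Delta>(x)(1 \<otimes> y) = \<Delta>(a x)(1 \<otimes> y)\<close>, which is the multiplicativity of \<open>\<Delta>\<close>.  For the second one,
  \<open>\<Delta>(b)\<close> acts by \<open>x \<otimes> y \<mapsto> x\<^sub>1 \<otimes> y\<^sub>1 \<langle>x\<^sub>2 y\<^sub>2, b\<rangle>\<close>, and \<open>T1\<close> turns this into
  \<open>x\<^sub>1 \<otimes> x\<^sub>2 y\<^sub>1 \<langle>x\<^sub>3 y\<^sub>2, b\<rangle> = (1 \<otimes> b) \<triangleright> (x\<^sub>1 \<otimes> x\<^sub>2 y)\<close>; thus \<open>\<Delta>(b) = T1\<^sup>-\<^sup>1 (1 \<otimes> b) T1\<close> as operators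
  (\<open>lact2_dual_comult\<close>).

  The objects in the statement are given by definite descriptions, so the larger part of the work is to
  show that they exist.  On the side of \<open>A\<close> this needs the counit, the antipode, and two properties of the
  left integral \<open>\<phi>\<close>: it is faithful (\<open>left_int_faithful_left\<close>), and every functional \<open>\<phi>( \<cdot> c)\<close> is also of
  the form \<open>\<phi>(d \<cdot> )\<close> and of the form \<open>\<psi>(e \<cdot> )\<close> with a right integral \<open>\<psi>\<close> (\<open>left_int_right_integral\<close>,
  \<open>right_integral_left_int_same_side\<close>, \<open>left_int_modular\<close>).  With these properties one finds that \<open>B\<close> is a
  non-degenerate algebra, that \<open>\<Delta>(b)\<close> is a multiplier of \<open>B \<otimes> B\<close>, and that \<open>AB\<close> is the algebra of the finite rank operators on \<open>A\<close> that are
  sums of operators \<open>x \<mapsto> \<phi>(q x) p\<close> (\<open>hact_rank_one\<close>).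

  Extending homomorphisms and pairings to multipliers rests on one principle: a non-degenerate module
  over an algebra is also a module over its multiplier algebra (\<open>module_extension\<close>).
\<close>

section \<open>Linear maps and tensor products\<close>

text \<open>
  Introduction rules that reduce the linearity of a composite expression to the linearity of its parts.
\<close>

named_theorems clin

lemma clinear_compose: "clinear f \<Longrightarrow> clinear g \<Longrightarrow> clinear (\<lambda>x. f (g x))"
  by (rule clinearI) (simp_all add: clinearD)

lemma clinear_diff:
  assumes "clinear f"
  shows "f (x - y) = f x - f y"
  using clinearD(1)[OF assms, of "x - y" y] by simp

lemma clinear_sum:
  assumes "clinear f"
  shows "f (sum g I) = (\<Sum>i\<in>I. f (g i))"
  by (induction I rule: infinite_finite_induct) (simp_all add: clinearD[OF assms])

lemma clinear_sum_list:
  assumes "clinear f"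
  shows "f (sum_list xs) = sum_list (map f xs)"
  by (induction xs) (simp_all add: clinearD[OF assms])

lemma clinear_basic [clin]:
  "clinear (\<lambda>x. x)"
  "clinear f \<Longrightarrow> clinear g \<Longrightarrow> clinear (\<lambda>x. f x + g x)"
  "clinear f \<Longrightarrow> clinear (\<lambda>x. c *\<^sub>C f x)"
  by (auto intro!: clinearI simp: clinearD scaleC_add_right scaleC_scaleC mult.commute)

lemma clinear_scaleC_left [clin]: "clinear f \<Longrightarrow> clinear (\<lambda>x. f x *\<^sub>C v)"
  by (rule clinearI) (simp_all add: clinearD scaleC_add_left scaleC_scaleC scaleC_complex_def)

lemma clinear_tensor [clin]:
  "clinear f \<Longrightarrow> clinear (\<lambda>x. f x \<otimes> v)" "clinear f \<Longrightarrow> clinear (\<lambda>x. v \<otimes> f x)"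
  by (auto intro!: clinearI simp: clinearD tensor_bilinear)

lemma clinear_zero [clin]: "clinear (\<lambda>x. 0)"
  by (rule clinearI) simp_all

instance complex :: complex_algebra
  by standard (simp_all add: scaleC_complex_def)

lemma clinear_times [clin]:
  fixes v :: "'a::complex_algebra"
  shows "clinear f \<Longrightarrow> clinear (\<lambda>x. f x * v)" "clinear f \<Longrightarrow> clinear (\<lambda>x. v * f x)"
  by (auto intro!: clinearI simp: clinearD distrib_left distrib_right mult_scaleC_left mult_scaleC_right)

lemma clinear_tlift_comp [clin]: "cbilinear f \<Longrightarrow> clinear g \<Longrightarrow> clinear (\<lambda>z. tlift f (g z))"
  by (rule clinear_compose[OF clinear_tlift])

lemma cbilinear_clin [clin]:
  "(\<And>y. clinear (\<lambda>x. f x y)) \<Longrightarrow> (\<And>x. clinear (\<lambda>y. f x y)) \<Longrightarrow> cbilinear f"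
  by (simp add: cbilinear_def)

abbreviation mu :: "('a::complex_algebra, 'a) tensor \<Rightarrow> 'a" where "mu \<equiv> tlift (*)"

lemma cbilinear_mu [clin]: "cbilinear ((*) :: 'a::complex_algebra \<Rightarrow> _)"
  by (intro clin)

lemma clinear_tlift_param [clin]:
  "(\<And>x y. clinear (\<lambda>z. F z x y)) \<Longrightarrow> clinear (\<lambda>z. tlift (F z) t)"
proof -
  assume *: "\<And>x y. clinear (\<lambda>z. F z x y)"
  have "clinear (\<lambda>z. \<Sum>(x, y)\<leftarrow>u. F z x y)" for u
    by (induction u) (auto intro!: clin *)
  then show ?thesis unfolding tlift_def .
qed

text \<open>
  Linear maps can be moved into \<^const>\<open>tlift\<close>, because it is a finite sum over a representing list.
\<close>

lemma clinear_tlift_push: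
  assumes "clinear f"
  shows "f (tlift g t) = tlift (\<lambda>x y. f (g x y)) t"
  unfolding tlift_def by (simp add: clinear_sum_list[OF assms] o_def case_prod_unfold)

declare clinear_tensor_flip [clin]

lemma clinear_tensor_flip_comp [clin]: "clinear f \<Longrightarrow> clinear (\<lambda>x. tensor_flip (f x))"
  by (rule clinear_compose[OF clinear_tensor_flip])

lemma tlift_id: "tlift (\<otimes>) t = t"
  by (induction t) (auto simp: tlift_tensor tlift_add clin)

lemma tlift_swap:
  "tlift (\<lambda>x y. tlift (\<lambda>x' y'. f x y x' y') t) s = tlift (\<lambda>x' y'. tlift (\<lambda>x y. f x y x' y') s) t"
proof -
  have swap: "(\<Sum>x\<leftarrow>xs. \<Sum>y\<leftarrow>ys. h x y) = (\<Sum>y\<leftarrow>ys. \<Sum>x\<leftarrow>xs. (h x y :: 'a))" for xs :: "('b \<times> 'c) list" and ys :: "('d \<times> 'e) list" and h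
    by (induction xs) (simp_all add: sum_list_addf)
  show ?thesis
    unfolding tlift_def by (simp add: case_prod_unfold swap[of "\<lambda>x y. f (fst x) (snd x) (fst y) (snd y)"])
qed

lemma clinear_tensor_map_comp [clin]:
  "clinear f \<Longrightarrow> clinear g \<Longrightarrow> clinear h \<Longrightarrow> clinear (\<lambda>z. tensor_map f g (h z))"
  by (rule clinear_compose[OF clinear_tensor_map])

lemma tensor_map_compose:
  assumes "clinear f" "clinear g" "clinear f'" "clinear g'"
  shows "tensor_map f g (tensor_map f' g' t) = tensor_map (\<lambda>x. f (f' x)) (\<lambda>x. g (g' x)) t"
  by (rule clinear_eq_tensor[where t=t])
    (auto intro!: clin assms clinear_compose[OF assms(1,3)] clinear_compose[OF assms(2,4)]
      simp: tensor_map_tensor assms clinear_compose[OF assms(1,3)] clinear_compose[OF assms(2,4)])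

lemma slice_tensor:
  assumes "clinear \<omega>"
  shows "slice_right \<omega> (x \<otimes> y) = \<omega> y *\<^sub>C x" and "slice_left \<omega> (y \<otimes> x) = \<omega> y *\<^sub>C x"
  unfolding slice_right_def slice_left_def
  by (auto intro!: tlift_tensor clin assms)

lemma clinear_slice_right_comp [clin]:
  "clinear \<omega> \<Longrightarrow> clinear g \<Longrightarrow> clinear (\<lambda>z. slice_right \<omega> (g z))"
  unfolding slice_right_def by (intro clin)

lemma clinear_slice_left_comp [clin]:
  "clinear \<omega> \<Longrightarrow> clinear g \<Longrightarrow> clinear (\<lambda>z. slice_left \<omega> (g z))"
  unfolding slice_left_def by (intro clin)

lemmas clinear_slice_right = clinear_slice_right_comp[OF _ clinear_basic(1)]
  and clinear_slice_left = clinear_slice_left_comp[OF _ clinear_basic(1)]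

text \<open>
  Both sides are \<open>(\<omega> \<otimes> \<omega>') t\<close>.
\<close>

lemma slice_exchange:
  assumes "clinear \<omega>" "clinear \<omega>'"
  shows "\<omega> (slice_right \<omega>' t) = \<omega>' (slice_left \<omega> t)"
  by (induction t)
    (simp_all add: slice_tensor assms clinearD[OF assms(1)] clinearD[OF assms(2)]
      clinearD[OF clinear_slice_right[OF assms(2)]]
      clinearD[OF clinear_slice_left[OF assms(1)]] scaleC_complex_def)

lemma slice_flip:
  assumes "clinear \<omega>"
  shows "slice_right \<omega> t = slice_left \<omega> (tensor_flip t)"
  by (induction t) (simp_all add: slice_tensor assms tensor_flip_tensor clinearD[OF clinear_tensor_flip]
    clinearD[OF clinear_slice_right[OF assms(1)]]
      clinearD[OF clinear_slice_left[OF assms(1)]])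

lemma tensor_flip_flip: "tensor_flip (tensor_flip t) = t"
  by (induction t) (simp_all add: tensor_flip_tensor clinearD[OF clinear_tensor_flip])

text \<open>Extend \<open>{v}\<close> to a basis and take the coordinate at \<open>v\<close>.\<close>

lemma functional_separates:
  fixes v :: "'a::complex_vector"
  assumes "v \<noteq> 0"
  obtains \<omega> where "clinear \<omega>" "\<omega> v = (1::complex)"
proof -
  have i: "complex_vector.independent {v}"
    using assms by simp
  let ?E = "complex_vector.extend_basis {v}"
  have E: "complex_vector.independent ?E" "\<And>x. x \<in> complex_vector.span ?E" "v \<in> ?E"
    using complex_vector.independent_extend_basis[OF i] complex_vector.span_extend_basis[OF i]
      complex_vector.extend_basis_superset[OF i] by auto
  have "clinear (\<lambda>x. complex_vector.representation ?E x v)"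
    by (rule clinearI) (simp_all add: complex_vector.representation_add complex_vector.representation_scale E scaleC_complex_def)
  moreover have "complex_vector.representation ?E v v = 1"
    by (simp add: complex_vector.representation_basis E)
  ultimately show ?thesis by (rule that)
qed

lemma functional_eqI:
  fixes x y :: "'a::complex_vector"
  assumes "\<And>\<omega>. clinear \<omega> \<Longrightarrow> \<omega> x = (\<omega> y :: complex)"
  shows "x = y"
proof (rule ccontr)
  assume "x \<noteq> y"
  then obtain \<omega> where w: "clinear \<omega>" "\<omega> (x - y) = (1::complex)"
    using functional_separates[of "x - y"] by auto
  then show False using assms[OF w(1)] by (simp add: clinear_diff)
qed

text \<open>
  Expand the right legs in a basis.  Slicing on the left such an expansion gives a linear combination of basis vectors,
  so that a vanishing slice has vanishing coefficients; this is how tensors are shown to be zero below.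
\<close>

lemma tensor_basis_expansion:
  fixes t :: "('a::complex_vector, 'b::complex_vector) tensor"
  obtains E x where "finite E" "complex_vector.independent E" "t = (\<Sum>b\<in>E. x b \<otimes> b)"
proof -
  let ?B = "complex_vector.extend_basis ({} :: 'b set)"
  have i: "complex_vector.independent ({} :: 'b set)" by (rule complex_vector.independent_empty)
  have B: "complex_vector.independent ?B" "\<And>y. y \<in> complex_vector.span ?B"
    using complex_vector.independent_extend_basis[OF i] complex_vector.span_extend_basis[OF i] by auto
  have "\<exists>E x. finite E \<and> E \<subseteq> ?B \<and> t = (\<Sum>b\<in>E. x b \<otimes> b)"
  proof (induction t)
    case (tensor u y)
    let ?r = "complex_vector.representation ?B y"
    have "u \<otimes> y = u \<otimes> (\<Sum>b | ?r b \<noteq> 0. ?r b *\<^sub>C b)"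
      by (simp only: complex_vector.sum_nonzero_representation_eq[OF B(1) B(2)])
    also have "\<dots> = (\<Sum>b | ?r b \<noteq> 0. (?r b *\<^sub>C u) \<otimes> b)"
      by (simp only: clinear_sum[OF clinear_tensor(2)[OF clinear_basic(1)]] tensor_bilinear)
    finally have "u \<otimes> y = (\<Sum>b | ?r b \<noteq> 0. (?r b *\<^sub>C u) \<otimes> b)" .
    moreover have "finite {b. ?r b \<noteq> 0}" "{b. ?r b \<noteq> 0} \<subseteq> ?B"
      using complex_vector.finite_representation complex_vector.representation_ne_zero by auto
    ultimately show ?case
      by (intro exI[of _ "{b. ?r b \<noteq> 0}"] exI[of _ "\<lambda>b. ?r b *\<^sub>C u"] conjI)
  next
    case (add s t)
    then obtain E x F y where *: "finite E" "E \<subseteq> ?B" "s = (\<Sum>b\<in>E. x b \<otimes> b)"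
        "finite F" "F \<subseteq> ?B" "t = (\<Sum>b\<in>F. y b \<otimes> b)" by blast
    have z: "0 \<otimes> b = 0" for b :: 'b
      using tensor_bilinear(3)[of 0 0 b] by simp
    have "s = (\<Sum>b\<in>E \<union> F. (if b \<in> E then x b else 0) \<otimes> b)"
      unfolding * by (rule sum.mono_neutral_cong_left) (use * z in auto)
    moreover have "t = (\<Sum>b\<in>E \<union> F. (if b \<in> F then y b else 0) \<otimes> b)"
      unfolding * by (rule sum.mono_neutral_cong_left) (use * z in auto)
    ultimately have "s + t = (\<Sum>b\<in>E \<union> F. ((if b \<in> E then x b else 0) + (if b \<in> F then y b else 0)) \<otimes> b)"
      by (simp add: tensor_bilinear sum.distrib)
    with * show ?case
      by (intro exI[of _ "E \<union> F"] exI[of _ "\<lambda>b. (if b \<in> E then x b else 0) + (if b \<in> F then y b else 0)"]) auto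
  qed
  then obtain E x where "finite E" "E \<subseteq> ?B" "t = (\<Sum>b\<in>E. x b \<otimes> b)" by blast
  then show ?thesis using complex_vector.independent_mono[OF B(1)] by (intro that)
qed

lemma slice_left_separates:
  fixes t :: "('a::complex_vector, 'b::complex_vector) tensor"
  assumes "\<And>f. f \<in> F \<Longrightarrow> clinear f" and "\<And>x. (\<And>f. f \<in> F \<Longrightarrow> f x = 0) \<Longrightarrow> x = 0"
    and "\<And>f. f \<in> F \<Longrightarrow> slice_left f t = 0"
  shows "t = 0"
proof -
  obtain E x where E: "finite E" "complex_vector.independent E" "t = (\<Sum>b\<in>E. x b \<otimes> b)"
    by (rule tensor_basis_expansion)
  have "x b = 0" if b: "b \<in> E" for b
  proof (rule assms(2))
    fix f assume f: "f \<in> F"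
    have "(\<Sum>b\<in>E. f (x b) *\<^sub>C b) = slice_left f t"
      by (simp add: E clinear_sum[OF clinear_slice_left[OF assms(1)[OF f]]]
        slice_tensor assms(1)[OF f])
    then show "f (x b) = 0"
      using complex_vector.independentD[OF E(2,1) subset_refl _ b] assms(3)[OF f] by auto
  qed
  then have "\<And>b. b \<in> E \<Longrightarrow> x b \<otimes> b = 0"
    using tensor_bilinear(3)[of 0 0] by simp
  then show ?thesis by (simp add: E)
qed

lemma slice_right_separates:
  fixes t :: "('a::complex_vector, 'b::complex_vector) tensor"
  assumes "\<And>f. f \<in> F \<Longrightarrow> clinear f" and "\<And>x. (\<And>f. f \<in> F \<Longrightarrow> f x = 0) \<Longrightarrow> x = 0"
    and "\<And>f. f \<in> F \<Longrightarrow> slice_right f t = 0"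
  shows "t = 0"
proof -
  have "tensor_flip t = 0"
    using assms by (intro slice_left_separates[of F]) (auto simp: slice_flip)
  then show ?thesis by (metis tensor_flip_flip clinearD(3)[OF clinear_tensor_flip])
qed

lemma slice_left_eqI:
  fixes s t :: "('a::complex_vector, 'b::complex_vector) tensor"
  assumes "\<And>f. f \<in> F \<Longrightarrow> clinear f" and "\<And>x. (\<And>f. f \<in> F \<Longrightarrow> f x = 0) \<Longrightarrow> x = 0"
    and "\<And>f. f \<in> F \<Longrightarrow> slice_left f s = slice_left f t"
  shows "s = t"
proof -
  have "s - t = 0"
    using assms by (intro slice_left_separates[of F])
      (auto simp: clinear_diff[OF clinear_slice_left])
  then show ?thesis by simp
qed

lemma slice_right_eqI:
  fixes s t :: "('a::complex_vector, 'b::complex_vector) tensor"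
  assumes "\<And>f. f \<in> F \<Longrightarrow> clinear f" and "\<And>x. (\<And>f. f \<in> F \<Longrightarrow> f x = 0) \<Longrightarrow> x = 0"
    and "\<And>f. f \<in> F \<Longrightarrow> slice_right f s = slice_right f t"
  shows "s = t"
proof -
  have "s - t = 0"
    using assms by (intro slice_right_separates[of F])
      (auto simp: clinear_diff[OF clinear_slice_right])
  then show ?thesis by simp
qed

lemma functional_separates_zero:
  fixes x :: "'a::complex_vector"
  assumes "\<And>f. f \<in> {\<omega>. clinear \<omega>} \<Longrightarrow> f x = (0::complex)"
  shows "x = 0"
proof (rule functional_eqI)
  show "\<omega> x = (\<omega> 0 :: complex)" if "clinear \<omega>" for \<omega>
    using assms[of \<omega>] that clinearD(3)[OF that] by simp
qed

lemma slice_left_all_eqI: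
  fixes s t :: "('a::complex_vector, 'b::complex_vector) tensor"
  assumes "\<And>\<omega>. clinear \<omega> \<Longrightarrow> slice_left \<omega> s = slice_left \<omega> t"
  shows "s = t"
  by (rule slice_left_eqI[of "{\<omega>. clinear \<omega>}"])
    (simp, rule functional_separates_zero, assumption, rule assms, simp)

lemma slice_right_all_eqI:
  fixes s t :: "('a::complex_vector, 'b::complex_vector) tensor"
  assumes "\<And>\<omega>. clinear \<omega> \<Longrightarrow> slice_right \<omega> s = slice_right \<omega> t"
  shows "s = t"
  by (rule slice_right_eqI[of "{\<omega>. clinear \<omega>}"])
    (simp, rule functional_separates_zero, assumption, rule assms, simp)

text \<open>
  If \<open>F\<close> and \<open>G\<close> separate points, so do the functionals \<open>f \<otimes> g\<close>: slice by \<open>f\<close> first.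
\<close>

lemma tensor_functional_eqI:
  fixes s t :: "('a::complex_vector, 'b::complex_vector) tensor"
  assumes "\<And>f. f \<in> F \<Longrightarrow> clinear f" and "\<And>x. (\<And>f. f \<in> F \<Longrightarrow> f x = 0) \<Longrightarrow> x = 0"
    and "\<And>g. g \<in> G \<Longrightarrow> clinear g" and "\<And>x. (\<And>g. g \<in> G \<Longrightarrow> g x = 0) \<Longrightarrow> x = 0"
    and "\<And>f g. f \<in> F \<Longrightarrow> g \<in> G \<Longrightarrow> g (slice_left f s) = g (slice_left f t)"
  shows "s = t"
proof (rule slice_left_eqI[of F])
  fix f assume f: "f \<in> F"
  have "slice_left f s - slice_left f t = 0"
    using assms f by (intro assms(4)) (simp add: clinear_diff)
  then show "slice_left f s = slice_left f t" by simp
qed (use assms in auto)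

lemma factor_through_surjection:
  fixes p :: "'a::complex_vector \<Rightarrow> 'b::complex_vector" and g :: "'a \<Rightarrow> 'c::complex_vector"
  assumes "clinear p" "surj p" "clinear g" "\<And>x. p x = 0 \<Longrightarrow> g x = 0"
  obtains h where "clinear h" "\<And>x. h (p x) = g x"
proof -
  define h where "h y = g (inv p y)" for y
  have h: "h (p x) = g x" for x
  proof -
    have "p (inv p (p x) - x) = 0"
      by (simp add: clinear_diff[OF assms(1)] surj_f_inv_f[OF assms(2)])
    then have "g (inv p (p x) - x) = 0" by (rule assms(4))
    then show ?thesis by (simp add: h_def clinear_diff[OF assms(3)])
  qed
  have "clinear h"
  proof (rule clinearI)
    fix y y' c
    obtain x x' where "y = p x" "y' = p x'" by (metis surjD[OF assms(2)])
    then show "h (y + y') = h y + h y'" "h (c *\<^sub>C y) = c *\<^sub>C h y"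
      by (simp_all add: h clinearD[OF assms(1), symmetric] clinearD[OF assms(3)])
  qed
  with h show ?thesis using that by blast
qed

lemma clinear_inv:
  assumes "clinear f" "bij f"
  shows "clinear (inv f)"
  using assms
  by (intro clinearI) (metis bij_inv_eq_iff clinearD(1), metis bij_inv_eq_iff clinearD(2))

section \<open>Actions on tensor products\<close>

lemma slice_left_tensor_map:
  assumes "clinear f" "clinear g" "clinear \<omega>"
  shows "slice_left \<omega> (tensor_map f g t) = g (slice_left (\<lambda>x. \<omega> (f x)) t)"
proof (rule clinear_eq_tensor[where t=t])
  note c = clinear_compose[OF assms(3) assms(1)]
  show "clinear (\<lambda>t. slice_left \<omega> (tensor_map f g t))"
    by (intro clin assms)
  show "clinear (\<lambda>t. g (slice_left (\<lambda>x. \<omega> (f x)) t))"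
    by (intro clinear_compose[OF assms(2)] clin c)
  show "slice_left \<omega> (tensor_map f g (x \<otimes> y)) = g (slice_left (\<lambda>x. \<omega> (f x)) (x \<otimes> y))" for x y
    by (simp add: tensor_map_tensor assms slice_tensor c clinearD(2)[OF assms(2)])
qed

lemma slice_right_tensor_map:
  assumes "clinear f" "clinear g" "clinear \<omega>"
  shows "slice_right \<omega> (tensor_map f g t) = f (slice_right (\<lambda>x. \<omega> (g x)) t)"
proof (rule clinear_eq_tensor[where t=t])
  note c = clinear_compose[OF assms(3) assms(2)]
  show "clinear (\<lambda>t. slice_right \<omega> (tensor_map f g t))"
    by (intro clin assms)
  show "clinear (\<lambda>t. f (slice_right (\<lambda>x. \<omega> (g x)) t))"
    by (intro clinear_compose[OF assms(1)] clin c)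
  show "slice_right \<omega> (tensor_map f g (x \<otimes> y)) = f (slice_right (\<lambda>x. \<omega> (g x)) (x \<otimes> y))" for x y
    by (simp add: tensor_map_tensor assms slice_tensor c clinearD(2)[OF assms(1)])
qed

lemma clinear_tensor_map_param [clin]:
  "(\<And>x. clinear (\<lambda>z. f z x)) \<Longrightarrow> clinear (\<lambda>z. tensor_map (f z) g t)"
  unfolding tensor_map_def by (intro clin; assumption)

lemma clinear_tensor_map_param' [clin]:
  "(\<And>x. clinear (\<lambda>z. g z x)) \<Longrightarrow> clinear (\<lambda>z. tensor_map f (g z) t)"
  unfolding tensor_map_def by (intro clin; assumption)

lemma composed_functionals_separate:
  fixes h :: "'i \<Rightarrow> 'x::complex_vector \<Rightarrow> 'u::complex_vector"
  assumes "\<And>x. (\<And>i. h i x = 0) \<Longrightarrow> x = 0"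
    and x: "\<And>f. f \<in> {(\<lambda>x. \<omega> (h i x)) | \<omega> i. clinear \<omega>} \<Longrightarrow> f x = (0::complex)"
  shows "x = 0"
proof (rule assms(1), rule functional_eqI)
  show "\<omega> (h i x) = \<omega> 0" if "clinear \<omega>" for \<omega> :: "'u \<Rightarrow> complex" and i
    using x[of "\<lambda>x. \<omega> (h i x)"] that clinearD(3)[OF that] by auto
qed

text \<open>
  The action of a tensor product on a tensor product, \<open>\<Sum> x \<otimes> y\<close> acting as \<open>\<Sum> f x \<otimes> g y\<close>.  Multiplication in a
  tensor product of algebras, the maps \<^const>\<open>tensor_hom_left\<close> and \<^const>\<open>tensor_hom_right\<close>, and the actions on
  \<open>A \<otimes> A\<close> below are all of this form.
\<close>

definition tact ::
    "('x::complex_vector \<Rightarrow> 'u::complex_vector \<Rightarrow> 'u) \<Rightarrow> ('y::complex_vector \<Rightarrow> 'w::complex_vector \<Rightarrow> 'w)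
      \<Rightarrow> ('x, 'y) tensor \<Rightarrow> ('u, 'w) tensor \<Rightarrow> ('u, 'w) tensor"
  where "tact f g t \<xi> = tlift (\<lambda>x y. tensor_map (f x) (g y) \<xi>) t"

context
  fixes f :: "'x::complex_vector \<Rightarrow> 'u::complex_vector \<Rightarrow> 'u" and g :: "'y::complex_vector \<Rightarrow> 'w::complex_vector \<Rightarrow> 'w"
  assumes f: "cbilinear f" and g: "cbilinear g"
begin

lemma bilinear_action:
  "clinear (f x)" "clinear (g y)" "clinear (\<lambda>x. f x u)" "clinear (\<lambda>y. g y w)"
  using f g by (simp_all add: cbilinear_def)

lemma clinear_tact [clin]:
  "clinear h \<Longrightarrow> clinear (\<lambda>z. tact f g (h z) \<xi>)" "clinear h' \<Longrightarrow> clinear (\<lambda>z. tact f g t (h' z))"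
  unfolding tact_def by (intro clin bilinear_action | assumption)+

lemma tact_tensor: "tact f g (x \<otimes> y) \<xi> = tensor_map (f x) (g y) \<xi>"
  unfolding tact_def by (rule tlift_tensor) (intro clin bilinear_action)

lemma tact_tensor_tensor: "tact f g (x \<otimes> y) (u \<otimes> w) = f x u \<otimes> g y w"
  by (simp add: tact_tensor tensor_map_tensor bilinear_action)

text \<open>
  The functionals \<open>x \<mapsto> \<omega> (f x u)\<close> separate points if \<open>f\<close> is faithful, and their tensor products are
  matrix coefficients of \<open>tact f g\<close>.
\<close>

lemma tact_faithful:
  assumes "\<And>x. (\<And>u. f x u = 0) \<Longrightarrow> x = 0" "\<And>y. (\<And>w. g y w = 0) \<Longrightarrow> y = 0"
    and t: "\<And>\<xi>. tact f g t \<xi> = 0"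
  shows "t = 0"
proof (rule tensor_functional_eqI[OF _ composed_functionals_separate[where h="\<lambda>u x. f x u"]
      _ composed_functionals_separate[where h="\<lambda>w y. g y w"]])
  fix h k
  assume "h \<in> {(\<lambda>x. \<omega> (f x u) :: complex) | \<omega> u. clinear \<omega>}" "k \<in> {(\<lambda>y. \<omega> (g y w) :: complex) | \<omega> w. clinear \<omega>}"
  then obtain \<omega> u \<omega>' w where w: "clinear \<omega>" "clinear \<omega>'" "h = (\<lambda>x. \<omega> (f x u))" "k = (\<lambda>y. \<omega>' (g y w))" by blast
  have ch: "clinear h" "clinear k"
    unfolding w by (intro clinear_compose[OF w(1)] clinear_compose[OF w(2)] bilinear_action)+
  have "\<omega>' (slice_left \<omega> (tact f g t (u \<otimes> w))) = k (slice_left h t)" for t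
    by (rule clinear_eq_tensor[where t=t])
      ((intro clinear_compose[OF w(2)] clinear_compose[OF ch(2)] clin clinear_tact w ch)+,
        simp add: tact_tensor_tensor slice_tensor w ch[unfolded w] clinearD(2)[OF w(2)] clinearD(2)[OF bilinear_action(4)])
  then show "k (slice_left h t) = k (slice_left h 0)"
    using t by (metis clinearD(3)[OF w(2)] clinearD(3)[OF clinear_slice_left[OF w(1)]] clinearD(3)[OF ch(2)] clinearD(3)[OF clinear_slice_left[OF ch(1)]])
qed (use assms(1,2) in \<open>auto intro: clinear_compose[OF _ bilinear_action(3)] clinear_compose[OF _ bilinear_action(4)]\<close>)

lemma tact_eqI:
  assumes "\<And>x. (\<And>u. f x u = 0) \<Longrightarrow> x = 0" "\<And>y. (\<And>w. g y w = 0) \<Longrightarrow> y = 0"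
    and "\<And>\<xi>. tact f g s \<xi> = tact f g t \<xi>"
  shows "s = t"
proof -
  have "s - t = 0"
    using assms by (intro tact_faithful) (simp_all add: clinear_diff[OF clinear_tact(1)[OF clinear_basic(1)]])
  then show ?thesis by simp
qed

lemma tact_separates:
  assumes "\<And>u. (\<And>x. f x u = 0) \<Longrightarrow> u = 0" "\<And>w. (\<And>y. g y w = 0) \<Longrightarrow> w = 0"
    and \<xi>: "\<And>t. tact f g t \<xi> = 0"
  shows "\<xi> = 0"
proof (rule tensor_functional_eqI[OF _ composed_functionals_separate[where h=f] _ composed_functionals_separate[where h=g]])
  fix h k
  assume "h \<in> {(\<lambda>u. \<omega> (f x u) :: complex) | \<omega> x. clinear \<omega>}" "k \<in> {(\<lambda>w. \<omega> (g y w) :: complex) | \<omega> y. clinear \<omega>}"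
  then obtain \<omega> x \<omega>' y where w: "clinear \<omega>" "clinear \<omega>'" "h = (\<lambda>u. \<omega> (f x u))" "k = (\<lambda>w. \<omega>' (g y w))" by blast
  have ch: "clinear h" "clinear k"
    unfolding w by (intro clinear_compose[OF w(1)] clinear_compose[OF w(2)] bilinear_action)+
  have "\<omega>' (slice_left \<omega> (tact f g (x \<otimes> y) \<xi>)) = k (slice_left h \<xi>)"
    by (simp add: tact_tensor slice_left_tensor_map bilinear_action w)
  then show "k (slice_left h \<xi>) = k (slice_left h 0)"
    using \<xi> by (metis clinearD(3)[OF w(2)] clinearD(3)[OF clinear_slice_left[OF w(1)]] clinearD(3)[OF ch(2)] clinearD(3)[OF clinear_slice_left[OF ch(1)]])
qed (use assms(1,2) in \<open>auto intro: clinear_compose[OF _ bilinear_action(1)] clinear_compose[OF _ bilinear_action(2)]\<close>)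

lemma tact_surj:
  assumes "surj (tlift f)" "surj (tlift g)"
  shows "surj (tlift (tact f g))"
proof -
  have ct: "clinear (tlift (tact f g))" by (intro clinear_tlift clin clinear_tact)
  have "\<exists>s. \<xi> = tlift (tact f g) s" for \<xi>
  proof (induction \<xi>)
    case (tensor u w)
    obtain t1 t2 where t: "u = tlift f t1" "w = tlift g t2" using assms by (meson surjD)
    have "tlift (tact f g) (tlift (\<lambda>x u'. tlift (\<lambda>y w'. (x \<otimes> y) \<otimes> (u' \<otimes> w')) t2) t1)
        = tlift (\<lambda>x u'. tlift (\<lambda>y w'. f x u' \<otimes> g y w') t2) t1"
      by (simp add: clinear_tlift_push[OF ct] tlift_tensor clin clinear_tact tact_tensor_tensor)
    also have "\<dots> = u \<otimes> w"
      by (simp add: clinear_tlift_push[OF clinear_tensor(2)[OF clinear_basic(1)], symmetric]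
        clinear_tlift_push[OF clinear_tensor(1)[OF clinear_basic(1)], symmetric] t)
    finally show ?case by metis
  next
    case (add s t)
    then show ?case by (metis clinearD(1)[OF ct])
  qed
  then show ?thesis by blast
qed

end

lemma tact_times:
  fixes f :: "'x::complex_algebra \<Rightarrow> 'u::complex_vector \<Rightarrow> 'u" and g :: "'y::complex_algebra \<Rightarrow> 'w::complex_vector \<Rightarrow> 'w"
  assumes "cbilinear f" "cbilinear g"
    and "\<And>x x' u. f (x * x') u = f x (f x' u)" "\<And>y y' w. g (y * y') w = g y (g y' w)"
  shows "tact f g (s * t) \<xi> = tact f g s (tact f g t \<xi>)"
proof (rule clinear_eq_tensor[of "\<lambda>s. tact f g (s * t) \<xi>" "\<lambda>s. tact f g s (tact f g t \<xi>)"])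
  note c = bilinear_action[OF assms(1,2)]
  have comp: "f (x * x') = (\<lambda>u. f x (f x' u))" "g (y * y') = (\<lambda>w. g y (g y' w))" for x x' y y'
    by (simp_all add: fun_eq_iff assms)
  show "tact f g (x \<otimes> y * t) \<xi> = tact f g (x \<otimes> y) (tact f g t \<xi>)" for x y
    by (rule clinear_eq_tensor[where t=t])
      ((intro clin clinear_tact assms(1,2) c)+, simp add: tact_tensor[OF assms(1,2)] tensor_times_tensor tensor_map_compose c comp)
qed (intro clin clinear_tact assms(1,2) bilinear_action[OF assms(1,2)])+

lemma tact_times_opposite:
  fixes f :: "'x::complex_algebra \<Rightarrow> 'u::complex_vector \<Rightarrow> 'u" and g :: "'y::complex_algebra \<Rightarrow> 'w::complex_vector \<Rightarrow> 'w"
  assumes "cbilinear f" "cbilinear g"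
    and "\<And>x x' u. f (x * x') u = f x' (f x u)" "\<And>y y' w. g (y * y') w = g y' (g y w)"
  shows "tact f g (s * t) \<xi> = tact f g t (tact f g s \<xi>)"
proof (rule clinear_eq_tensor[of "\<lambda>s. tact f g (s * t) \<xi>" "\<lambda>s. tact f g t (tact f g s \<xi>)"])
  note c = bilinear_action[OF assms(1,2)]
  have comp: "f (x * x') = (\<lambda>u. f x' (f x u))" "g (y * y') = (\<lambda>w. g y' (g y w))" for x x' y y'
    by (simp_all add: fun_eq_iff assms)
  show "tact f g (x \<otimes> y * t) \<xi> = tact f g t (tact f g (x \<otimes> y) \<xi>)" for x y
    by (rule clinear_eq_tensor[where t=t])
      ((intro clin clinear_tact assms(1,2) c)+, simp add: tact_tensor[OF assms(1,2)] tensor_times_tensor tensor_map_compose c comp)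
qed (intro clin clinear_tact assms(1,2) bilinear_action[OF assms(1,2)])+

lemma tact_intertwine:
  assumes "cbilinear f" "cbilinear g" "cbilinear f'" "cbilinear g'" "cbilinear p" "cbilinear q"
    and "\<And>x u \<xi>. f (p x u) \<xi> = f' x (f u \<xi>)" "\<And>y w \<xi>. g (q y w) \<xi> = g' y (g w \<xi>)"
  shows "tact f g (tact p q t z) \<xi> = tact f' g' t (tact f g z \<xi>)"
proof (rule clinear_eq_tensor[of "\<lambda>t. tact f g (tact p q t z) \<xi>" "\<lambda>t. tact f' g' t (tact f g z \<xi>)"])
  note c = bilinear_action[OF assms(1,2)] bilinear_action[OF assms(3,4)] bilinear_action[OF assms(5,6)]
  have comp: "f (p x u) = (\<lambda>\<xi>. f' x (f u \<xi>))" "g (q y w) = (\<lambda>\<xi>. g' y (g w \<xi>))" for x u y w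
    by (simp_all add: fun_eq_iff assms)
  show "tact f g (tact p q (x \<otimes> y) z) \<xi> = tact f' g' (x \<otimes> y) (tact f g z \<xi>)" for x y
    by (rule clinear_eq_tensor[where t=z])
      ((intro clin clinear_tact assms(1-6) c)+, simp add: tact_tensor_tensor[OF assms(5,6)] tact_tensor[OF assms(1,2)] tact_tensor[OF assms(3,4)]
        tensor_map_compose c comp)
qed (intro clin clinear_tact assms(1-6) bilinear_action[OF assms(1,2)] bilinear_action[OF assms(3,4)] bilinear_action[OF assms(5,6)])+

lemma tlift_zero: "tlift (\<lambda>x y. 0) t = 0"
  by (simp add: tlift_def case_prod_unfold)

text \<open>
  A non-degenerate module over an algebra is a module over the multiplier algebra: if \<open>f\<close> and \<open>g\<close> are the
  left and the right component of a multiplier, then \<open>n'((f n) \<eta>) = (g n')(n \<eta>)\<close>, so \<open>n \<eta> \<mapsto> (f n) \<eta>\<close> is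
  well defined as soon as the \<open>n \<eta>\<close> span the module and no non-zero element is annihilated by all \<open>n'\<close>.
  For a right module the two components change places.
\<close>

lemma module_extension:
  fixes \<sigma> :: "'n::complex_vector \<Rightarrow> 'm::complex_vector \<Rightarrow> 'm"
  assumes \<sigma>: "cbilinear \<sigma>" and f: "clinear f"
    and exchange: "\<And>n n' \<eta>. \<sigma> n' (\<sigma> (f n) \<eta>) = \<sigma> (g n') (\<sigma> n \<eta>)"
    and faithful: "\<And>\<eta>. (\<And>n. \<sigma> n \<eta> = 0) \<Longrightarrow> \<eta> = 0" and surj: "surj (tlift \<sigma>)"
  obtains X where "clinear X" "\<And>n \<eta>. X (\<sigma> n \<eta>) = \<sigma> (f n) \<eta>"
proof -
  have c: "clinear (\<sigma> n)" "clinear (\<lambda>n. \<sigma> n \<eta>)" for n \<eta> using \<sigma> by (simp_all add: cbilinear_def)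
  have fb: "cbilinear (\<lambda>n \<eta>. \<sigma> (f n) \<eta>)" by (intro clin c clinear_compose[OF c(2) f])
  have ker: "tlift (\<lambda>n \<eta>. \<sigma> (f n) \<eta>) t = 0" if "tlift \<sigma> t = 0" for t
  proof (rule faithful)
    fix n'
    have "\<sigma> n' (tlift (\<lambda>n \<eta>. \<sigma> (f n) \<eta>) t) = \<sigma> (g n') (tlift \<sigma> t)"
      by (simp add: clinear_tlift_push[OF c(1)] exchange)
    then show "\<sigma> n' (tlift (\<lambda>n \<eta>. \<sigma> (f n) \<eta>) t) = 0" by (simp add: that clinearD(3)[OF c(1)])
  qed
  obtain X where X: "clinear X" "\<And>t. X (tlift \<sigma> t) = tlift (\<lambda>n \<eta>. \<sigma> (f n) \<eta>) t"
    using factor_through_surjection[OF clinear_tlift[OF \<sigma>] surj clinear_tlift[OF fb] ker] by blast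
  have "X (\<sigma> n \<eta>) = \<sigma> (f n) \<eta>" for n \<eta>
    using X(2)[of "n \<otimes> \<eta>"] by (simp add: tlift_tensor \<sigma> fb)
  with X(1) show ?thesis by (rule that)
qed

section \<open>Multipliers of non-degenerate algebras\<close>

lemma multiplier_eqI: "lapp m = lapp n \<Longrightarrow> (\<And>x. rapp x m = rapp x n) \<Longrightarrow> m = n"
  by transfer (auto simp: prod_eq_iff fun_eq_iff)

lemma multiplier_exists:
  fixes L R :: "'a::{complex_vector, times} \<Rightarrow> 'a"
  assumes "clinear L" "clinear R" "\<And>x y. L (x * y) = L x * y" "\<And>x y. R (x * y) = x * R y"
    and "\<And>x y. x * L y = R x * y"
  obtains m where "\<And>x. lapp m x = L x" "\<And>x. rapp x m = R x"
proof -
  have "(L, R) \<in> {(L, R). clinear L \<and> clinear R \<and> (\<forall>x y. L (x * y) = L x * y) \<and>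
     (\<forall>x y. R (x * y) = x * R y) \<and> (\<forall>x y. x * L y = R x * y)}"
    using assms by blast
  then have "Rep_multiplier (Abs_multiplier (L, R)) = (L, R)" by (rule Abs_multiplier_inverse)
  then have "lapp (Abs_multiplier (L, R)) x = L x" "rapp x (Abs_multiplier (L, R)) = R x" for x
    by (simp_all add: lapp.rep_eq rapp.rep_eq)
  then show ?thesis by (rule that)
qed

lemma lapp_times [simp]: "lapp (m * n) x = lapp m (lapp n x)"
  and rapp_times [simp]: "rapp x (m * n) = rapp (rapp x m) n"
  and lapp_one [simp]: "lapp 1 x = x"
  and rapp_one [simp]: "rapp x 1 = x"
  by (transfer; auto)+

lemma clinear_app_comp [clin]:
  "clinear g \<Longrightarrow> clinear (\<lambda>x. lapp m (g x))" "clinear g \<Longrightarrow> clinear (\<lambda>x. rapp (g x) m)"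
  by (rule clinear_compose[OF multiplierD(1)], assumption, rule clinear_compose[OF multiplierD(2)], assumption)

lemma lapp_plus [simp]: "lapp (m + n) x = lapp m x + lapp n x"
  and rapp_plus [simp]: "rapp x (m + n) = rapp x m + rapp x n"
  and lapp_scaleC [simp]: "lapp (c *\<^sub>C m) x = c *\<^sub>C lapp m x"
  and rapp_scaleC [simp]: "rapp x (c *\<^sub>C m) = c *\<^sub>C rapp x m"
  by (transfer; auto)+

lemma clinear_app_multiplier [clin]:
  fixes j :: "'a::complex_vector \<Rightarrow> 'b::complex_algebra multiplier"
  shows "clinear j \<Longrightarrow> clinear (\<lambda>x. lapp (j x) y)" "clinear j \<Longrightarrow> clinear (\<lambda>x. rapp y (j x))"
  by (auto intro!: clinearI simp: clinearD)

lemma of_alg_lapp: "m * of_alg t = of_alg (lapp m t)"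
  and of_alg_rapp: "of_alg t * m = of_alg (rapp t m)"
  for t :: "'a::complex_algebra"
  by (auto intro!: multiplier_eqI simp: of_alg_app fun_eq_iff multiplierD)

lemma of_alg_times: "of_alg (x * y) = of_alg x * of_alg y" for x :: "'a::complex_algebra"
  by (simp add: of_alg_lapp of_alg_app)

lemma clinear_of_alg [clin]: "clinear (of_alg :: 'a::complex_algebra \<Rightarrow> _)"
  by (rule clinearI; rule multiplier_eqI)
    (auto simp: fun_eq_iff of_alg_app distrib_left distrib_right mult_scaleC_left mult_scaleC_right)

lemma of_alg_inj: "of_alg x = of_alg y \<Longrightarrow> x = y" for x :: "'a::nondegenerate_algebra"
proof -
  assume *: "of_alg x = of_alg y"
  have "(x - y) * z = 0" for z
    using arg_cong[OF *, of "\<lambda>m. lapp m z"] by (simp add: of_alg_app left_diff_distrib)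
  then have "x - y = 0" by (rule nondegenerate_left)
  then show ?thesis by simp
qed

lemma nondegenerate_left_eqI: "(\<And>z. x * z = y * z) \<Longrightarrow> x = y" for x :: "'a::nondegenerate_algebra"
  using nondegenerate_left[of "x - y"] by (simp add: left_diff_distrib)

lemma nondegenerate_right_eqI: "(\<And>z. z * x = z * y) \<Longrightarrow> x = y" for x :: "'a::nondegenerate_algebra"
  using nondegenerate_right[of "x - y"] by (simp add: right_diff_distrib)

lemma alg_elem_of_alg [simp]: "alg_elem (of_alg x) = x" for x :: "'a::nondegenerate_algebra"
  unfolding alg_elem_def by (auto dest: of_alg_inj)

lemma multiplier_eq_lappI:
  fixes m n :: "'a::nondegenerate_algebra multiplier"
  assumes "\<And>x. lapp m x = lapp n x"
  shows "m = n"
proof (rule multiplier_eqI)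
  show "lapp m = lapp n" using assms by auto
  show "rapp x m = rapp x n" for x
    by (rule nondegenerate_left_eqI) (simp add: multiplierD(5)[symmetric] assms)
qed

lemma multiplier_eq_rappI:
  fixes m n :: "'a::nondegenerate_algebra multiplier"
  assumes "\<And>x. rapp x m = rapp x n"
  shows "m = n"
proof (rule multiplier_eqI)
  show "lapp m = lapp n"
  proof
    show "lapp m x = lapp n x" for x
      by (rule nondegenerate_right_eqI) (simp add: multiplierD(5) assms)
  qed
qed (use assms in auto)

lemma tensor_map_mult:
  fixes x :: "'a::complex_algebra" and y :: "'b::complex_algebra"
  shows "(x \<otimes> y) * t = tensor_map ((*) x) ((*) y) t" "t * (x \<otimes> y) = tensor_map (\<lambda>p. p * x) (\<lambda>q. q * y) t"
  by (induction t; simp add: tensor_times_tensor tensor_map_tensor clin distrib_left distrib_right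
    clinearD(1)[OF clinear_tensor_map[OF clinear_times(2) clinear_times(2)]] clinearD(1)[OF clinear_tensor_map[OF clinear_times(1) clinear_times(1)]])+

lemma tact_mult: "tact (*) (*) t \<xi> = t * \<xi>" "tact (\<lambda>x u. u * x) (\<lambda>y w. w * y) t \<xi> = \<xi> * t"
  for t :: "('a::complex_algebra, 'b::complex_algebra) tensor"
  by (rule clinear_eq_tensor[where t=t]; (intro clin)?; simp add: tact_tensor clin tensor_map_mult)+

instance tensor :: (nondegenerate_algebra, nondegenerate_algebra) nondegenerate_algebra
proof
  fix t :: "('a, 'b) tensor"
  show "t = 0" if "\<And>s. t * s = 0"
    by (rule tact_faithful[OF cbilinear_mu cbilinear_mu nondegenerate_left nondegenerate_left])
      (simp_all add: tact_mult that)
  have b: "cbilinear (\<lambda>x u::'a. u * x)" "cbilinear (\<lambda>y w::'b. w * y)" by (intro clin)+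
  show "t = 0" if "\<And>s. s * t = 0"
    by (rule tact_faithful[OF b nondegenerate_right nondegenerate_right]) (simp_all add: tact_mult that)
qed

lemma lapp_mult_tensor: "lapp (m \<otimes>\<^sub>m n) t = tensor_map (lapp m) (lapp n) t"
  and rapp_mult_tensor: "rapp t (m \<otimes>\<^sub>m n) = tensor_map (\<lambda>x. rapp x m) (\<lambda>y. rapp y n) t"
  for m :: "'a::complex_algebra multiplier" and n :: "'b::complex_algebra multiplier"
  by (rule clinear_eq_tensor[where t=t];
    (intro clinear_tensor_map multiplierD | simp add: mult_tensor_app tensor_map_tensor multiplierD(1,2)))+

lemma mult_tensor_eqI:
  fixes m n :: "('a::complex_algebra, 'b::complex_algebra) tensor multiplier"
  assumes "\<And>x y. lapp m (x \<otimes> y) = lapp n (x \<otimes> y)" "\<And>x y. rapp (x \<otimes> y) m = rapp (x \<otimes> y) n"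
  shows "m = n"
proof (rule multiplier_eqI)
  show "lapp m = lapp n"
    by (rule ext, rule clinear_eq_tensor) (rule multiplierD(1) assms)+
  show "rapp t m = rapp t n" for t
    by (rule clinear_eq_tensor[of "\<lambda>t. rapp t m" "\<lambda>t. rapp t n"]) (rule multiplierD(2) assms)+
qed

lemma mult_tensor_times:
  fixes m m' :: "'a::complex_algebra multiplier" and n n' :: "'b::complex_algebra multiplier"
  shows "(m \<otimes>\<^sub>m n) * (m' \<otimes>\<^sub>m n') = (m * m') \<otimes>\<^sub>m (n * n')"
  by (rule mult_tensor_eqI) (simp_all add: mult_tensor_app)

lemma mult_tensor_of_alg: "of_alg x \<otimes>\<^sub>m of_alg y = of_alg (x \<otimes> y)"
  for x :: "'a::complex_algebra" and y :: "'b::complex_algebra"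
  by (rule mult_tensor_eqI) (simp_all add: mult_tensor_app of_alg_app tensor_times_tensor)

lemma clinear_mult_tensor [clin]:
  fixes m :: "'a::complex_algebra multiplier" and n :: "'b::complex_algebra multiplier"
  shows "clinear f \<Longrightarrow> clinear (\<lambda>x. f x \<otimes>\<^sub>m n)" "clinear g \<Longrightarrow> clinear (\<lambda>x. m \<otimes>\<^sub>m g x)"
  by (auto intro!: clinearI mult_tensor_eqI simp: mult_tensor_app clinearD tensor_bilinear)

section \<open>Extension of homomorphisms to multipliers\<close>

definition nondegenerate_hom :: "('x::complex_algebra \<Rightarrow> 'u::complex_algebra multiplier) \<Rightarrow> bool"
  where "nondegenerate_hom j \<longleftrightarrow> clinear j \<and> (\<forall>x y. j (x * y) = j x * j y) \<and>
    surj (tlift (\<lambda>x u. lapp (j x) u)) \<and> surj (tlift (\<lambda>x u. rapp u (j x)))"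

context
  fixes j :: "'x::complex_algebra \<Rightarrow> 'u::nondegenerate_algebra multiplier" and k :: "'y::complex_algebra \<Rightarrow> 'w::nondegenerate_algebra multiplier"
  assumes j: "nondegenerate_hom j" and k: "nondegenerate_hom k"
begin

lemma hom_lapp_rapp:
  assumes "nondegenerate_hom (i :: 'c::complex_algebra \<Rightarrow> 'd::nondegenerate_algebra multiplier)"
  shows "cbilinear (\<lambda>x. lapp (i x))" "cbilinear (\<lambda>x u. rapp u (i x))"
    and "(\<And>x. lapp (i x) u = 0) \<Longrightarrow> u = 0" "(\<And>x. rapp u (i x) = 0) \<Longrightarrow> u = 0"
proof -
  have i: "clinear i" "surj (tlift (\<lambda>x u. lapp (i x) u))" "surj (tlift (\<lambda>x u. rapp u (i x)))"
    using assms by (simp_all add: nondegenerate_hom_def)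
  show b: "cbilinear (\<lambda>x. lapp (i x))" "cbilinear (\<lambda>x u. rapp u (i x))"
    by (intro clin i)+
  show "u = 0" if u: "\<And>x. lapp (i x) u = 0"
  proof (rule nondegenerate_right)
    fix y
    obtain t where "y = tlift (\<lambda>x u. rapp u (i x)) t" using i(3) by (meson surjD)
    moreover have "tlift (\<lambda>x u. rapp u (i x)) t * u = tlift (\<lambda>x v. v * lapp (i x) u) t"
      by (simp add: clinear_tlift_push[OF clinear_times(1)[OF clinear_basic(1)]] multiplierD(5))
    ultimately show "y * u = 0" by (simp add: u tlift_zero)
  qed
  show "u = 0" if u: "\<And>x. rapp u (i x) = 0"
  proof (rule nondegenerate_left)
    fix y
    obtain t where "y = tlift (\<lambda>x u. lapp (i x) u) t" using i(2) by (meson surjD)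
    moreover have "u * tlift (\<lambda>x u. lapp (i x) u) t = tlift (\<lambda>x v. rapp u (i x) * v) t"
      by (simp add: clinear_tlift_push[OF clinear_times(2)[OF clinear_basic(1)]] multiplierD(5))
    ultimately show "u * y = 0" by (simp add: u tlift_zero)
  qed
qed

lemma tensor_hom_tact:
  "tensor_hom_left j k t z = tact (\<lambda>x. lapp (j x)) (\<lambda>y. lapp (k y)) t z"
  "tensor_hom_right j k z t = tact (\<lambda>x u. rapp u (j x)) (\<lambda>y w. rapp w (k y)) t z"
  unfolding tensor_hom_left_def tensor_hom_right_def tact_def lapp_mult_tensor rapp_mult_tensor by (rule refl)+

lemma tensor_hom_exchange:
  "tensor_hom_right j k z t * y = z * tensor_hom_left j k t y"
  unfolding tensor_hom_left_def tensor_hom_right_def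
  by (simp add: clinear_tlift_push[OF clinear_times(1)[OF clinear_basic(1)]]
    clinear_tlift_push[OF clinear_times(2)[OF clinear_basic(1)]] multiplierD(5))

lemma tensor_hom_module:
  "tensor_hom_left j k t (z * y) = tensor_hom_left j k t z * y"
  "tensor_hom_right j k (y * z) t = y * tensor_hom_right j k z t"
  unfolding tensor_hom_left_def tensor_hom_right_def
  by (simp_all add: clinear_tlift_push[OF clinear_times(1)[OF clinear_basic(1)]]
    clinear_tlift_push[OF clinear_times(2)[OF clinear_basic(1)]] multiplierD(3,4))

lemma tensor_hom_props:
  shows tensor_hom_left_times: "tensor_hom_left j k (s * t) z = tensor_hom_left j k s (tensor_hom_left j k t z)"
    and tensor_hom_right_times: "tensor_hom_right j k z (s * t) = tensor_hom_right j k (tensor_hom_right j k z s) t"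
    and tensor_hom_left_surj: "surj (tlift (\<lambda>t z. tensor_hom_left j k t z))"
    and tensor_hom_right_surj: "surj (tlift (\<lambda>t z. tensor_hom_right j k z t))"
    and tensor_hom_left_bilinear: "cbilinear (\<lambda>t z. tensor_hom_left j k t z)"
    and tensor_hom_right_bilinear: "cbilinear (\<lambda>t z. tensor_hom_right j k z t)"
    and tensor_hom_left_faithful: "(\<And>t. tensor_hom_left j k t z = 0) \<Longrightarrow> z = 0"
    and tensor_hom_right_faithful: "(\<And>t. tensor_hom_right j k z t = 0) \<Longrightarrow> z = 0"
proof -
  note b = hom_lapp_rapp[OF j] hom_lapp_rapp[OF k]
  have J: "j (x * y) = j x * j y" "surj (tlift (\<lambda>x u. lapp (j x) u))" "surj (tlift (\<lambda>x u. rapp u (j x)))" for x y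
    using j by (simp_all add: nondegenerate_hom_def)
  have K: "k (x * y) = k x * k y" "surj (tlift (\<lambda>x u. lapp (k x) u))" "surj (tlift (\<lambda>x u. rapp u (k x)))" for x y
    using k by (simp_all add: nondegenerate_hom_def)
  show "tensor_hom_left j k (s * t) z = tensor_hom_left j k s (tensor_hom_left j k t z)"
    unfolding tensor_hom_tact by (rule tact_times) (simp_all add: b(1,5) J K)
  show "tensor_hom_right j k z (s * t) = tensor_hom_right j k (tensor_hom_right j k z s) t"
    unfolding tensor_hom_tact by (rule tact_times_opposite) (simp_all add: b(2,6) J K)
  show "surj (tlift (\<lambda>t z. tensor_hom_left j k t z))"
    unfolding tensor_hom_tact by (rule tact_surj) (rule b J K)+
  show "surj (tlift (\<lambda>t z. tensor_hom_right j k z t))"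
    unfolding tensor_hom_tact by (rule tact_surj) (rule b J K)+
  show "cbilinear (\<lambda>t z. tensor_hom_left j k t z)" "cbilinear (\<lambda>t z. tensor_hom_right j k z t)"
    unfolding tensor_hom_tact by (intro clin clinear_tact b)+
  show "z = 0" if "\<And>t. tensor_hom_left j k t z = 0"
    by (rule tact_separates[OF b(1) b(5) b(3) b(7)]) (use that[unfolded tensor_hom_tact] in auto)
  show "z = 0" if "\<And>t. tensor_hom_right j k z t = 0"
    by (rule tact_separates[OF b(2) b(6) b(4) b(8)]) (use that[unfolded tensor_hom_tact] in auto)
qed

text \<open>
  The target \<open>U \<otimes> W\<close> is a non-degenerate left and right module over \<open>X \<otimes> Y\<close>; the two extensions to \<open>M(X \<otimes> Y)\<close>
  are the components of the multiplier that \<^const>\<open>mult_extend\<close> describes.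
\<close>

lemma lapp_mult_extend:
  "lapp (mult_extend j k m) (tensor_hom_left j k t z) = tensor_hom_left j k (lapp m t) z"
proof -
  obtain L where L: "clinear L" "\<And>t z. L (tensor_hom_left j k t z) = tensor_hom_left j k (lapp m t) z"
    by (rule module_extension[OF tensor_hom_left_bilinear multiplierD(1)[of m], of "\<lambda>t. rapp t m"])
      (simp_all add: tensor_hom_left_times[symmetric] multiplierD(5) tensor_hom_left_faithful tensor_hom_left_surj)
  obtain R where R: "clinear R" "\<And>t z. R (tensor_hom_right j k z t) = tensor_hom_right j k z (rapp t m)"
    by (rule module_extension[OF tensor_hom_right_bilinear multiplierD(2)[of m], of "lapp m"])
      (simp_all add: tensor_hom_right_times[symmetric] multiplierD(5) tensor_hom_right_faithful tensor_hom_right_surj)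
  note bl = clinear_tlift[OF tensor_hom_left_bilinear] clinear_tlift[OF tensor_hom_right_bilinear]
  have left: "P x" if "\<And>t z. P (tensor_hom_left j k t z)" "\<And>x y. P x \<Longrightarrow> P y \<Longrightarrow> P (x + y)" for P x
  proof -
    obtain t where t: "x = tlift (\<lambda>t z. tensor_hom_left j k t z) t" using tensor_hom_left_surj by (meson surjD)
    have "P (tlift (\<lambda>t z. tensor_hom_left j k t z) t)"
      by (induction t) (simp_all add: tlift_tensor tensor_hom_left_bilinear that clinearD(1)[OF bl(1)])
    then show ?thesis by (simp add: t)
  qed
  have right: "P x" if "\<And>t z. P (tensor_hom_right j k z t)" "\<And>x y. P x \<Longrightarrow> P y \<Longrightarrow> P (x + y)" for P x
  proof -
    obtain t where t: "x = tlift (\<lambda>t z. tensor_hom_right j k z t) t" using tensor_hom_right_surj by (meson surjD)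
    have "P (tlift (\<lambda>t z. tensor_hom_right j k z t) t)"
      by (induction t) (simp_all add: tlift_tensor tensor_hom_right_bilinear that clinearD(1)[OF bl(2)])
    then show ?thesis by (simp add: t)
  qed
  have "L (x * y) = L x * y" for x y
    by (rule left[of "\<lambda>x. L (x * y) = L x * y"])
      (simp_all add: L tensor_hom_module[symmetric] distrib_right clinearD(1)[OF L(1)])
  moreover have "R (x * y) = x * R y" for x y
    by (rule right[of "\<lambda>y. R (x * y) = x * R y"])
      (simp_all add: R tensor_hom_module[symmetric] distrib_left clinearD(1)[OF R(1)])
  moreover have "x * L y = R x * y" for x y
  proof (rule left[of "\<lambda>y. x * L y = R x * y"])
    fix t z
    show "x * L (tensor_hom_left j k t z) = R x * tensor_hom_left j k t z"
    proof (rule right[of "\<lambda>x. x * L (tensor_hom_left j k t z) = R x * tensor_hom_left j k t z"])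
      show "tensor_hom_right j k w s * L (tensor_hom_left j k t z) = R (tensor_hom_right j k w s) * tensor_hom_left j k t z" for s w
        by (simp add: L R tensor_hom_exchange tensor_hom_left_times[symmetric] multiplierD(5))
    qed (simp add: distrib_right clinearD(1)[OF R(1)])
  qed (simp add: distrib_left clinearD(1)[OF L(1)])
  ultimately obtain n0 where app: "\<And>n. lapp n0 n = L n" "\<And>n. rapp n n0 = R n"
    using multiplier_exists[OF L(1) R(1)] by metis
  let ?P = "\<lambda>n. \<forall>t z. lapp n (tensor_hom_left j k t z) = tensor_hom_left j k (lapp m t) z \<and>
    rapp (tensor_hom_right j k z t) n = tensor_hom_right j k z (rapp t m)"
  have "\<exists>!n. ?P n"
  proof (rule ex1I)
    show "?P n0" by (simp add: app L R)
    show "n = n0" if n: "?P n" for n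
      by (rule multiplier_eq_lappI, rule left[of "\<lambda>x. lapp n x = lapp n0 x"])
        (simp_all add: n app L clinearD(1)[OF multiplierD(1)] clinearD(1)[OF L(1)])
  qed
  from theI'[OF this] show ?thesis unfolding mult_extend_def by blast
qed

text \<open>
  The tool for computing with extended multipliers: if the two homomorphisms intertwine an action of their source
  with an action of their target on the same space, then \<open>m\<close> and its extension act as the same operator.
\<close>

lemma mult_extend_intertwine:
  assumes f: "cbilinear f" "cbilinear g" "cbilinear f'" "cbilinear g'"
    and "\<And>x u \<xi>. f (lapp (j x) u) \<xi> = f' x (f u \<xi>)" "\<And>y w \<xi>. g (lapp (k y) w) \<xi> = g' y (g w \<xi>)"
    and X: "clinear X" "\<And>t \<eta>. tact f' g' (lapp m t) \<eta> = X (tact f' g' t \<eta>)"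
  shows "tact f g (lapp (mult_extend j k m) z) \<xi> = X (tact f g z \<xi>)"
proof -
  note b = hom_lapp_rapp[OF j] hom_lapp_rapp[OF k]
  have hom: "tact f g (tensor_hom_left j k t z) \<xi> = tact f' g' t (tact f g z \<xi>)" for t z
    unfolding tensor_hom_tact by (rule tact_intertwine) (rule assms b)+
  obtain s where s: "z = tlift (\<lambda>t z. tensor_hom_left j k t z) s" using tensor_hom_left_surj by (meson surjD)
  have "tact f g (lapp (mult_extend j k m) (tlift (\<lambda>t z. tensor_hom_left j k t z) s)) \<xi>
      = X (tact f g (tlift (\<lambda>t z. tensor_hom_left j k t z) s) \<xi>)"
  proof (rule clinear_eq_tensor[where t=s])
    show "clinear (\<lambda>s. tact f g (lapp (mult_extend j k m) (tlift (\<lambda>t z. tensor_hom_left j k t z) s)) \<xi>)"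
      "clinear (\<lambda>s. X (tact f g (tlift (\<lambda>t z. tensor_hom_left j k t z) s) \<xi>))"
      by (intro clinear_compose[OF X(1)] clinear_tact f clinear_app_comp clinear_tlift tensor_hom_left_bilinear)+
  qed (simp add: tlift_tensor tensor_hom_left_bilinear lapp_mult_extend hom X(2))
  then show ?thesis by (simp add: s)
qed

end

lemma nondegenerate_hom_of_alg:
  assumes "surj (mu :: ('a::complex_algebra, 'a) tensor \<Rightarrow> 'a)"
  shows "nondegenerate_hom (of_alg :: 'a \<Rightarrow> _)"
proof -
  have "tlift (\<lambda>x u. u * x) (tensor_flip t) = mu t" for t :: "('a, 'a) tensor"
    by (rule clinear_eq_tensor[where t=t]) ((intro clin)+, simp add: tensor_flip_tensor tlift_tensor clin)
  then have "surj (tlift (\<lambda>x u::'a. u * x))" using assms by (metis surj_def)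
  then show ?thesis using assms unfolding nondegenerate_hom_def of_alg_app
    by (simp add: clinear_of_alg of_alg_times)
qed

text \<open>
  A faithful action turns the construction of a multiplier into the construction of an operator
  that can be composed, on either side, with the operators of the algebra.
\<close>

lemma multiplier_of_operator:
  fixes \<sigma> :: "'n::complex_algebra \<Rightarrow> 'm::complex_vector \<Rightarrow> 'm"
  assumes lin: "\<And>\<xi>. clinear (\<lambda>n. \<sigma> n \<xi>)" and times: "\<And>n n' \<xi>. \<sigma> (n * n') \<xi> = \<sigma> n (\<sigma> n' \<xi>)"
    and faithful: "\<And>n. (\<And>\<xi>. \<sigma> n \<xi> = 0) \<Longrightarrow> n = 0" and X: "clinear X"
    and left: "\<And>n. \<exists>n'. \<forall>\<xi>. \<sigma> n' \<xi> = X (\<sigma> n \<xi>)" and right: "\<And>n. \<exists>n'. \<forall>\<xi>. \<sigma> n' \<xi> = \<sigma> n (X \<xi>)"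
  obtains m where "\<And>n \<xi>. \<sigma> (lapp m n) \<xi> = X (\<sigma> n \<xi>)" "\<And>n \<xi>. \<sigma> (rapp n m) \<xi> = \<sigma> n (X \<xi>)"
proof -
  have eqI: "n = n'" if "\<And>\<xi>. \<sigma> n \<xi> = \<sigma> n' \<xi>" for n n'
    using faithful[of "n - n'"] that by (simp add: clinear_diff[OF lin])
  from left obtain L where L: "\<And>n \<xi>. \<sigma> (L n) \<xi> = X (\<sigma> n \<xi>)" by metis
  from right obtain R where R: "\<And>n \<xi>. \<sigma> (R n) \<xi> = \<sigma> n (X \<xi>)" by metis
  have "clinear L" "clinear R"
    by (rule clinearI; rule eqI; simp add: L R clinearD[OF lin] clinearD[OF X])+
  moreover have "L (x * y) = L x * y" "R (x * y) = x * R y" "x * L y = R x * y" for x y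
    by (rule eqI; simp add: L R times)+
  ultimately obtain m where "\<And>n. lapp m n = L n" "\<And>n. rapp n m = R n"
    using multiplier_exists[of L R] by blast
  then show ?thesis using that[of m] by (simp add: L R)
qed

section \<open>The canonical maps\<close>

lemma nondegenerate_tensor_leg_eqI:
  fixes s t :: "('a::nondegenerate_algebra, 'a) tensor"
  shows "(\<And>w. lapp (of_alg w \<otimes>\<^sub>m 1) s = lapp (of_alg w \<otimes>\<^sub>m 1) t) \<Longrightarrow> s = t"
    and "(\<And>w. rapp s (1 \<otimes>\<^sub>m of_alg w) = rapp t (1 \<otimes>\<^sub>m of_alg w)) \<Longrightarrow> s = t"
proof -
  assume *: "\<And>w. lapp (of_alg w \<otimes>\<^sub>m 1) s = lapp (of_alg w \<otimes>\<^sub>m 1) t"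
  have "(w \<otimes> z) * s = (w \<otimes> z) * t" for w z
  proof -
    have "(w \<otimes> z) * s = lapp ((1 \<otimes>\<^sub>m of_alg z) * (of_alg w \<otimes>\<^sub>m 1)) s" for s :: "('a, 'a) tensor"
      by (simp only: mult_tensor_times) (simp add: mult_tensor_of_alg of_alg_app)
    then show ?thesis using * by simp
  qed
  then have "z * s = z * t" for z
    by (induction z) (simp_all add: distrib_right)
  then show "s = t" by (rule nondegenerate_right_eqI)
next
  assume *: "\<And>w. rapp s (1 \<otimes>\<^sub>m of_alg w) = rapp t (1 \<otimes>\<^sub>m of_alg w)"
  have "s * (z \<otimes> w) = t * (z \<otimes> w)" for w z
  proof -
    have "s * (z \<otimes> w) = rapp s ((1 \<otimes>\<^sub>m of_alg w) * (of_alg z \<otimes>\<^sub>m 1))" for s :: "('a, 'a) tensor"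
      by (simp only: mult_tensor_times) (simp add: mult_tensor_of_alg of_alg_app)
    then show ?thesis using * by simp
  qed
  then have "s * z = t * z" for z
    by (induction z) (simp_all add: distrib_left)
  then show "s = t" by (rule nondegenerate_left_eqI)
qed

lemma slice_leg:
  fixes t :: "('a::complex_algebra, 'b::complex_algebra) tensor"
  shows "clinear \<omega> \<Longrightarrow> slice_left \<omega> (lapp (of_alg x \<otimes>\<^sub>m 1) t) = slice_left (\<lambda>p. \<omega> (x * p)) t"
    and "clinear \<omega> \<Longrightarrow> slice_left \<omega> (rapp t (of_alg x \<otimes>\<^sub>m 1)) = slice_left (\<lambda>p. \<omega> (p * x)) t"
    and "clinear \<omega> \<Longrightarrow> slice_left \<omega> (lapp (1 \<otimes>\<^sub>m of_alg y) t) = y * slice_left \<omega> t"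
    and "clinear \<omega> \<Longrightarrow> slice_left \<omega> (rapp t (1 \<otimes>\<^sub>m of_alg y)) = slice_left \<omega> t * y"
    and "clinear \<omega>' \<Longrightarrow> slice_right \<omega>' (lapp (of_alg x \<otimes>\<^sub>m 1) t) = x * slice_right \<omega>' t"
    and "clinear \<omega>' \<Longrightarrow> slice_right \<omega>' (rapp t (of_alg x \<otimes>\<^sub>m 1)) = slice_right \<omega>' t * x"
    and "clinear \<omega>' \<Longrightarrow> slice_right \<omega>' (lapp (1 \<otimes>\<^sub>m of_alg y) t) = slice_right (\<lambda>p. \<omega>' (y * p)) t"
    and "clinear \<omega>' \<Longrightarrow> slice_right \<omega>' (rapp t (1 \<otimes>\<^sub>m of_alg y)) = slice_right (\<lambda>p. \<omega>' (p * y)) t"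
  by (simp_all add: lapp_mult_tensor rapp_mult_tensor slice_left_tensor_map slice_right_tensor_map
    multiplierD(1,2) of_alg_app clin)

text \<open>
  Most equations in \<open>A \<otimes> A\<close> are proved with this criterion.  The factor \<open>w\<close> is there because only covered slices,
  such as \<open>(\<omega> \<otimes> \<iota>)((w \<otimes> 1)\<Delta>(a))\<close>, are elements of \<open>A\<close> to which coassociativity can be applied.
\<close>

lemma slice_leg_separates:
  fixes s t :: "('a::nondegenerate_algebra, 'a) tensor"
  shows "(\<And>\<omega> w. clinear \<omega> \<Longrightarrow>
      slice_left \<omega> (lapp (of_alg w \<otimes>\<^sub>m 1) s) = slice_left \<omega> (lapp (of_alg w \<otimes>\<^sub>m 1) t)) \<Longrightarrow> s = t"
    and "(\<And>\<omega> w. clinear \<omega> \<Longrightarrow>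
      slice_right \<omega> (rapp s (1 \<otimes>\<^sub>m of_alg w)) = slice_right \<omega> (rapp t (1 \<otimes>\<^sub>m of_alg w))) \<Longrightarrow> s = t"
  by (rule nondegenerate_tensor_leg_eqI, rule slice_left_all_eqI, assumption)
    (rule nondegenerate_tensor_leg_eqI, rule slice_right_all_eqI, assumption)

lemma tensor_flip_times: "tensor_flip (s * t) = tensor_flip s * tensor_flip t"
  for s t :: "('a::complex_algebra, 'b::complex_algebra) tensor"
proof (induction s)
  case (tensor x y)
  show ?case
    by (induction t) (simp_all add: tensor_times_tensor tensor_flip_tensor distrib_left clinearD(1)[OF clinear_tensor_flip])
qed (simp add: distrib_right clinearD(1)[OF clinear_tensor_flip])

lemma mult_flip_app:
  fixes m :: "('a::complex_algebra, 'b::complex_algebra) tensor multiplier"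
  shows "lapp (mult_flip m) t = tensor_flip (lapp m (tensor_flip t))"
    and "rapp t (mult_flip m) = tensor_flip (rapp (tensor_flip t) m)"
proof -
  let ?L = "\<lambda>t. tensor_flip (lapp m (tensor_flip t))" and ?R = "\<lambda>t. tensor_flip (rapp (tensor_flip t) m)"
  have c: "clinear ?L" "clinear ?R"
    by (intro clin)+
  have m: "x * ?L y = ?R x * y" for x y
  proof -
    have "x * ?L y = tensor_flip (tensor_flip x * lapp m (tensor_flip y))"
      by (simp add: tensor_flip_times tensor_flip_flip)
    also have "\<dots> = ?R x * y"
      by (simp add: multiplierD(5) tensor_flip_times tensor_flip_flip)
    finally show ?thesis .
  qed
  have "(?L, ?R) \<in> {(L, R). clinear L \<and> clinear R \<and> (\<forall>s t. L (s * t) = L s * t) \<and>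
     (\<forall>s t. R (s * t) = s * R t) \<and> (\<forall>s t. s * L t = R s * t)}"
    using c m by (simp add: tensor_flip_times multiplierD(3,4) tensor_flip_flip)
  then have "Rep_multiplier (mult_flip m) = (?L, ?R)"
    unfolding mult_flip_def by (rule Abs_multiplier_inverse)
  then show "lapp (mult_flip m) t = tensor_flip (lapp m (tensor_flip t))"
    and "rapp t (mult_flip m) = tensor_flip (rapp (tensor_flip t) m)"
    by (simp_all add: lapp.rep_eq[of "mult_flip m"] rapp.rep_eq[of _ "mult_flip m"])
qed

lemma mult_flip_hom:
  fixes m n :: "('a::complex_algebra, 'b::complex_algebra) tensor multiplier" and t :: "('a, 'b) tensor"
    and p :: "'a multiplier" and q :: "'b multiplier"
  shows "mult_flip (m * n) = mult_flip m * mult_flip n"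
    and "mult_flip (of_alg t) = of_alg (tensor_flip t)"
    and "mult_flip (p \<otimes>\<^sub>m q) = q \<otimes>\<^sub>m p"
proof -
  show "mult_flip (m * n) = mult_flip m * mult_flip n"
    by (rule multiplier_eqI) (simp_all add: fun_eq_iff mult_flip_app tensor_flip_flip)
  show "mult_flip (of_alg t) = of_alg (tensor_flip t)"
    by (rule multiplier_eqI) (simp_all add: fun_eq_iff mult_flip_app of_alg_app tensor_flip_times tensor_flip_flip)
  show "mult_flip (p \<otimes>\<^sub>m q) = q \<otimes>\<^sub>m p"
    by (rule mult_tensor_eqI) (simp_all add: mult_flip_app mult_tensor_app tensor_flip_tensor)
qed

text \<open>
  In the notation of Sweedler, \<open>T1 a b = a\<^sub>1 \<otimes> a\<^sub>2 b\<close>, \<open>T2 a b = a b\<^sub>1 \<otimes> b\<^sub>2\<close>,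
  \<open>T3 a b = a\<^sub>1 b \<otimes> a\<^sub>2\<close> and \<open>T4 a b = b\<^sub>1 \<otimes> a b\<^sub>2\<close>.
\<close>

definition T1 :: "'a::algebraic_quantum_group \<Rightarrow> 'a \<Rightarrow> ('a, 'a) tensor"
  where "T1 = comult_right comult"

definition T2 :: "'a::algebraic_quantum_group \<Rightarrow> 'a \<Rightarrow> ('a, 'a) tensor"
  where "T2 = comult_left comult"

definition T3 :: "'a::algebraic_quantum_group \<Rightarrow> 'a \<Rightarrow> ('a, 'a) tensor"
  where "T3 a b = alg_elem (comult a * (of_alg b \<otimes>\<^sub>m 1))"

definition T4 :: "'a::algebraic_quantum_group \<Rightarrow> 'a \<Rightarrow> ('a, 'a) tensor"
  where "T4 a b = alg_elem ((1 \<otimes>\<^sub>m of_alg a) * comult b)"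

lemmas regular_comult = regular_multiplier_hopf_algebra_comult[unfolded regular_multiplier_hopf_algebra_def]

lemma clinear_comult [clin]: "clinear (comult :: 'a::algebraic_quantum_group \<Rightarrow> _)"
  using regular_comult by blast

lemma comult_times: "comult (a * b) = comult a * comult b" for a :: "'a::algebraic_quantum_group"
  using regular_comult[where ?'a='a] by blast

lemma of_alg_canonical:
  fixes a b :: "'a::algebraic_quantum_group"
  shows "of_alg (T1 a b) = comult a * (1 \<otimes>\<^sub>m of_alg b)"
    and "of_alg (T2 a b) = (of_alg a \<otimes>\<^sub>m 1) * comult b"
    and "of_alg (T3 a b) = comult a * (of_alg b \<otimes>\<^sub>m 1)"
    and "of_alg (T4 a b) = (1 \<otimes>\<^sub>m of_alg a) * comult b"
proof -
  have "comult a * (1 \<otimes>\<^sub>m of_alg b) \<in> range of_alg" "(of_alg a \<otimes>\<^sub>m 1) * comult b \<in> range of_alg"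
    "comult a * (of_alg b \<otimes>\<^sub>m 1) \<in> range of_alg" "(1 \<otimes>\<^sub>m of_alg a) * comult b \<in> range of_alg"
    using regular_comult[where ?'a='a] by blast+
  then show "of_alg (T1 a b) = comult a * (1 \<otimes>\<^sub>m of_alg b)"
    "of_alg (T2 a b) = (of_alg a \<otimes>\<^sub>m 1) * comult b"
    "of_alg (T3 a b) = comult a * (of_alg b \<otimes>\<^sub>m 1)"
    "of_alg (T4 a b) = (1 \<otimes>\<^sub>m of_alg a) * comult b"
    unfolding T1_def T2_def T3_def T4_def comult_right_def comult_left_def by fastforce+
qed

lemma clinear_canonical [clin]:
  fixes b :: "'a::algebraic_quantum_group"
  shows "clinear f \<Longrightarrow> clinear (\<lambda>x. T1 (f x) b)" "clinear f \<Longrightarrow> clinear (\<lambda>x. T1 b (f x))"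
    "clinear f \<Longrightarrow> clinear (\<lambda>x. T2 (f x) b)" "clinear f \<Longrightarrow> clinear (\<lambda>x. T2 b (f x))"
    "clinear f \<Longrightarrow> clinear (\<lambda>x. T3 (f x) b)" "clinear f \<Longrightarrow> clinear (\<lambda>x. T3 b (f x))"
    "clinear f \<Longrightarrow> clinear (\<lambda>x. T4 (f x) b)" "clinear f \<Longrightarrow> clinear (\<lambda>x. T4 b (f x))"
  by (rule clinearI; rule of_alg_inj;
    simp add: of_alg_canonical clinearD[OF clinear_of_alg] clinearD[OF clinear_comult] clinearD(1,2)[of f]
      clinearD[OF clinear_mult_tensor(1)[OF clinear_basic(1)]] clinearD[OF clinear_mult_tensor(2)[OF clinear_basic(1)]]
      distrib_left distrib_right mult_scaleC_left mult_scaleC_right)+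

text \<open>All exchange rules below express that \<open>x \<Delta>(a) y\<close> can be bracketed in two ways.\<close>

lemma canonical_exchange:
  fixes a b c x y :: "'a::algebraic_quantum_group"
  shows "lapp (of_alg x \<otimes>\<^sub>m 1) (T1 a b) = rapp (T2 x a) (1 \<otimes>\<^sub>m of_alg b)"
    and "rapp (T1 a b) (of_alg c \<otimes>\<^sub>m 1) = rapp (T3 a c) (1 \<otimes>\<^sub>m of_alg b)"
    and "lapp (1 \<otimes>\<^sub>m of_alg x) (T1 a b) = rapp (T4 x a) (1 \<otimes>\<^sub>m of_alg b)"
    and "lapp (of_alg x \<otimes>\<^sub>m 1) (T3 a b) = rapp (T2 x a) (of_alg b \<otimes>\<^sub>m 1)"
    and "lapp (1 \<otimes>\<^sub>m of_alg x) (T2 y a) = lapp (of_alg y \<otimes>\<^sub>m 1) (T4 x a)"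
    and "lapp (1 \<otimes>\<^sub>m of_alg x) (T3 a b) = rapp (T4 x a) (of_alg b \<otimes>\<^sub>m 1)"
  by (rule of_alg_inj; simp add: of_alg_lapp[symmetric] of_alg_rapp[symmetric] of_alg_canonical mult.assoc mult_tensor_times;
    simp add: mult.assoc[symmetric] mult_tensor_times)+

lemma canonical_app:
  fixes a b x y :: "'a::algebraic_quantum_group"
  shows "lapp (comult a) (x \<otimes> y) = rapp (T1 a y) (of_alg x \<otimes>\<^sub>m 1)"
    and "lapp (comult a) (x \<otimes> y) = rapp (T3 a x) (1 \<otimes>\<^sub>m of_alg y)"
    and "rapp (x \<otimes> y) (comult a) = lapp (of_alg x \<otimes>\<^sub>m 1) (T4 y a)"
    and "rapp (x \<otimes> y) (comult a) = lapp (1 \<otimes>\<^sub>m of_alg y) (T2 x a)"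
  by (rule of_alg_inj; simp add: of_alg_lapp[symmetric] of_alg_rapp[symmetric] of_alg_canonical mult.assoc mult_tensor_times
    mult_tensor_of_alg; simp add: mult.assoc[symmetric] mult_tensor_times mult_tensor_of_alg)+

lemma canonical_times:
  fixes a a' b :: "'a::algebraic_quantum_group"
  shows "lapp (comult a) (T1 a' b) = T1 (a * a') b"
    and "lapp (comult a) (T3 a' b) = T3 (a * a') b"
    and "rapp (T2 b a') (comult a) = T2 b (a' * a)"
    and "rapp (T4 b a') (comult a) = T4 b (a' * a)"
    and "rapp (T1 a b) (1 \<otimes>\<^sub>m of_alg a') = T1 a (b * a')"
  by (rule of_alg_inj; simp add: of_alg_lapp[symmetric] of_alg_rapp[symmetric] of_alg_canonical comult_times mult.assoc mult_tensor_times of_alg_times)+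

text \<open>
  Up to flips of the legs, \<open>T3\<close> and \<open>T4\<close> are the canonical maps of the flipped coproduct.
\<close>

lemma bij_canonical:
  shows "bij (tlift T1 :: ('a::algebraic_quantum_group, 'a) tensor \<Rightarrow> _)"
    and "bij (tlift T2 :: ('a::algebraic_quantum_group, 'a) tensor \<Rightarrow> _)"
    and "bij (tlift T3 :: ('a::algebraic_quantum_group, 'a) tensor \<Rightarrow> _)"
    and "bij (tlift T4 :: ('a::algebraic_quantum_group, 'a) tensor \<Rightarrow> _)"
proof -
  show "bij (tlift T1 :: ('a, 'a) tensor \<Rightarrow> _)" "bij (tlift T2 :: ('a, 'a) tensor \<Rightarrow> _)"
    unfolding T1_def T2_def using regular_comult[where ?'a='a] by blast+
  have "comult_right (\<lambda>a. mult_flip (comult a)) a b = alg_elem (mult_flip (of_alg (T3 a b)))" for a b :: 'a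
    unfolding comult_right_def of_alg_canonical mult_flip_hom ..
  then have right: "comult_right (\<lambda>a. mult_flip (comult a)) = (\<lambda>a b :: 'a. tensor_flip (T3 a b))"
    by (simp add: fun_eq_iff mult_flip_hom)
  have "comult_left (\<lambda>a. mult_flip (comult a)) a b = alg_elem (mult_flip (of_alg (T4 a b)))" for a b :: 'a
    unfolding comult_left_def of_alg_canonical mult_flip_hom ..
  then have left: "comult_left (\<lambda>a. mult_flip (comult a)) = (\<lambda>a b :: 'a. tensor_flip (T4 a b))"
    by (simp add: fun_eq_iff mult_flip_hom)
  have unflip: "bij (tlift f)" if "bij (tlift (\<lambda>a b. tensor_flip (f a b)))" for f :: "'a \<Rightarrow> 'a \<Rightarrow> ('a, 'a) tensor"
  proof -
    have "tlift f = tensor_flip \<circ> tlift (\<lambda>a b. tensor_flip (f a b))"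
      by (simp add: fun_eq_iff clinear_tlift_push[OF clinear_tensor_flip] tensor_flip_flip)
    moreover have "bij (tensor_flip :: ('a, 'a) tensor \<Rightarrow> _)"
      by (rule o_bij[of tensor_flip]) (simp_all add: fun_eq_iff tensor_flip_flip)
    ultimately show ?thesis using that by (simp add: bij_comp)
  qed
  show "bij (tlift T3 :: ('a, 'a) tensor \<Rightarrow> _)" "bij (tlift T4 :: ('a, 'a) tensor \<Rightarrow> _)"
    using regular_comult[where ?'a='a, unfolded right left] unflip by blast+
qed

lemma cbilinear_canonical:
  "cbilinear (T1 :: 'a::algebraic_quantum_group \<Rightarrow> _)" "cbilinear (T2 :: 'a::algebraic_quantum_group \<Rightarrow> _)"
  "cbilinear (T3 :: 'a::algebraic_quantum_group \<Rightarrow> _)" "cbilinear (T4 :: 'a::algebraic_quantum_group \<Rightarrow> _)"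
  by (intro clin)+

lemmas canonical_tensor = cbilinear_canonical[THEN tlift_tensor]
lemmas clinear_canonical_tlift = cbilinear_canonical[THEN clinear_tlift]

lemma canonical_inv:
  fixes t :: "('a::algebraic_quantum_group, 'a) tensor"
  shows "tlift T1 (inv (tlift T1) t) = t" "tlift T2 (inv (tlift T2) t) = t"
    "tlift T3 (inv (tlift T3) t) = t" "tlift T4 (inv (tlift T4) t) = t"
    "inv (tlift T1) (tlift T1 t) = t" "inv (tlift T2) (tlift T2 t) = t"
    "inv (tlift T3) (tlift T3 t) = t" "inv (tlift T4) (tlift T4 t) = t"
  using bij_canonical[where ?'a='a] by (simp_all add: bij_def surj_f_inv_f)

lemma clinear_canonical_inv [clin]:
  fixes f :: "'b::complex_vector \<Rightarrow> ('a::algebraic_quantum_group, 'a) tensor"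
  shows "clinear f \<Longrightarrow> clinear (\<lambda>x. inv (tlift T1) (f x))" "clinear f \<Longrightarrow> clinear (\<lambda>x. inv (tlift T2) (f x))"
    "clinear f \<Longrightarrow> clinear (\<lambda>x. inv (tlift T3) (f x))" "clinear f \<Longrightarrow> clinear (\<lambda>x. inv (tlift T4) (f x))"
  using clinear_compose[OF clinear_inv[OF clinear_canonical_tlift(1) bij_canonical(1)], of f]
    clinear_compose[OF clinear_inv[OF clinear_canonical_tlift(2) bij_canonical(2)], of f]
    clinear_compose[OF clinear_inv[OF clinear_canonical_tlift(3) bij_canonical(3)], of f]
    clinear_compose[OF clinear_inv[OF clinear_canonical_tlift(4) bij_canonical(4)], of f] by auto

text \<open>
  Coassociativity is used in the following form: slicing \<open>\<Delta>\<close> in one leg commutes with applying \<open>\<Delta>\<close>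
  in the other one.
\<close>

lemma coassoc_T1_T2:
  fixes w c y :: "'a::algebraic_quantum_group"
  assumes "clinear \<omega>"
  shows "tensor_map (\<lambda>p. slice_left \<omega> (T2 w p)) (\<lambda>q. q) (T1 c y) = T1 (slice_left \<omega> (T2 w c)) y"
    and "tensor_map (\<lambda>p. p) (\<lambda>q. slice_right \<omega> (T1 q y)) (T2 w c) = T2 w (slice_right \<omega> (T1 c y))"
proof -
  have ca: "clinear (tensor_assoc :: (('a, 'a) tensor, 'a) tensor \<Rightarrow> _)"
    unfolding tensor_assoc_def by (intro clin)
  have assoc: "tensor_assoc (s \<otimes> z) = tlift (\<lambda>x y. x \<otimes> (y \<otimes> z)) s" for s :: "('a, 'a) tensor" and z :: 'a
    unfolding tensor_assoc_def by (intro tlift_tensor clin)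
  have coassoc: "tlift (\<lambda>p q. tensor_assoc (T2 w p \<otimes> q)) (T1 c y) = tlift (\<lambda>p q. p \<otimes> T1 q y) (T2 w c)"
    using regular_comult[where ?'a='a] unfolding T1_def T2_def
    by (simp add: clinear_tlift_push[OF ca, symmetric])
  have s: "slice_left \<omega> (tensor_assoc (s \<otimes> z)) = slice_left \<omega> s \<otimes> z" for s :: "('a, 'a) tensor" and z :: 'a
    unfolding assoc by (rule clinear_eq_tensor[where t=s])
      ((intro clin assms)+, simp add: tlift_tensor clin slice_tensor assms tensor_bilinear)
  have "tensor_map (\<lambda>p. slice_left \<omega> (T2 w p)) (\<lambda>q. q) (T1 c y)
      = slice_left \<omega> (tlift (\<lambda>p q. tensor_assoc (T2 w p \<otimes> q)) (T1 c y))"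
    unfolding tensor_map_def by (simp add: clinear_tlift_push[OF clinear_slice_left] assms s)
  also have "\<dots> = tlift (\<lambda>p q. \<omega> p *\<^sub>C T1 q y) (T2 w c)"
    unfolding coassoc by (simp add: clinear_tlift_push[OF clinear_slice_left] assms slice_tensor)
  also have "\<dots> = T1 (slice_left \<omega> (T2 w c)) y"
    unfolding slice_left_def by (simp add: clinear_tlift_push[OF clinear_canonical(1)[OF clinear_basic(1)]]
      clinearD(2)[OF clinear_canonical(1)[OF clinear_basic(1)]])
  finally show "tensor_map (\<lambda>p. slice_left \<omega> (T2 w p)) (\<lambda>q. q) (T1 c y) = T1 (slice_left \<omega> (T2 w c)) y" .
  let ?s = "tensor_map (\<lambda>x. x) (slice_right \<omega>) :: ('a, ('a, 'a) tensor) tensor \<Rightarrow> ('a, 'a) tensor"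
  have cs: "clinear ?s" by (intro clin assms)
  have s: "?s (tensor_assoc (s \<otimes> z)) = \<omega> z *\<^sub>C s" for s :: "('a, 'a) tensor" and z :: 'a
    unfolding assoc by (rule clinear_eq_tensor[where t=s])
      ((intro clin assms)+, simp add: tlift_tensor clin slice_tensor assms tensor_bilinear tensor_map_tensor)
  have "tensor_map (\<lambda>p. p) (\<lambda>q. slice_right \<omega> (T1 q y)) (T2 w c) = ?s (tlift (\<lambda>p q. p \<otimes> T1 q y) (T2 w c))"
    by (simp add: clinear_tlift_push[OF cs] tensor_map_tensor clin assms) (simp add: tensor_map_def)
  also have "\<dots> = tlift (\<lambda>p q. \<omega> q *\<^sub>C T2 w p) (T1 c y)"
    unfolding coassoc[symmetric] by (simp add: clinear_tlift_push[OF cs] s)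
  also have "\<dots> = T2 w (slice_right \<omega> (T1 c y))"
    unfolding slice_right_def by (simp add: clinear_tlift_push[OF clinear_canonical(4)[OF clinear_basic(1)]]
      clinearD(2)[OF clinear_canonical(4)[OF clinear_basic(1)]])
  finally show "tensor_map (\<lambda>p. p) (\<lambda>q. slice_right \<omega> (T1 q y)) (T2 w c) = T2 w (slice_right \<omega> (T1 c y))" .
qed

lemma tensor_map_leg:
  fixes f :: "'a::complex_algebra \<Rightarrow> 'a" and t :: "('a::complex_algebra, 'b::complex_algebra) tensor"
  assumes "clinear f"
  shows "tensor_map f (\<lambda>q. q) (lapp (1 \<otimes>\<^sub>m of_alg y) t) = lapp (1 \<otimes>\<^sub>m of_alg y) (tensor_map f (\<lambda>q. q) t)"
    and "tensor_map f (\<lambda>q. q) (rapp t (1 \<otimes>\<^sub>m of_alg y)) = rapp (tensor_map f (\<lambda>q. q) t) (1 \<otimes>\<^sub>m of_alg y)"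
  by (rule clinear_eq_tensor[where t=t]; (intro clin assms)?; simp add: mult_tensor_app tensor_map_tensor assms clin)+

lemma tensor_map_leg':
  fixes g :: "'b::complex_algebra \<Rightarrow> 'b" and t :: "('a::complex_algebra, 'b::complex_algebra) tensor"
  assumes "clinear g"
  shows "tensor_map (\<lambda>q. q) g (lapp (of_alg y \<otimes>\<^sub>m 1) t) = lapp (of_alg y \<otimes>\<^sub>m 1) (tensor_map (\<lambda>q. q) g t)"
    and "tensor_map (\<lambda>q. q) g (rapp t (of_alg y \<otimes>\<^sub>m 1)) = rapp (tensor_map (\<lambda>q. q) g t) (of_alg y \<otimes>\<^sub>m 1)"
  by (rule clinear_eq_tensor[where t=t]; (intro clin assms)?; simp add: mult_tensor_app tensor_map_tensor assms clin)+

text \<open>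
  The versions for \<open>T4\<close> and \<open>T3\<close> follow from those for \<open>T1\<close> and \<open>T2\<close>, because multiplying the untouched leg by \<open>z\<close>
  turns one canonical map into the other.
\<close>

lemma coassoc_T4:
  fixes w c y :: "'a::algebraic_quantum_group"
  assumes "clinear \<omega>"
  shows "tensor_map (\<lambda>p. slice_left \<omega> (T2 w p)) (\<lambda>q. q) (T4 y c) = T4 y (slice_left \<omega> (T2 w c))"
proof (rule nondegenerate_tensor_leg_eqI(2))
  fix z
  let ?L = "\<lambda>p. slice_left \<omega> (T2 w p)"
  have L: "clinear ?L" by (intro clin assms)
  have "rapp (tensor_map ?L (\<lambda>q. q) (T4 y c)) (1 \<otimes>\<^sub>m of_alg z) = tensor_map ?L (\<lambda>q. q) (lapp (1 \<otimes>\<^sub>m of_alg y) (T1 c z))"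
    by (simp add: canonical_exchange tensor_map_leg L)
  also have "\<dots> = rapp (T4 y (?L c)) (1 \<otimes>\<^sub>m of_alg z)"
    by (simp only: tensor_map_leg[OF L] coassoc_T1_T2[OF assms]) (simp only: canonical_exchange(3))
  finally show "rapp (tensor_map ?L (\<lambda>q. q) (T4 y c)) (1 \<otimes>\<^sub>m of_alg z) = rapp (T4 y (?L c)) (1 \<otimes>\<^sub>m of_alg z)" .
qed

lemma coassoc_T3:
  fixes w c y :: "'a::algebraic_quantum_group"
  assumes "clinear \<omega>"
  shows "tensor_map (\<lambda>p. p) (\<lambda>q. slice_right \<omega> (T1 q y)) (T3 c w) = T3 (slice_right \<omega> (T1 c y)) w"
proof (rule nondegenerate_tensor_leg_eqI(1))
  fix z
  let ?R = "\<lambda>p. slice_right \<omega> (T1 p y)"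
  have R: "clinear ?R" by (intro clin assms)
  have "lapp (of_alg z \<otimes>\<^sub>m 1) (tensor_map (\<lambda>p. p) ?R (T3 c w)) = tensor_map (\<lambda>p. p) ?R (rapp (T2 z c) (of_alg w \<otimes>\<^sub>m 1))"
    by (simp add: canonical_exchange[symmetric] tensor_map_leg' R)
  also have "\<dots> = lapp (of_alg z \<otimes>\<^sub>m 1) (T3 (?R c) w)"
    by (simp only: tensor_map_leg'[OF R] coassoc_T1_T2[OF assms]) (simp only: canonical_exchange(4))
  finally show "lapp (of_alg z \<otimes>\<^sub>m 1) (tensor_map (\<lambda>p. p) ?R (T3 c w)) = lapp (of_alg z \<otimes>\<^sub>m 1) (T3 (?R c) w)" .
qed

lemma slices_commute:
  fixes w c y :: "'a::algebraic_quantum_group"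
  assumes "clinear \<omega>" "clinear \<omega>'"
  shows "slice_left \<omega> (T2 w (slice_right \<omega>' (T1 c y))) = slice_right \<omega>' (T1 (slice_left \<omega> (T2 w c)) y)"
    and "slice_left \<omega> (T2 w (slice_right \<omega>' (T4 y c))) = slice_right \<omega>' (T4 y (slice_left \<omega> (T2 w c)))"
proof -
  have L: "clinear (\<lambda>p. slice_left \<omega> (T2 w p))" by (intro clin assms)
  show "slice_left \<omega> (T2 w (slice_right \<omega>' (T1 c y))) = slice_right \<omega>' (T1 (slice_left \<omega> (T2 w c)) y)"
    by (simp add: coassoc_T1_T2(1)[OF assms(1), symmetric] slice_right_tensor_map L clin assms)
  show "slice_left \<omega> (T2 w (slice_right \<omega>' (T4 y c))) = slice_right \<omega>' (T4 y (slice_left \<omega> (T2 w c)))"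
    by (simp add: coassoc_T4[OF assms(1), symmetric] slice_right_tensor_map L clin assms)
qed

section \<open>The counit\<close>

lemma tlift_linear: "clinear f \<Longrightarrow> tlift (\<lambda>x y. f (x \<otimes> y)) t = f t"
  by (simp only: clinear_tlift_push[of f, symmetric] tlift_id)

lemma canonical_eqI:
  fixes f g :: "('a::algebraic_quantum_group, 'a) tensor \<Rightarrow> 'b::complex_vector"
  assumes "clinear f" "clinear g"
  shows "(\<And>a b. f (T1 a b) = g (T1 a b)) \<Longrightarrow> f t = g t"
    and "(\<And>a b. f (T2 a b) = g (T2 a b)) \<Longrightarrow> f t = g t"
    and "(\<And>a b. f (T3 a b) = g (T3 a b)) \<Longrightarrow> f t = g t"
    and "(\<And>a b. f (T4 a b) = g (T4 a b)) \<Longrightarrow> f t = g t"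
proof -
  have *: "f t = g t" if T: "clinear (tlift T)" "\<And>a b. tlift T (a \<otimes> b) = T a b" "\<exists>v. t = tlift T v"
    "\<And>a b. f (T a b) = g (T a b)" for T :: "'a \<Rightarrow> 'a \<Rightarrow> ('a, 'a) tensor"
  proof -
    obtain v where "t = tlift T v" using T(3) by blast
    moreover have "f (tlift T v) = g (tlift T v)"
      by (rule clinear_eq_tensor[OF clinear_compose[OF assms(1) T(1)] clinear_compose[OF assms(2) T(1)]])
        (simp add: T)
    ultimately show ?thesis by simp
  qed
  show "(\<And>a b. f (T1 a b) = g (T1 a b)) \<Longrightarrow> f t = g t"
    by (rule *[of T1]) (use clinear_canonical_tlift canonical_tensor canonical_inv(1)[of t, symmetric] in auto)
  show "(\<And>a b. f (T2 a b) = g (T2 a b)) \<Longrightarrow> f t = g t"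
    by (rule *[of T2]) (use clinear_canonical_tlift canonical_tensor canonical_inv(2)[of t, symmetric] in auto)
  show "(\<And>a b. f (T3 a b) = g (T3 a b)) \<Longrightarrow> f t = g t"
    by (rule *[of T3]) (use clinear_canonical_tlift canonical_tensor canonical_inv(3)[of t, symmetric] in auto)
  show "(\<And>a b. f (T4 a b) = g (T4 a b)) \<Longrightarrow> f t = g t"
    by (rule *[of T4]) (use clinear_canonical_tlift canonical_tensor canonical_inv(4)[of t, symmetric] in auto)
qed

lemma exists_nonzero: "\<exists>x::'a::algebraic_quantum_group. x \<noteq> 0"
proof -
  obtain a :: 'a where "left_int a \<noteq> 0"
    using left_integral_left_int by (auto simp: left_integral_def)
  then have "a \<noteq> 0" using clinearD(3)[OF clinear_left_int] by metis
  then show ?thesis by blast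
qed

text \<open>
  The map \<open>\<mu> T1\<^sup>-\<^sup>1\<close> has to be \<open>\<epsilon> \<otimes> \<iota>\<close>.  That \<open>y \<mapsto> \<mu> (T1\<^sup>-\<^sup>1 (y \<otimes> c))\<close> is a scalar multiple of
  \<open>c\<close> is seen on the slices \<open>y\<close> of \<open>T2 a b\<close>, which exhaust the algebra: by coassociativity
  the slices can be pulled out of \<open>T1\<^sup>-\<^sup>1\<close>.
\<close>

lemma counit_exists:
  "\<exists>e :: 'a::algebraic_quantum_group \<Rightarrow> complex. clinear e \<and>
    (\<forall>a b. slice_left e (T1 a b) = a * b) \<and> (\<forall>a b. slice_right e (T2 a b) = a * b)"
proof -
  define E :: "'a \<Rightarrow> 'a \<Rightarrow> 'a" where "E y c = mu (inv (tlift T1) (y \<otimes> c))" for y c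
  have E_lin: "clinear (\<lambda>y. E y c)" "clinear (E y)" for c y
    unfolding E_def by (intro clin)+
  have E_slice: "E (slice_left \<omega> (T2 a b)) c = \<omega> (a * b) *\<^sub>C c" if w: "clinear \<omega>" for \<omega> a b c
  proof -
    let ?L = "\<lambda>p. slice_left \<omega> (T2 a p)"
    have L: "clinear ?L" by (intro clin w)
    define v where "v = inv (tlift T1) (b \<otimes> c)"
    have "tlift T1 (tensor_map ?L (\<lambda>q. q) v) = tensor_map ?L (\<lambda>q. q) (tlift T1 v)" for v
      by (rule clinear_eq_tensor[where t=v])
        ((intro clin L)+, simp add: tensor_map_tensor L clin canonical_tensor coassoc_T1_T2 w)
    then have "tlift T1 (tensor_map ?L (\<lambda>q. q) v) = ?L b \<otimes> c"
      by (simp add: v_def canonical_inv tensor_map_tensor L clin)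
    then have "E (?L b) c = mu (tensor_map ?L (\<lambda>q. q) v)"
      unfolding E_def by (metis canonical_inv(5))
    also have "\<dots> = slice_left \<omega> (lapp (of_alg a \<otimes>\<^sub>m 1) (tlift T1 v))"
    proof (rule clinear_eq_tensor[where t=v])
      show "mu (tensor_map ?L (\<lambda>q. q) (p \<otimes> q)) = slice_left \<omega> (lapp (of_alg a \<otimes>\<^sub>m 1) (tlift T1 (p \<otimes> q)))" for p q
        by (simp add: tensor_map_tensor L clin canonical_tensor tlift_tensor canonical_exchange(1) slice_leg(4) w)
    qed (intro clin L w)+
    also have "\<dots> = \<omega> (a * b) *\<^sub>C c"
      by (simp add: v_def canonical_inv mult_tensor_app of_alg_app slice_tensor w)
    finally show ?thesis .
  qed
  obtain x0 :: 'a where x0: "x0 \<noteq> 0" using exists_nonzero by blast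
  obtain \<omega>0 where w0: "clinear \<omega>0" "\<omega>0 x0 = (1::complex)" using functional_separates[OF x0] by blast
  \<comment> \<open>\<open>\<omega>0\<close> reads off the scalar: \<open>y\<close> is the slice by \<open>\<omega>0\<close> of \<open>x0 \<otimes> y\<close>\<close>
  define e where "e y = \<omega>0 (mu (inv (tlift T2) (x0 \<otimes> y)))" for y
  have e_lin: "clinear e" unfolding e_def by (intro clinear_compose[OF w0(1)] clin)
  have E_e: "E y c = e y *\<^sub>C c" for y c
  proof -
    define v where "v = inv (tlift T2) (x0 \<otimes> y)"
    have "E (slice_left \<omega>0 (tlift T2 v)) c = \<omega>0 (mu v) *\<^sub>C c" for v
    proof (rule clinear_eq_tensor[where t=v])
      show "clinear (\<lambda>v. E (slice_left \<omega>0 (tlift T2 v)) c)"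
        by (intro clinear_compose[OF E_lin(1)] clin w0)
      show "clinear (\<lambda>v. \<omega>0 (mu v) *\<^sub>C c)"
        by (intro clin clinear_compose[OF w0(1)])
      show "E (slice_left \<omega>0 (tlift T2 (x \<otimes> y))) c = \<omega>0 (mu (x \<otimes> y)) *\<^sub>C c" for x y
        by (simp add: canonical_tensor tlift_tensor clin E_slice w0)
    qed
    from this[of v] show ?thesis
      by (simp add: v_def canonical_inv slice_tensor w0 e_def scaleC_one)
  qed
  have "slice_left e (T1 a b) = a * b" for a b
  proof -
    have "slice_left e (T1 a b) = tlift (\<lambda>x y. mu (inv (tlift T1) (x \<otimes> y))) (T1 a b)"
      unfolding slice_left_def using E_e by (simp add: E_def)
    also have "\<dots> = mu (inv (tlift T1) (tlift T1 (a \<otimes> b)))"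
      by (subst tlift_linear, intro clin) (simp add: canonical_tensor)
    finally show ?thesis unfolding canonical_inv by (simp add: tlift_tensor clin)
  qed
  moreover have "slice_right e (T2 a b) = a * b" for a b
  proof (rule functional_eqI)
    fix \<omega> :: "'a \<Rightarrow> complex" assume w: "clinear \<omega>"
    have "\<omega> (slice_right e (T2 a b)) *\<^sub>C x0 = \<omega> (a * b) *\<^sub>C x0"
      using E_slice[OF w, of a b x0] by (simp add: E_e slice_exchange e_lin w)
    then show "\<omega> (slice_right e (T2 a b)) = \<omega> (a * b)"
      using x0 by (simp add: complex_vector.scale_right_imp_eq)
  qed
  ultimately show ?thesis using e_lin by blast
qed

definition counit :: "'a::algebraic_quantum_group \<Rightarrow> complex"
  where "counit = (SOME e. clinear e \<and>
    (\<forall>a b. slice_left e (T1 a b) = a * b) \<and> (\<forall>a b. slice_right e (T2 a b) = a * b))"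

lemma counit:
  shows clinear_counit: "clinear (counit :: 'a::algebraic_quantum_group \<Rightarrow> _)"
    and counit_T1: "slice_left counit (T1 a b) = a * b"
    and counit_T2: "slice_right counit (T2 a b) = (a::'a) * b"
  using someI_ex[OF counit_exists[where ?'a='a]] unfolding counit_def by blast+

declare clinear_counit [clin, simp]

lemma clinear_counit_comp [clin]: "clinear f \<Longrightarrow> clinear (\<lambda>x. counit (f x))"
  by (rule clinear_compose[OF clinear_counit])

lemma counit_T4: "slice_left counit (T4 y a) = y * a" for a y :: "'a::algebraic_quantum_group"
proof (rule nondegenerate_left_eqI)
  fix z
  show "slice_left counit (T4 y a) * z = y * a * z"
    by (simp add: slice_leg(4)[OF clinear_counit, symmetric] canonical_exchange(3)[symmetric])
      (simp add: slice_leg counit_T1 mult.assoc)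
qed

lemma counit_T1_inv: "slice_left counit t = mu (inv (tlift T1) t)"
proof -
  have "slice_left counit (tlift T1 v) = mu v" for v :: "('a, 'a) tensor"
    by (rule clinear_eq_tensor[where t=v])
      ((intro clin)+, simp add: canonical_tensor tlift_tensor clin counit_T1)
  from this[of "inv (tlift T1) t"] show ?thesis by (simp add: canonical_inv)
qed

lemma counit_T2_inv: "slice_right counit t = mu (inv (tlift T2) t)"
proof -
  have "slice_right counit (tlift T2 v) = mu v" for v :: "('a, 'a) tensor"
    by (rule clinear_eq_tensor[where t=v])
      ((intro clin)+, simp add: canonical_tensor tlift_tensor clin counit_T2)
  from this[of "inv (tlift T2) t"] show ?thesis by (simp add: canonical_inv)
qed

lemma counit_slice_T1: "clinear \<omega> \<Longrightarrow> counit (slice_right \<omega> (T1 a y)) = \<omega> (a * y)"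
  by (simp add: slice_exchange counit_T1)

lemma counit_slice_T4: "clinear \<omega> \<Longrightarrow> counit (slice_right \<omega> (T4 y a)) = \<omega> (y * a)"
  by (simp add: slice_exchange counit_T4)

lemma counit_slice_T2: "clinear \<omega> \<Longrightarrow> counit (slice_left \<omega> (T2 w a)) = \<omega> (w * a)"
  by (simp add: slice_exchange[symmetric] counit_T2)

lemma counit_nonzero: "\<exists>x::'a::algebraic_quantum_group. counit x = 1"
proof -
  obtain x :: 'a where x: "x \<noteq> 0" using exists_nonzero by blast
  have "\<exists>y::'a. counit y \<noteq> 0"
  proof (rule ccontr)
    assume "\<nexists>y. counit (y::'a) \<noteq> 0"
    then have "x * z = 0" for z
      using counit_T1[of x z] unfolding slice_left_def tlift_def by (simp add: case_prod_unfold sum_list_0)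
    then show False using nondegenerate_left[of x] x by blast
  qed
  then obtain y :: 'a where "counit y \<noteq> 0" by blast
  then have "counit ((1 / counit y) *\<^sub>C y) = 1"
    by (simp add: clinearD(2)[OF clinear_counit] scaleC_complex_def)
  then show ?thesis by blast
qed

lemma mult_surj: "\<exists>v. mu v = (y::'a::algebraic_quantum_group)"
proof -
  obtain x :: 'a where "counit x = 1" using counit_nonzero by blast
  then have "y = slice_left counit (x \<otimes> y)"
    by (simp add: slice_tensor scaleC_one)
  then show ?thesis by (metis counit_T1_inv)
qed

text \<open>
  As \<open>T1\<close> is surjective, \<open>(\<epsilon> \<otimes> \<iota>)(\<Delta>(a) t) = a (\<epsilon> \<otimes> \<iota>)(t)\<close> for every tensor \<open>t\<close>.  With \<open>t = x \<otimes> y\<close> this computes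
  \<open>\<epsilon>(p x)\<close> on the elements \<open>\<Sum> p \<otimes> q = \<Delta>(a)(1 \<otimes> y)\<close>, and these exhaust \<open>A \<otimes> A\<close>.
\<close>

lemma counit_times: "counit (p * x) = counit p * counit x" for p x :: "'a::algebraic_quantum_group"
proof -
  have a: "slice_left counit (lapp (comult a) t) = a * slice_left counit t" for a :: 'a and t
    by (rule canonical_eqI(1)[where t=t])
      ((intro clin)+, simp add: canonical_times counit_T1 mult.assoc)
  have c: "clinear (\<lambda>p. counit (p * x))" by (intro clin)
  have "slice_left (\<lambda>p. counit (p * x)) t = counit x *\<^sub>C slice_left counit t" for t :: "('a, 'a) tensor"
  proof (rule canonical_eqI(1)[where t=t])
    fix a y :: 'a
    show "slice_left (\<lambda>p. counit (p * x)) (T1 a y) = counit x *\<^sub>C slice_left counit (T1 a y)"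
      using a[of a "x \<otimes> y"]
      by (simp add: canonical_app(1) slice_leg slice_tensor counit_T1 mult_scaleC_right)
  qed (intro clin c)+
  from this[of "p \<otimes> y" for y] have "counit (p * x) *\<^sub>C y = (counit x * counit p) *\<^sub>C y" for y :: 'a
    by (simp add: slice_tensor c scaleC_scaleC)
  then show ?thesis
    using exists_nonzero[where ?'a='a] by (metis complex_vector.scale_right_imp_eq mult.commute)
qed

section \<open>The antipode\<close>

declare clinear_left_int [clin, simp]

lemma clinear_left_int_comp [clin]: "clinear f \<Longrightarrow> clinear (\<lambda>x. left_int (f x))"
  by (rule clinear_compose[OF clinear_left_int])

lemma left_int_invariant:
  fixes a x :: "'a::algebraic_quantum_group"
  shows "slice_right left_int (T3 a x) = left_int a *\<^sub>C x"
    and "slice_right left_int (T2 x a) = left_int a *\<^sub>C x"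
  using left_integral_left_int[where ?'a='a] unfolding left_integral_def T2_def T3_def comult_left_def by blast+

lemma right_integral_invariant:
  fixes a x :: "'a::algebraic_quantum_group"
  assumes "right_integral comult \<psi>"
  shows "slice_left \<psi> (T1 a x) = \<psi> a *\<^sub>C x"
    and "slice_left \<psi> (T4 x a) = \<psi> a *\<^sub>C x"
  using assms unfolding right_integral_def T1_def T4_def comult_right_def by blast+

lemma slice_right_left_int_surj: "\<exists>t :: ('a, 'a) tensor. slice_right left_int t = (x::'a::algebraic_quantum_group)"
proof -
  obtain y :: 'a where y: "left_int y \<noteq> 0"
    using left_integral_left_int by (auto simp: left_integral_def)
  have "slice_right left_int (x \<otimes> ((1 / left_int y) *\<^sub>C y)) = x"
    using y by (simp add: slice_tensor clinearD(2)[OF clinear_left_int] scaleC_complex_def scaleC_one)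
  then show ?thesis by blast
qed

text \<open>
  The antipode is given by \<open>S(x) c = (\<epsilon> \<otimes> \<iota>) (T1\<^sup>-\<^sup>1 (x \<otimes> c))\<close>.  A priori this defines a left
  multiplier \<open>S(x)\<close> only.  The integral shows that \<open>S(x)\<close> lies in the algebra: as
  \<open>T1 (a\<^sub>1 \<otimes> b\<^sub>1 c \<phi>(a\<^sub>2 b\<^sub>2)) = a\<^sub>1 \<phi>(a\<^sub>2 b) \<otimes> c\<close> by left invariance, \<open>S\<close> maps \<open>a\<^sub>1 \<phi>(a\<^sub>2 b)\<close> to
  \<open>b\<^sub>1 \<phi>(a b\<^sub>2)\<close>.
\<close>

lemma antipode_left_int:
  fixes a b c :: "'a::algebraic_quantum_group"
  shows "slice_left counit (inv (tlift T1) (slice_right left_int (T1 a b) \<otimes> c)) = slice_right left_int (T4 a b) * c"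
proof -
  let ?R = "\<lambda>y. slice_right left_int (T1 a y)"
  \<comment> \<open>\<open>u = a\<^sub>1 \<phi>(a\<^sub>2 b\<^sub>2) \<otimes> b\<^sub>1 c\<close>\<close>
  define u where "u = tlift (\<lambda>x y. ?R y \<otimes> x) (T3 b c)"
  have "tlift T1 u = ?R b \<otimes> c"
  proof (rule slice_leg_separates(1))
    fix \<omega> :: "'a \<Rightarrow> complex" and w :: 'a assume w: "clinear \<omega>"
    let ?La = "slice_left \<omega> (T2 w a)"
    let ?f = "\<lambda>t. slice_left \<omega> (lapp (of_alg w \<otimes>\<^sub>m 1) t)"
    have f: "clinear ?f" by (intro clin w)
    have "?f (T1 (?R y) x) = slice_right left_int (lapp (comult ?La) (x \<otimes> y))" for x y
      by (simp add: canonical_exchange(1) slice_leg(4) w slices_commute canonical_app(1) slice_leg(6))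
    then have "?f (tlift T1 u) = tlift (\<lambda>x y. slice_right left_int (lapp (comult ?La) (x \<otimes> y))) (T3 b c)"
      by (simp add: u_def clinear_tlift_push[OF clinear_canonical_tlift(1)] clinear_tlift_push[OF f] canonical_tensor)
    also have "\<dots> = slice_right left_int (lapp (comult ?La) (T3 b c))"
      by (rule tlift_linear) (intro clin)
    also have "\<dots> = left_int (?La * b) *\<^sub>C c"
      by (simp add: canonical_times left_int_invariant)
    also have "left_int (?La * b) = \<omega> (w * ?R b)"
      by (simp add: slice_leg(4)[OF w, symmetric] slice_exchange[OF w clinear_left_int, symmetric]
        canonical_exchange(1)[symmetric] slice_leg(5))
    finally show "?f (tlift T1 u) = ?f (?R b \<otimes> c)"
      by (simp add: mult_tensor_app of_alg_app slice_tensor w)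
  qed
  then have "inv (tlift T1) (?R b \<otimes> c) = u" by (metis canonical_inv(5))
  then have "slice_left counit (inv (tlift T1) (?R b \<otimes> c)) = tlift (\<lambda>x y. left_int (a * y) *\<^sub>C x) (T3 b c)"
    by (simp add: u_def clinear_tlift_push[OF clinear_slice_left[OF clinear_counit]] slice_tensor
      counit_slice_T1)
  also have "\<dots> = slice_right left_int (lapp (1 \<otimes>\<^sub>m of_alg a) (T3 b c))"
    unfolding slice_leg(7)[OF clinear_left_int] slice_leg(8)[OF clinear_left_int] by (simp add: slice_right_def)
  also have "\<dots> = slice_right left_int (T4 a b) * c"
    by (simp add: canonical_exchange(6) slice_leg)
  finally show ?thesis .
qed

text \<open>
  The mirror image of \<open>antipode_left_int\<close> in the opposite algebra: \<open>b\<^sub>1 \<phi>(a b\<^sub>2)\<close> determines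
  \<open>a\<^sub>1 \<phi>(a\<^sub>2 b)\<close>.  This makes the antipode injective.
\<close>

lemma antipode_inverse_left_int:
  fixes a b c :: "'a::algebraic_quantum_group"
  shows "slice_right counit (inv (tlift T4) (slice_right left_int (T4 a b) \<otimes> c)) = c * slice_right left_int (T1 a b)"
proof -
  let ?R = "\<lambda>y. slice_right left_int (T4 y b)"
  \<comment> \<open>\<open>u = c a\<^sub>1 \<otimes> b\<^sub>1 \<phi>(a\<^sub>2 b\<^sub>2)\<close>\<close>
  define u where "u = tlift (\<lambda>x y. x \<otimes> ?R y) (T2 c a)"
  have "tlift T4 u = ?R a \<otimes> c"
  proof (rule slice_leg_separates(1))
    fix \<omega> :: "'a \<Rightarrow> complex" and w :: 'a assume w: "clinear \<omega>"
    let ?Lb = "slice_left \<omega> (T2 w b)"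
    let ?f = "\<lambda>t. slice_left \<omega> (lapp (of_alg w \<otimes>\<^sub>m 1) t)"
    have f: "clinear ?f" by (intro clin w)
    have "?f (T4 x (?R y)) = slice_right left_int (rapp (x \<otimes> y) (comult ?Lb))" for x y
      by (simp add: canonical_exchange(5)[symmetric] slice_leg(3) w slices_commute)
        (simp add: canonical_app(3) slice_leg(5))
    then have "?f (tlift T4 u) = tlift (\<lambda>x y. slice_right left_int (rapp (x \<otimes> y) (comult ?Lb))) (T2 c a)"
      by (simp add: u_def clinear_tlift_push[OF clinear_canonical_tlift(4)] clinear_tlift_push[OF f] canonical_tensor)
    also have "\<dots> = slice_right left_int (rapp (T2 c a) (comult ?Lb))"
      by (rule tlift_linear) (intro clin)
    also have "\<dots> = left_int (a * ?Lb) *\<^sub>C c"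
      by (simp add: canonical_times left_int_invariant)
    also have "left_int (a * ?Lb) = \<omega> (w * ?R a)"
      by (simp add: slice_leg(3)[OF w, symmetric] slice_exchange[OF w clinear_left_int, symmetric]
        canonical_exchange(5) slice_leg(5))
    finally show "?f (tlift T4 u) = ?f (?R a \<otimes> c)"
      by (simp add: mult_tensor_app of_alg_app slice_tensor w)
  qed
  then have "inv (tlift T4) (?R a \<otimes> c) = u" by (metis canonical_inv(8))
  then have "slice_right counit (inv (tlift T4) (?R a \<otimes> c)) = tlift (\<lambda>x y. left_int (y * b) *\<^sub>C x) (T2 c a)"
    by (simp add: u_def clinear_tlift_push[OF clinear_slice_right[OF clinear_counit]] slice_tensor
      counit_slice_T4)
  also have "\<dots> = slice_right left_int (rapp (T2 c a) (1 \<otimes>\<^sub>m of_alg b))"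
    unfolding slice_leg(7)[OF clinear_left_int] slice_leg(8)[OF clinear_left_int] by (simp add: slice_right_def)
  also have "\<dots> = c * slice_right left_int (T1 a b)"
    by (simp add: canonical_exchange(1)[symmetric] slice_leg)
  finally show ?thesis .
qed

lemma antipode_left_int_tlift:
  fixes c :: "'a::algebraic_quantum_group"
  shows "slice_left counit (inv (tlift T1) (slice_right left_int (tlift T1 v) \<otimes> c)) = slice_right left_int (tlift T4 v) * c"
    and "slice_right counit (inv (tlift T4) (slice_right left_int (tlift T4 v) \<otimes> c)) = c * slice_right left_int (tlift T1 v)"
  by (rule clinear_eq_tensor[where t=v]; ((intro clin)+)?;
    simp add: canonical_tensor antipode_left_int antipode_inverse_left_int)+

definition antipode :: "'a::algebraic_quantum_group \<Rightarrow> 'a"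
  where "antipode x = (THE s. \<forall>c. s * c = slice_left counit (inv (tlift T1) (x \<otimes> c)))"

lemma antipode_left:
  fixes x c :: "'a::algebraic_quantum_group"
  shows "antipode x * c = slice_left counit (inv (tlift T1) (x \<otimes> c))"
proof -
  obtain t :: "('a, 'a) tensor" where t: "slice_right left_int t = x" using slice_right_left_int_surj by blast
  have "\<exists>!s. \<forall>c. s * c = slice_left counit (inv (tlift T1) (x \<otimes> c))"
  proof (rule ex1I)
    show "\<forall>c. slice_right left_int (tlift T4 (inv (tlift T1) t)) * c = slice_left counit (inv (tlift T1) (x \<otimes> c))"
      using antipode_left_int_tlift(1)[of "inv (tlift T1) t"] by (simp add: canonical_inv t)
    then show "s = slice_right left_int (tlift T4 (inv (tlift T1) t))"
      if "\<forall>c. s * c = slice_left counit (inv (tlift T1) (x \<otimes> c))" for s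
      using that by - (rule nondegenerate_left_eqI, simp)
  qed
  from theI'[OF this] show ?thesis unfolding antipode_def by blast
qed

lemma antipode_left_int_slice: "antipode (slice_right left_int (tlift T1 v)) = slice_right left_int (tlift T4 v)"
  by (rule nondegenerate_left_eqI) (simp add: antipode_left antipode_left_int_tlift)

lemma clinear_antipode: "clinear (antipode :: 'a::algebraic_quantum_group \<Rightarrow> 'a)"
proof (rule clinearI; rule nondegenerate_left_eqI)
  fix x y z :: 'a and c
  have l: "clinear (\<lambda>x. slice_left counit (inv (tlift T1) (x \<otimes> z)))"
    by (intro clin)
  show "antipode (x + y) * z = (antipode x + antipode y) * z"
    by (simp add: antipode_left distrib_right clinearD[OF l])
  show "antipode (c *\<^sub>C x) * z = (c *\<^sub>C antipode x) * z"
    by (simp add: antipode_left mult_scaleC_left clinearD[OF l])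
qed

lemma clinear_antipode_comp [clin]: "clinear f \<Longrightarrow> clinear (\<lambda>x. antipode (f x))"
  by (rule clinear_compose[OF clinear_antipode])

lemma bij_antipode: "bij (antipode :: 'a::algebraic_quantum_group \<Rightarrow> 'a)"
proof (rule bijI)
  show "inj (antipode :: 'a \<Rightarrow> 'a)"
  proof (rule injI)
    fix x y :: 'a assume "antipode x = antipode y"
    then have 0: "antipode (x - y) = 0" by (simp add: clinear_diff[OF clinear_antipode])
    obtain t :: "('a, 'a) tensor" where t: "slice_right left_int t = x - y" using slice_right_left_int_surj by blast
    define v where "v = inv (tlift T1) t"
    have "slice_right left_int (tlift T4 v) = 0"
      using 0 antipode_left_int_slice[of v] by (simp add: v_def canonical_inv t)
    moreover have l: "clinear (\<lambda>x. slice_right counit (inv (tlift T4) (x \<otimes> c)))" for c :: 'a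
      by (intro clin)
    ultimately have "c * (x - y) = 0" for c
      using antipode_left_int_tlift(2)[of v c] clinearD(3)[OF l[of c]] by (simp add: v_def canonical_inv t)
    then show "x = y" using nondegenerate_right[of "x - y"] by simp
  qed
  show "surj (antipode :: 'a \<Rightarrow> 'a)"
    unfolding surj_def
  proof
    fix y :: 'a
    obtain t :: "('a, 'a) tensor" where "slice_right left_int t = y" using slice_right_left_int_surj by blast
    then show "\<exists>x. y = antipode x"
      using antipode_left_int_slice[of "inv (tlift T4) t"] by (metis canonical_inv(4))
  qed
qed

text \<open>
  If \<open>a \<otimes> c = \<Sum> T1 (p \<otimes> q)\<close> and \<open>b \<otimes> p = \<Sum> T2 (r \<otimes> s)\<close>, coassociativity gives
  \<open>T2\<^sup>-\<^sup>1 (b \<otimes> a) \<otimes> c = \<Sum> r \<otimes> T1 (s \<otimes> q)\<close>.  Applying the counit to the second leg and multiplying, one obtains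
  \<open>\<Sum> r s q\<close>, and this is also what the description of \<open>b (S(a) c)\<close> through \<open>T1\<close> yields.
\<close>

lemma antipode_right:
  fixes a b :: "'a::algebraic_quantum_group"
  shows "b * antipode a = slice_right counit (inv (tlift T2) (b \<otimes> a))"
proof (rule nondegenerate_left_eqI)
  fix c
  define G where "G x = slice_right counit (inv (tlift T2) (b \<otimes> x))" for x
  have G: "clinear G" unfolding G_def by (intro clin)
  \<comment> \<open>\<open>Y (p \<otimes> q) = \<Sum> r \<otimes> s q\<close>, where \<open>b \<otimes> p = T2 (\<Sum> r \<otimes> s)\<close>\<close>
  define Y where "Y v = tlift (\<lambda>p q. tlift (\<lambda>r s. r \<otimes> (s * q)) (inv (tlift T2) (b \<otimes> p))) v" for v :: "('a, 'a) tensor"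
  have Y: "clinear Y" unfolding Y_def by (intro clin)
  have "tlift (\<lambda>x y. G x \<otimes> y) (tlift T1 v) = Y v" for v
  proof (rule clinear_eq_tensor[where t=v])
    show "clinear (\<lambda>v. tlift (\<lambda>x y. G x \<otimes> y) (tlift T1 v))"
      by (intro clin clinear_compose[OF G])
    show "tlift (\<lambda>x y. G x \<otimes> y) (tlift T1 (p \<otimes> q)) = Y (p \<otimes> q)" for p q
    proof (rule slice_right_all_eqI)
      fix \<omega> :: "'a \<Rightarrow> complex" assume w: "clinear \<omega>"
      let ?R = "\<lambda>x. slice_right \<omega> (T1 x q)"
      have R: "clinear ?R" by (intro clin w)
      have wq: "clinear (\<lambda>s. \<omega> (s * q))" by (intro clinear_compose[OF w] clin)
      have "tlift T2 (tensor_map (\<lambda>x. x) ?R t) = tensor_map (\<lambda>x. x) ?R (tlift T2 t)" for t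
        by (rule clinear_eq_tensor[where t=t])
          ((intro clin R)+, simp add: tensor_map_tensor R clin canonical_tensor coassoc_T1_T2 w)
      then have "tlift T2 (tensor_map (\<lambda>x. x) ?R (inv (tlift T2) (b \<otimes> p))) = b \<otimes> ?R p"
        by (simp add: canonical_inv tensor_map_tensor R clin)
      then have inv: "inv (tlift T2) (b \<otimes> ?R p) = tensor_map (\<lambda>x. x) ?R (inv (tlift T2) (b \<otimes> p))"
        by (metis canonical_inv(6))
      have "slice_right \<omega> (tlift (\<lambda>x y. G x \<otimes> y) (tlift T1 (p \<otimes> q))) = tlift (\<lambda>x y. \<omega> y *\<^sub>C G x) (T1 p q)"
        by (simp add: canonical_tensor clinear_tlift_push[OF clinear_slice_right[OF w]] slice_tensor w)
      also have "\<dots> = G (?R p)"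
        unfolding slice_right_def by (simp add: clinear_tlift_push[OF G] clinearD(2)[OF G])
      also have "\<dots> = slice_right (\<lambda>s. \<omega> (s * q)) (inv (tlift T2) (b \<otimes> p))"
        unfolding G_def inv by (simp add: slice_right_tensor_map R clin counit_slice_T1 w)
      also have "\<dots> = slice_right \<omega> (tlift (\<lambda>r s. r \<otimes> (s * q)) (inv (tlift T2) (b \<otimes> p)))"
        by (simp add: clinear_tlift_push[OF clinear_slice_right[OF w]] slice_tensor w) (simp add: slice_right_def)
      also have "tlift (\<lambda>r s. r \<otimes> (s * q)) (inv (tlift T2) (b \<otimes> p)) = Y (p \<otimes> q)"
        unfolding Y_def by (subst tlift_tensor) (intro clin | simp)+
      finally show "slice_right \<omega> (tlift (\<lambda>x y. G x \<otimes> y) (tlift T1 (p \<otimes> q))) = slice_right \<omega> (Y (p \<otimes> q))" .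
    qed
  qed (rule Y)
  from this[of "inv (tlift T1) (a \<otimes> c)"] have "G a \<otimes> c = Y (inv (tlift T1) (a \<otimes> c))"
    unfolding canonical_inv by (subst (asm) tlift_tensor) (intro clin G | simp)+
  then have "G a * c = mu (Y (inv (tlift T1) (a \<otimes> c)))"
    by (metis tlift_tensor cbilinear_mu)
  also have "mu (Y v) = b * slice_left counit v" for v
  proof (rule clinear_eq_tensor[where t=v])
    fix p q
    have "Y (p \<otimes> q) = tlift (\<lambda>r s. r \<otimes> (s * q)) (inv (tlift T2) (b \<otimes> p))"
      unfolding Y_def by (rule tlift_tensor) (intro clin)
    then have "mu (Y (p \<otimes> q)) = tlift (\<lambda>r s. (r * s) * q) (inv (tlift T2) (b \<otimes> p))"
      by (simp add: clinear_tlift_push[OF clinear_tlift[OF cbilinear_mu]] tlift_tensor cbilinear_mu mult.assoc)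
    also have "\<dots> = mu (inv (tlift T2) (b \<otimes> p)) * q"
      by (rule clinear_tlift_push[symmetric]) (intro clin)
    also have "\<dots> = b * slice_left counit (p \<otimes> q)"
      by (simp add: counit_T2_inv[symmetric] slice_tensor mult_scaleC_left mult_scaleC_right)
    finally show "mu (Y (p \<otimes> q)) = b * slice_left counit (p \<otimes> q)" .
  qed (intro clin Y clinear_compose[OF clinear_tlift[OF cbilinear_mu] Y])+
  also have "b * slice_left counit (inv (tlift T1) (a \<otimes> c)) = b * antipode a * c"
    by (simp add: antipode_left mult.assoc)
  finally show "b * antipode a * c = slice_right counit (inv (tlift T2) (b \<otimes> a)) * c"
    by (simp add: G_def)
qed

text \<open>
  If \<open>x \<otimes> c = \<Sum> \<Delta>(p)(1 \<otimes> q)\<close> and \<open>y \<otimes> q = \<Sum> \<Delta>(r)(1 \<otimes> s)\<close>, then \<open>x y \<otimes> c = \<Sum> \<Delta>(p r)(1 \<otimes> s)\<close>, and the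
  multiplicativity of \<open>\<epsilon>\<close> gives \<open>S(x y) c = \<Sum> \<epsilon>(p) \<epsilon>(r) s = S(y) S(x) c\<close>.
\<close>

lemma antipode_times: "antipode (x * y) = antipode y * antipode x" for x y :: "'a::algebraic_quantum_group"
proof (rule nondegenerate_left_eqI)
  fix c
  define v where "v = inv (tlift T1) (x \<otimes> c)"
  define W where "W = tlift (\<lambda>p q. lapp (of_alg p \<otimes>\<^sub>m 1) (inv (tlift T1) (y \<otimes> q)))"
  have W: "clinear W" unfolding W_def by (rule clinear_tlift) (intro clin)
  have W': "W (p \<otimes> q) = lapp (of_alg p \<otimes>\<^sub>m 1) (inv (tlift T1) (y \<otimes> q))" for p q
    unfolding W_def by (rule tlift_tensor) (intro clin)
  have l: "tlift T1 (lapp (of_alg p \<otimes>\<^sub>m 1) t) = lapp (comult p) (tlift T1 t)" for p :: 'a and t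
    by (rule clinear_eq_tensor[where t=t])
      ((intro clin)+, simp add: mult_tensor_app of_alg_app canonical_tensor canonical_times)
  have "tlift T1 (W t) = rapp (tlift T1 t) (of_alg y \<otimes>\<^sub>m 1)" for t
    by (rule clinear_eq_tensor[where t=t])
      ((intro clin W)+, simp add: W' l canonical_inv canonical_tensor canonical_app(1))
  from this[of v] have "tlift T1 (W v) = (x * y) \<otimes> c"
    by (simp add: v_def canonical_inv mult_tensor_app of_alg_app)
  then have "antipode (x * y) * c = slice_left counit (W v)"
    unfolding antipode_left by (metis canonical_inv(5))
  also have "slice_left counit (W t) = antipode y * slice_left counit t" for t
  proof (rule clinear_eq_tensor[where t=t])
    have "slice_left counit (lapp (of_alg p \<otimes>\<^sub>m 1) s) = counit p *\<^sub>C slice_left counit s" for p :: 'a and s :: "('a, 'a) tensor"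
      by (rule clinear_eq_tensor[where t=s])
        ((intro clin)+, simp add: mult_tensor_app of_alg_app slice_tensor counit_times scaleC_scaleC)
    then show "slice_left counit (W (p \<otimes> q)) = antipode y * slice_left counit (p \<otimes> q)" for p q
      by (simp add: W' antipode_left[symmetric] slice_tensor mult_scaleC_right)
  qed (intro clin W)+
  also have "antipode y * slice_left counit v = antipode y * antipode x * c"
    by (simp add: v_def antipode_left[symmetric] mult.assoc)
  finally show "antipode (x * y) * c = antipode y * antipode x * c" .
qed

text \<open>
  By right invariance \<open>T2 (c b\<^sub>2 \<otimes> \<psi>(b\<^sub>1 a\<^sub>1) a\<^sub>2) = c \<otimes> \<psi>(b a\<^sub>1) a\<^sub>2\<close>, and \<open>\<iota> \<otimes> \<epsilon>\<close> maps the preimage to \<open>c \<psi>(b\<^sub>1 a) b\<^sub>2\<close>.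
\<close>

lemma antipode_right_integral:
  fixes a b :: "'a::algebraic_quantum_group"
  assumes "right_integral comult \<psi>"
  shows "antipode (slice_left \<psi> (T2 b a)) = slice_left \<psi> (T3 b a)"
proof (rule nondegenerate_right_eqI)
  fix c
  have p: "clinear \<psi>" using assms by (simp add: right_integral_def)
  let ?L = "\<lambda>x. slice_left \<psi> (T2 x a)"
  define u where "u = tlift (\<lambda>x y. y \<otimes> ?L x) (T4 c b)"
  have "tlift T2 u = c \<otimes> ?L b"
  proof (rule slice_leg_separates(2))
    fix \<omega> :: "'a \<Rightarrow> complex" and w :: 'a assume w: "clinear \<omega>"
    let ?Ra = "slice_right \<omega> (T1 a w)"
    let ?f = "\<lambda>t. slice_right \<omega> (rapp t (1 \<otimes>\<^sub>m of_alg w))"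
    have f: "clinear ?f" by (intro clin w)
    have "?f (T2 y (?L x)) = slice_left \<psi> (rapp (x \<otimes> y) (comult ?Ra))" for x y
      by (simp add: canonical_exchange(1)[symmetric] slice_leg(5) w slices_commute[symmetric] p)
        (simp add: canonical_app(4) slice_leg(3) p)
    then have "?f (tlift T2 u) = tlift (\<lambda>x y. slice_left \<psi> (rapp (x \<otimes> y) (comult ?Ra))) (T4 c b)"
      by (simp add: u_def clinear_tlift_push[OF clinear_canonical_tlift(2)] clinear_tlift_push[OF f] canonical_tensor)
    also have "\<dots> = slice_left \<psi> (rapp (T4 c b) (comult ?Ra))"
      by (rule tlift_linear) (intro clin p)
    also have "\<dots> = \<psi> (b * ?Ra) *\<^sub>C c"
      by (simp add: canonical_times right_integral_invariant[OF assms])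
    also have "\<psi> (b * ?Ra) = \<omega> (?L b * w)"
      by (simp add: slice_leg(4)[OF p, symmetric] slice_exchange[OF p w, symmetric]
        canonical_exchange(1)[symmetric] slice_leg(5) w)
    finally show "?f (tlift T2 u) = ?f (c \<otimes> ?L b)"
      by (simp add: mult_tensor_app of_alg_app slice_tensor w)
  qed
  then have "inv (tlift T2) (c \<otimes> ?L b) = u" by (metis canonical_inv(6))
  then have "c * antipode (?L b) = tlift (\<lambda>x y. \<psi> (x * a) *\<^sub>C y) (T4 c b)"
    by (simp add: antipode_right u_def clinear_tlift_push[OF clinear_slice_right[OF clinear_counit]] slice_tensor
      counit_slice_T2 p)
  also have "\<dots> = slice_left \<psi> (rapp (T4 c b) (of_alg a \<otimes>\<^sub>m 1))"
    unfolding slice_leg(2)[OF p] by (simp add: slice_left_def)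
  also have "\<dots> = c * slice_left \<psi> (T3 b a)"
    by (simp add: canonical_exchange(6)[symmetric] slice_leg p)
  finally show "c * antipode (?L b) = c * slice_left \<psi> (T3 b a)" .
qed

lemma antipode_inv:
  fixes x :: "'a::algebraic_quantum_group"
  shows "antipode (inv antipode x) = x" "inv antipode (antipode x) = x"
  using bij_antipode[where ?'a='a] by (simp_all add: bij_is_surj surj_f_inv_f bij_is_inj)

section \<open>Faithfulness and the modular property of the integral\<close>

text \<open>
  A tensor whose right slices by a family of functionals vanish lies in \<open>A \<otimes> N\<close>, where \<open>N\<close> is the common
  kernel of the family; the expansion may be chosen for all functionals at once.
\<close>

lemma slice_right_zero_expansion:
  fixes t :: "('a::complex_vector, 'b::complex_vector) tensor"
  obtains E y where "finite E" "t = (\<Sum>b\<in>E. b \<otimes> y b)"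
    "\<And>f b. clinear f \<Longrightarrow> slice_right f t = 0 \<Longrightarrow> b \<in> E \<Longrightarrow> f (y b) = 0"
proof -
  obtain E y where E: "finite E" "complex_vector.independent E" "tensor_flip t = (\<Sum>b\<in>E. y b \<otimes> b)"
    by (rule tensor_basis_expansion)
  have "t = tensor_flip (tensor_flip t)" by (simp add: tensor_flip_flip)
  also have "\<dots> = (\<Sum>b\<in>E. b \<otimes> y b)"
    unfolding E by (simp add: clinear_sum[OF clinear_tensor_flip] tensor_flip_tensor)
  finally have t: "t = (\<Sum>b\<in>E. b \<otimes> y b)" .
  have "f (y b) = 0" if f: "clinear f" "slice_right f t = 0" "b \<in> E" for f b
  proof -
    have "(\<Sum>b\<in>E. f (y b) *\<^sub>C b) = slice_right f t"
      by (simp add: t clinear_sum[OF clinear_slice_right[OF f(1)]] slice_tensor f)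
    then show ?thesis
      using complex_vector.independentD[OF E(2,1) subset_refl _ f(3)] f(2) by auto
  qed
  with E(1) t show ?thesis by (rule that)
qed

text \<open>
  Let \<open>N\<close> be the right ideal of all \<open>a\<close> with \<open>\<phi>(a x) = 0\<close> for all \<open>x\<close>.  Left invariance gives
  \<open>(p \<otimes> 1)\<Delta>(a) \<in> A \<otimes> N\<close> for \<open>a \<in> N\<close>.  Since \<open>p a\<^sub>1 S(a\<^sub>2) = \<epsilon>(a) p\<close>, applying \<open>S\<^sup>-\<^sup>1\<close> shows that
  \<open>\<epsilon>(a) A \<subseteq> N\<close>, hence \<open>\<epsilon>(a) = 0\<close>, because \<open>N\<close> is proper.  So \<open>\<epsilon>\<close> vanishes on \<open>N\<close>, and
  \<open>p a = p a\<^sub>1 \<epsilon>(a\<^sub>2) = 0\<close>.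
\<close>

lemma left_int_faithful_left:
  fixes a :: "'a::algebraic_quantum_group"
  assumes a: "\<And>x. left_int (a * x) = 0"
  shows "a = 0"
proof -
  have expand: "\<exists>E y. finite E \<and> T2 p a = (\<Sum>b\<in>E. b \<otimes> y b) \<and> (\<forall>b\<in>E. \<forall>x. left_int (y b * x) = 0)"
    if a: "\<And>x. left_int (a * x) = 0" for p a :: 'a
  proof -
    have "slice_right (\<lambda>y. left_int (y * x)) (T2 p a) = 0" for x
    proof -
      have "slice_right left_int (lapp (comult a) t) = 0" for t
      proof -
        have "slice_right left_int (lapp (comult a) t) = 0 *\<^sub>C slice_right left_int t"
          by (rule canonical_eqI(3)[where t=t])
            ((intro clin)+, simp add: canonical_times left_int_invariant a)
        then show ?thesis by simp
      qed
      from this[of "y \<otimes> x" for y] have "slice_right left_int (T1 a x) * y = 0" for y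
        by (simp add: canonical_app(1) slice_leg)
      then have "slice_right left_int (T1 a x) = 0" by (rule nondegenerate_left)
      then show ?thesis
        by (simp add: slice_leg(8)[OF clinear_left_int, symmetric] canonical_exchange(1)[symmetric] slice_leg(5))
    qed
    moreover obtain E y where "finite E" "T2 p a = (\<Sum>b\<in>E. b \<otimes> y b)"
      "\<And>f b. clinear f \<Longrightarrow> slice_right f (T2 p a) = 0 \<Longrightarrow> b \<in> E \<Longrightarrow> f (y b) = 0"
      using slice_right_zero_expansion[of "T2 p a"] by blast
    moreover have "clinear (\<lambda>y. left_int (y * x))" for x :: 'a by (intro clin)
    ultimately show ?thesis by blast
  qed
  have counit0: "counit a = 0" if a: "\<And>x. left_int (a * x) = 0" for a :: 'a
  proof (rule ccontr)
    assume nz: "counit a \<noteq> 0"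
    have "left_int (p * z) = 0" for p z :: 'a
    proof -
      \<comment> \<open>the left factor is \<open>S(p)\<close>, so that \<open>S\<^sup>-\<^sup>1\<close> returns \<open>p\<close>\<close>
      obtain E y where E: "finite E" "T2 (antipode p) a = (\<Sum>b\<in>E. b \<otimes> y b)"
        "\<And>b x. b \<in> E \<Longrightarrow> left_int (y b * x) = 0"
        using expand[OF a, of "antipode p"] by blast
      let ?g = "tlift (\<lambda>x y. x * antipode y)"
      have g: "cbilinear (\<lambda>x y. x * antipode y)" by (intro clin)
      define s where "s b = inv antipode b" for b :: 'a
      have s: "antipode (s b) = b" for b
        unfolding s_def by (rule antipode_inv)
      have "antipode (counit a *\<^sub>C p) = slice_right counit (inv (tlift T2) (T2 (antipode p) a))"
        by (simp add: canonical_inv(6)[of "antipode p \<otimes> a", unfolded canonical_tensor] slice_tensor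
          clinearD(2)[OF clinear_antipode])
      also have "\<dots> = ?g (T2 (antipode p) a)"
        unfolding antipode_right by (rule tlift_linear[symmetric]) (intro clin)
      also have "\<dots> = (\<Sum>b\<in>E. b * antipode (y b))"
        unfolding E(2) by (simp add: clinear_sum[OF clinear_tlift[OF g]] tlift_tensor[OF g])
      also have "\<dots> = antipode (\<Sum>b\<in>E. y b * s b)"
        by (simp add: clinear_sum[OF clinear_antipode] antipode_times s)
      finally have "counit a *\<^sub>C p = (\<Sum>b\<in>E. y b * s b)"
        by (metis antipode_inv(2))
      then have "counit a * left_int (p * z) = left_int ((\<Sum>b\<in>E. y b * s b) * z)"
        by (metis clinearD(2) clinear_left_int mult_scaleC_left scaleC_complex_def)
      also have "\<dots> = 0"
        by (simp add: sum_distrib_right clinear_sum[OF clinear_left_int] E mult.assoc)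
      finally show ?thesis using nz by simp
    qed
    then have "left_int (mu v) = 0" for v :: "('a, 'a) tensor"
      by (induction v) (simp_all add: tlift_tensor tlift_add cbilinear_mu clinearD(1)[OF clinear_left_int])
    then have "left_int x = 0" for x :: 'a by (metis mult_surj)
    then show False using left_integral_left_int[where ?'a='a] by (auto simp: left_integral_def)
  qed
  show ?thesis
  proof (rule nondegenerate_right)
    fix p
    obtain E y where E: "finite E" "T2 p a = (\<Sum>b\<in>E. b \<otimes> y b)"
      "\<And>b x. b \<in> E \<Longrightarrow> left_int (y b * x) = 0"
      using expand[OF a, of p] by blast
    have "p * a = slice_right counit (T2 p a)" by (simp add: counit_T2)
    also have "\<dots> = 0"
      unfolding E(2) by (simp add: clinear_sum[OF clinear_slice_right[OF clinear_counit]] slice_tensor counit0 E(3))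
    finally show "p * a = 0" .
  qed
qed

text \<open>
  Evaluating \<open>\<psi>(b a\<^sub>1) \<phi>(a\<^sub>2 c)\<close> with either of the two formulas for the antipode turns it into
  \<open>\<psi>(d a)\<close> and into \<open>\<phi>(a d')\<close>.
\<close>

lemma right_integral_left_int_mixed:
  fixes b c a :: "'a::algebraic_quantum_group"
  assumes "right_integral comult \<psi>"
  shows "\<psi> (slice_right (\<lambda>x. left_int (inv antipode x)) (T4 (antipode c) b) * a)
    = left_int (a * slice_left (\<lambda>x. \<psi> (inv antipode x)) (T3 c (antipode b)))"
proof -
  have p: "clinear \<psi>" using assms by (simp add: right_integral_def)
  let ?S = "inv (antipode :: 'a \<Rightarrow> 'a)"
  have S: "antipode (?S x) = x" "?S (antipode x) = x" for x
    by (rule antipode_inv)+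
  have cS: "clinear ?S" by (rule clinear_inv[OF clinear_antipode bij_antipode])
  have S_times: "?S (x * y) = ?S y * ?S x" for x y
    by (metis S antipode_times)
  have c1: "clinear (\<lambda>x. left_int (?S x))" and c2: "clinear (\<lambda>x. \<psi> (?S x))"
    by (intro clin cS clinear_compose[OF p])+
  have "slice_left \<psi> (T2 b a) * c = ?S (antipode c * slice_left \<psi> (T3 b a))"
    by (simp add: antipode_right_integral[OF assms, symmetric] S_times S)
  also have "\<dots> = ?S (slice_left \<psi> (rapp (T4 (antipode c) b) (of_alg a \<otimes>\<^sub>m 1)))"
    by (simp add: slice_leg(3)[OF p, symmetric] canonical_exchange(6))
  finally have 1: "left_int (slice_left \<psi> (T2 b a) * c)
      = \<psi> (slice_right (\<lambda>x. left_int (?S x)) (T4 (antipode c) b) * a)"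
    by (simp add: slice_exchange[OF p c1, symmetric] slice_leg(6)[OF c1])
  have "antipode (slice_right left_int (T1 a c)) = slice_right left_int (T4 a c)"
    using antipode_left_int_slice[of "a \<otimes> c"] by (simp add: canonical_tensor)
  then have "slice_right left_int (T1 a c) = ?S (slice_right left_int (T4 a c))"
    by (metis S(2))
  then have "b * slice_right left_int (T1 a c) = ?S (slice_right left_int (T4 a c) * antipode b)"
    by (simp add: S_times S)
  also have "slice_right left_int (T4 a c) * antipode b = slice_right left_int (lapp (1 \<otimes>\<^sub>m of_alg a) (T3 c (antipode b)))"
    by (simp add: slice_leg(6)[OF clinear_left_int, symmetric] canonical_exchange(6))
  finally have 2: "\<psi> (b * slice_right left_int (T1 a c))
      = left_int (a * slice_left (\<lambda>x. \<psi> (?S x)) (T3 c (antipode b)))"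
    by (simp add: slice_exchange[OF c2 clinear_left_int] slice_leg(3)[OF c2])
  have "\<psi> (b * slice_right left_int (T1 a c)) = \<psi> (slice_right left_int (rapp (T2 b a) (1 \<otimes>\<^sub>m of_alg c)))"
    by (simp add: slice_leg(5)[OF clinear_left_int, symmetric] canonical_exchange(1))
  also have "\<dots> = left_int (slice_left \<psi> (T2 b a) * c)"
    by (simp add: slice_exchange[OF p clinear_left_int] slice_leg(4)[OF p])
  finally show ?thesis using 1 2 by simp
qed

lemma functional_slice_surj:
  fixes \<omega> :: "'a::complex_vector \<Rightarrow> complex"
  assumes "clinear \<omega>" "\<omega> y \<noteq> 0"
  shows "\<exists>t. slice_right \<omega> t = (x :: 'b::complex_vector)" "\<exists>t. slice_left \<omega> t = x"
proof -
  have "slice_right \<omega> (x \<otimes> ((1 / \<omega> y) *\<^sub>C y)) = x" "slice_left \<omega> (((1 / \<omega> y) *\<^sub>C y) \<otimes> x) = x"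
    using assms(2) by (simp_all add: slice_tensor assms(1) clinearD(2)[OF assms(1)] scaleC_complex_def scaleC_one)
  then show "\<exists>t. slice_right \<omega> t = x" "\<exists>t. slice_left \<omega> t = x" by blast+
qed

lemma left_int_right_integral:
  fixes d :: "'a::algebraic_quantum_group"
  assumes "right_integral comult \<psi>"
  shows "\<exists>d'. \<forall>a. \<psi> (d * a) = left_int (a * d')"
    and "\<exists>d'. \<forall>a. left_int (a * d) = \<psi> (d' * a)"
proof -
  have p: "clinear \<psi>" "\<exists>y. \<psi> y \<noteq> 0" using assms by (auto simp: right_integral_def)
  let ?S = "inv (antipode :: 'a \<Rightarrow> 'a)"
  have S: "antipode (?S x) = x" "?S (antipode x) = x" for x
    by (rule antipode_inv)+
  have cS: "clinear ?S" by (rule clinear_inv[OF clinear_antipode bij_antipode])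
  have c1: "clinear (\<lambda>x. left_int (?S x))" and c2: "clinear (\<lambda>x. \<psi> (?S x))"
    by (intro clin cS clinear_compose[OF p(1)])+
  have n1: "\<exists>y. left_int (?S y) \<noteq> 0" and n2: "\<exists>y. \<psi> (?S y) \<noteq> 0"
    using left_integral_left_int[where ?'a='a] p(2) S(2) unfolding left_integral_def by metis+
  let ?SI = "tensor_map antipode (\<lambda>x::'a. x)" and ?IS = "tensor_map (\<lambda>x::'a. x) antipode"
  have mixed: "\<psi> (slice_right (\<lambda>x. left_int (?S x)) (tlift T4 (?SI s)) * a)
    = left_int (a * slice_left (\<lambda>x. \<psi> (?S x)) (tlift T3 (?IS s)))" for s a
  proof (rule clinear_eq_tensor[where t=s])
    show "clinear (\<lambda>s. \<psi> (slice_right (\<lambda>x. left_int (?S x)) (tlift T4 (?SI s)) * a))"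
      "clinear (\<lambda>s. left_int (a * slice_left (\<lambda>x. \<psi> (?S x)) (tlift T3 (?IS s))))"
      by (intro clinear_compose[OF p(1)] clin c1 c2)+
  qed (simp add: tensor_map_tensor clin canonical_tensor right_integral_left_int_mixed[OF assms])
  have cSI: "?SI (tensor_map ?S (\<lambda>x. x) t) = t" "?IS (tensor_map (\<lambda>x. x) ?S t) = t" for t
    by (rule clinear_eq_tensor[where t=t]; (intro clin cS)?; simp add: tensor_map_tensor clin cS S)+
  show "\<exists>d'. \<forall>a. \<psi> (d * a) = left_int (a * d')"
  proof -
    obtain t :: "('a, 'a) tensor" where t: "slice_right (\<lambda>x. left_int (?S x)) t = d"
      using functional_slice_surj(1)[OF c1] n1 by blast
    show ?thesis
      using mixed[of "tensor_map ?S (\<lambda>x. x) (inv (tlift T4) t)"] unfolding cSI canonical_inv t by blast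
  qed
  show "\<exists>d'. \<forall>a. left_int (a * d) = \<psi> (d' * a)"
  proof -
    obtain t :: "('a, 'a) tensor" where t: "slice_left (\<lambda>x. \<psi> (?S x)) t = d"
      using functional_slice_surj(2)[OF c2] n2 by blast
    show ?thesis
      using mixed[of "tensor_map (\<lambda>x. x) ?S (inv (tlift T3) t)"] unfolding cSI canonical_inv t by metis
  qed
qed

text \<open>
  Applying \<open>\<psi> \<otimes> \<phi>\<close> to \<open>t \<Delta>(x)\<close>, where \<open>t\<close> is written once through \<open>T4\<close> and once through \<open>T2\<close>,
  compares the functionals \<open>\<psi>(d \<cdot> )\<close> and \<open>\<phi>(d' \<cdot> )\<close>.
\<close>

lemma right_integral_left_int_same_side:
  fixes d :: "'a::algebraic_quantum_group"
  assumes "right_integral comult \<psi>"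
  shows "\<exists>d'. \<forall>a. \<psi> (d * a) = left_int (d' * a)"
    and "\<exists>d'. \<forall>a. left_int (d * a) = \<psi> (d' * a)"
proof -
  have p: "clinear \<psi>" "\<exists>y. \<psi> y \<noteq> 0" using assms by (auto simp: right_integral_def)
  have n: "\<exists>y::'a. left_int y \<noteq> 0" using left_integral_left_int[where ?'a='a] by (auto simp: left_integral_def)
  have 4: "left_int (slice_left \<psi> (rapp (tlift T4 v) (comult x))) = \<psi> (slice_left left_int v * x)" for v and x :: 'a
  proof (rule clinear_eq_tensor[where t=v])
    show "clinear (\<lambda>v. left_int (slice_left \<psi> (rapp (tlift T4 v) (comult x))))"
      "clinear (\<lambda>v. \<psi> (slice_left left_int v * x))"
      by (intro clinear_compose[OF p(1)] clin clinear_left_int p)+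
    show "left_int (slice_left \<psi> (rapp (tlift T4 (q \<otimes> r)) (comult x))) = \<psi> (slice_left left_int (q \<otimes> r) * x)" for q r
      by (simp add: canonical_tensor canonical_times right_integral_invariant[OF assms] slice_tensor
        clinearD(2)[OF clinear_left_int] clinearD(2)[OF p(1)] mult_scaleC_left scaleC_complex_def mult.commute)
  qed
  have 2: "left_int (slice_left \<psi> (rapp (tlift T2 v) (comult x))) = left_int (slice_left \<psi> v * x)" for v and x :: 'a
  proof (rule clinear_eq_tensor[where t=v])
    show "clinear (\<lambda>v. left_int (slice_left \<psi> (rapp (tlift T2 v) (comult x))))"
      "clinear (\<lambda>v. left_int (slice_left \<psi> v * x))"
      by (intro clinear_compose[OF p(1)] clin clinear_left_int p)+
    show "left_int (slice_left \<psi> (rapp (tlift T2 (q \<otimes> r)) (comult x))) = left_int (slice_left \<psi> (q \<otimes> r) * x)" for q r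
      by (simp add: canonical_tensor canonical_times left_int_invariant slice_exchange[OF p(1) clinear_left_int, symmetric] slice_tensor p
        clinearD(2)[OF clinear_left_int] clinearD(2)[OF p(1)] mult_scaleC_left scaleC_complex_def mult.commute)
  qed
  have eq: "\<psi> (slice_left left_int (inv (tlift T4) t) * x) = left_int (slice_left \<psi> (inv (tlift T2) t) * x)" for t and x :: 'a
    using 4[of "inv (tlift T4) t" x] 2[of "inv (tlift T2) t" x] by (simp add: canonical_inv)
  show "\<exists>d'. \<forall>a. \<psi> (d * a) = left_int (d' * a)"
  proof -
    obtain t :: "('a, 'a) tensor" where t: "slice_left left_int t = d"
      using functional_slice_surj(2)[OF clinear_left_int] n by blast
    show ?thesis using eq[of "tlift T4 t"] unfolding canonical_inv t by blast
  qed
  show "\<exists>d'. \<forall>a. left_int (d * a) = \<psi> (d' * a)"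
  proof -
    obtain t :: "('a, 'a) tensor" where t: "slice_left \<psi> t = d"
      using functional_slice_surj(2)[OF p(1)] p(2) by blast
    show ?thesis using eq[of "tlift T2 t"] unfolding canonical_inv t by metis
  qed
qed

text \<open>
  The detour through a right integral moves \<open>c\<close> from one side of the argument of \<open>\<phi>\<close> to the other.
\<close>

lemma left_int_modular:
  fixes c :: "'a::algebraic_quantum_group"
  shows "\<exists>d. \<forall>a. left_int (a * c) = left_int (d * a)"
    and "\<exists>d. \<forall>a. left_int (c * a) = left_int (a * d)"
proof -
  obtain \<psi> :: "'a \<Rightarrow> complex" where p: "right_integral comult \<psi>"
    using right_integral_exists by blast
  show "\<exists>d. \<forall>a. left_int (a * c) = left_int (d * a)" "\<exists>d. \<forall>a. left_int (c * a) = left_int (a * d)"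
    using left_int_right_integral[OF p] right_integral_left_int_same_side[OF p] by metis+
qed

lemma left_int_faithful_right:
  fixes a :: "'a::algebraic_quantum_group"
  assumes "\<And>x. left_int (x * a) = 0"
  shows "a = 0"
  by (rule left_int_faithful_left) (metis assms left_int_modular(1))

section \<open>The dual algebra\<close>

lemma dual_eqI: "(\<And>a. pairing a b = pairing a d) \<Longrightarrow> b = d"
  by transfer (simp add: fun_eq_iff)

lemma clinear_pairing [clin]:
  fixes f :: "'b::complex_vector \<Rightarrow> 'a::algebraic_quantum_group" and g :: "'b \<Rightarrow> 'a dual"
  shows "clinear f \<Longrightarrow> clinear (\<lambda>x. pairing (f x) b)" "clinear g \<Longrightarrow> clinear (\<lambda>x. pairing a (g x))"
proof -
  have l: "clinear (\<lambda>a. pairing a b)"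
    by (rule clinearI; transfer)
      (auto simp: distrib_right mult_scaleC_left clinearD[OF clinear_left_int] scaleC_complex_def)
  have r: "clinear (pairing a)"
    by (rule clinearI; transfer) (auto simp: scaleC_complex_def)
  show "clinear f \<Longrightarrow> clinear (\<lambda>x. pairing (f x) b)" "clinear g \<Longrightarrow> clinear (\<lambda>x. pairing a (g x))"
    by (rule clinear_compose[OF l], assumption) (rule clinear_compose[OF r], assumption)
qed

lift_definition dualR :: "'a::algebraic_quantum_group \<Rightarrow> 'a dual" is "\<lambda>c a. left_int (a * c)"
  by blast

lift_definition dualL :: "'a::algebraic_quantum_group \<Rightarrow> 'a dual" is "\<lambda>c a. left_int (c * a)"
  using left_int_modular(2) by (fastforce simp: fun_eq_iff)

lemma pairing_dualR: "pairing a (dualR c) = left_int (a * c)"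
  by transfer simp

lemma pairing_dualL: "pairing a (dualL c) = left_int (c * a)"
  by transfer simp

lemma dualR_cases: obtains c where "b = dualR c"
  by transfer blast

lemma dualL_cases: obtains c where "b = dualL c"
proof -
  obtain c where "b = dualR c" by (rule dualR_cases)
  moreover obtain d where "\<forall>a. left_int (a * c) = left_int (d * a)" using left_int_modular(1) by blast
  ultimately have "b = dualL d" by (intro dual_eqI) (simp add: pairing_dualR pairing_dualL)
  then show ?thesis by (rule that)
qed

lemma clinear_dualR [clin]: "clinear f \<Longrightarrow> clinear (\<lambda>x. dualR (f x))"
  by (rule clinear_compose[of dualR]; (rule clinearI; rule dual_eqI)?)
    (simp_all add: pairing_dualR clinearD[OF clinear_pairing(2)[OF clinear_basic(1)]] distrib_left mult_scaleC_right
      clinearD[OF clinear_left_int])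

lemma clinear_dualL [clin]: "clinear f \<Longrightarrow> clinear (\<lambda>x. dualL (f x))"
  by (rule clinear_compose[of dualL]; (rule clinearI; rule dual_eqI)?)
    (simp_all add: pairing_dualL clinearD[OF clinear_pairing(2)[OF clinear_basic(1)]] distrib_right mult_scaleC_left
      clinearD[OF clinear_left_int])

lemma pairing_nondegenerate:
  fixes a :: "'a::algebraic_quantum_group"
  assumes "\<And>b. pairing a b = 0"
  shows "a = 0"
  by (rule left_int_faithful_left) (metis assms pairing_dualR)

lemma pairing_eqI:
  fixes a a' :: "'a::algebraic_quantum_group"
  assumes "\<And>b. pairing a b = pairing a' b"
  shows "a = a'"
  using pairing_nondegenerate[of "a - a'"] assms
  by (simp add: clinear_diff[OF clinear_pairing(1)[OF clinear_basic(1)]])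

lemma dualR_inj: "dualR c = dualR d \<Longrightarrow> c = d"
proof -
  assume "dualR c = dualR d"
  then have "left_int (x * (c - d)) = 0" for x
    by (simp add: right_diff_distrib clinear_diff[OF clinear_left_int] pairing_dualR[symmetric])
  then show "c = d" using left_int_faithful_right[of "c - d"] by simp
qed

lemma pairing_dual_rep: "pairing a b = left_int (a * dual_rep b)"
proof -
  obtain c where "b = dualR c" by (rule dualR_cases)
  then have "\<forall>a. pairing a b = left_int (a * c)" by (simp add: pairing_dualR)
  then have "\<forall>a. pairing a b = left_int (a * dual_rep b)"
    unfolding dual_rep_def by (rule someI)
  then show ?thesis by blast
qed

lemma dualR_dual_rep: "dualR (dual_rep b) = b"
  by (rule dual_eqI) (simp add: pairing_dualR pairing_dual_rep[symmetric])

lemma dual_rep_dualR: "dual_rep (dualR c) = c"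
  by (rule dualR_inj) (simp add: dualR_dual_rep)

lemma clinear_dual_rep [clin]: "clinear f \<Longrightarrow> clinear (\<lambda>x. dual_rep (f x))"
  by (rule clinear_compose[of dual_rep]; (rule clinearI; rule dualR_inj)?)
    (simp_all add: clinearD[OF clinear_dualR[OF clinear_basic(1)]] dualR_dual_rep)

text \<open>
  \<open>lact b a = a\<^sub>1 \<langle>a\<^sub>2, b\<rangle>\<close> and \<open>ract b a = \<langle>a\<^sub>1, b\<rangle> a\<^sub>2\<close>.  Both lie in the algebra, because the functional
  \<open>b\<close> has the forms \<open>\<phi>( \<cdot> c)\<close> and \<open>\<phi>(d \<cdot> )\<close>.
\<close>

definition lact :: "'a::algebraic_quantum_group dual \<Rightarrow> 'a \<Rightarrow> 'a"
  where "lact b a = slice_right left_int (T1 a (dual_rep b))"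

definition ract :: "'a::algebraic_quantum_group dual \<Rightarrow> 'a \<Rightarrow> 'a"
  where "ract b a = slice_left left_int (T2 (SOME d. b = dualL d) a)"

lemma clinear_lact [clin]:
  fixes f :: "'b::complex_vector \<Rightarrow> 'a::algebraic_quantum_group" and g :: "'b \<Rightarrow> 'a dual"
  shows "clinear f \<Longrightarrow> clinear (\<lambda>x. lact b (f x))" "clinear g \<Longrightarrow> clinear (\<lambda>x. lact (g x) a)"
  unfolding lact_def by (intro clin; assumption)+

lemma lact_T2_T3:
  shows "slice_right (\<lambda>x. pairing x b) (T3 a y) = lact b a * y"
    and "slice_right (\<lambda>x. pairing x b) (T2 y a) = y * lact b a"
  unfolding pairing_dual_rep slice_leg(8)[OF clinear_left_int, symmetric] lact_def
  by (simp_all add: canonical_exchange(2)[symmetric] canonical_exchange(1)[symmetric] slice_leg)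

lemma lact_dualR: "lact (dualR c) a = slice_right left_int (T1 a c)"
  by (simp add: lact_def dual_rep_dualR)

lemma lact_dualL: "lact (dualL c) a = slice_right left_int (T4 c a)"
proof (rule nondegenerate_left_eqI)
  show "lact (dualL c) a * z = slice_right left_int (T4 c a) * z" for z
    unfolding lact_T2_T3[symmetric] pairing_dualL slice_leg(7)[OF clinear_left_int, symmetric]
    by (simp add: canonical_exchange(6) slice_leg)
qed

lemma ract_T1_T4:
  fixes a y :: "'a::algebraic_quantum_group"
  shows "slice_left (\<lambda>x. pairing x b) (T1 a y) = ract b a * y"
    and "slice_left (\<lambda>x. pairing x b) (T4 y a) = y * ract b a"
proof -
  define d where "d = (SOME d. b = dualL d)"
  have "\<exists>d. b = dualL d" by (metis dualL_cases)
  then have b: "b = dualL d" unfolding d_def by (rule someI_ex)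
  show "slice_left (\<lambda>x. pairing x b) (T1 a y) = ract b a * y"
    "slice_left (\<lambda>x. pairing x b) (T4 y a) = y * ract b a"
    unfolding ract_def d_def[symmetric] unfolding b pairing_dualL slice_leg(1)[OF clinear_left_int, symmetric]
    by (simp_all add: canonical_exchange(1) canonical_exchange(5)[symmetric] slice_leg)
qed

lemma ract_dualL: "ract (dualL c) a = slice_left left_int (T2 c a)"
proof (rule nondegenerate_left_eqI)
  show "ract (dualL c) a * z = slice_left left_int (T2 c a) * z" for z
    unfolding ract_T1_T4[symmetric] pairing_dualL slice_leg(1)[OF clinear_left_int, symmetric]
    by (simp add: canonical_exchange(1) slice_leg)
qed

lemma clinear_ract [clin]: "clinear f \<Longrightarrow> clinear (\<lambda>x. ract b (f x))"
  unfolding ract_def by (intro clin; assumption)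

lemma lact_ract: "lact b (ract d a) = ract d (lact b a)"
  by (simp add: lact_def ract_def slices_commute)

lemma pairing_lact_ract: "pairing (lact b a) d = pairing (ract d a) b"
proof -
  obtain e where d: "d = dualL e" by (rule dualL_cases)
  have "left_int (e * slice_right left_int (T1 a (dual_rep b))) = left_int (slice_left left_int (T2 e a) * dual_rep b)"
    unfolding slice_leg(5)[OF clinear_left_int, symmetric] canonical_exchange(1)
      slice_exchange[OF clinear_left_int clinear_left_int] slice_leg(4)[OF clinear_left_int] ..
  then show ?thesis
    unfolding d ract_dualL lact_def pairing_dualL pairing_dual_rep[of _ b] .
qed

lemma mult_pairing_comult: "mult_pairing (comult a) b d = pairing (lact d a) b"
proof -
  have "tlift (\<lambda>x y. left_int x * left_int y) t = left_int (slice_right left_int t)" for t :: "('a, 'a) tensor"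
    unfolding slice_right_def
    by (simp add: clinear_tlift_push[OF clinear_left_int] clinearD(2)[OF clinear_left_int] scaleC_complex_def mult.commute)
  then show ?thesis
    by (simp add: mult_pairing_def canonical_app(1) slice_leg(6)[OF clinear_left_int] lact_def pairing_dual_rep[of _ b])
qed

text \<open>
  For \<open>t = \<Sum> \<Delta>(p)(q \<otimes> 1)\<close> left invariance gives \<open>(\<phi> \<otimes> \<phi>)(\<Delta>(a) t) = \<Sum> \<phi>(a p) \<phi>(q)\<close>.  So the product of two
  functionals \<open>\<phi>( \<cdot> c)\<close> and \<open>\<phi>( \<cdot> d)\<close> is again such a functional.
\<close>

lemma left_int_slice_T3:
  fixes a :: "'a::algebraic_quantum_group"
  shows "left_int (slice_right left_int (lapp (comult a) t)) = left_int (a * slice_right left_int (inv (tlift T3) t))"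
proof -
  have "left_int (slice_right left_int (lapp (comult a) (tlift T3 v))) = left_int (a * slice_right left_int v)" for v
  proof (rule clinear_eq_tensor[where t=v])
    show "left_int (slice_right left_int (lapp (comult a) (tlift T3 (p \<otimes> q)))) = left_int (a * slice_right left_int (p \<otimes> q))" for p q
      by (simp add: canonical_tensor canonical_times left_int_invariant slice_tensor
        clinearD(2)[OF clinear_left_int] mult_scaleC_right scaleC_complex_def)
  qed (intro clin)+
  from this[of "inv (tlift T3) t"] show ?thesis by (simp add: canonical_inv)
qed

lemma dualR_times_pairing:
  "mult_pairing (comult a) (dualR c) (dualR d) = pairing a (dualR (slice_right left_int (inv (tlift T3) (c \<otimes> d))))"
  unfolding mult_pairing_comult pairing_dualR left_int_slice_T3[symmetric]
  by (simp add: canonical_app(1) slice_leg(6)[OF clinear_left_int] lact_dualR)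

lemma dualR_times: "dualR c * dualR d = dualR (slice_right left_int (inv (tlift T3) (c \<otimes> d)))"
  unfolding times_dual_def dualR_times_pairing by (rule the_equality) (auto intro: dual_eqI)

lemma pairing_times: "pairing a (b * d) = pairing (lact d a) b"
proof -
  obtain c c' where "b = dualR c" "d = dualR c'" by (metis dualR_cases)
  then show ?thesis
    by (simp only: dualR_times dualR_times_pairing[symmetric] mult_pairing_comult)
qed

lemma pairing_times': "pairing a (b * d) = pairing (ract b a) d"
  by (simp add: pairing_times pairing_lact_ract)

lemma lact_surj:
  fixes x :: "'a::algebraic_quantum_group"
  obtains t :: "('a dual, 'a) tensor" where "tlift lact t = x"
proof -
  obtain s :: "('a, 'a) tensor" where s: "slice_right left_int s = x" using slice_right_left_int_surj by blast
  have "slice_right left_int (tlift T1 v) = tlift lact (tensor_map dualR (\<lambda>x. x) (tensor_flip v))" for v :: "('a, 'a) tensor"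
    by (rule clinear_eq_tensor[where t=v])
      ((intro clin)+, simp add: canonical_tensor tensor_flip_tensor tensor_map_tensor clin tlift_tensor lact_dualR)
  from this[of "inv (tlift T1) s"] show ?thesis
    using that by (metis canonical_inv(1) s)
qed

lemma clinear_span_lact_eqI:
  fixes f g :: "'a::algebraic_quantum_group \<Rightarrow> 'b::complex_vector"
  assumes "clinear f" "clinear g" "\<And>b a. f (lact b a) = g (lact b a)"
  shows "f x = g x"
proof -
  obtain t :: "('a dual, 'a) tensor" where t: "tlift lact t = x" by (rule lact_surj)
  have "f (tlift lact t) = g (tlift lact t)"
    by (rule clinear_eq_tensor[where t=t])
      ((rule clinear_compose[OF assms(1)] clinear_compose[OF assms(2)], intro clin)+, simp add: tlift_tensor clin assms)
  then show ?thesis by (simp add: t)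
qed

lemma ract_span_eqI:
  fixes f g :: "'a::algebraic_quantum_group \<Rightarrow> 'b::complex_vector"
  assumes "clinear f" "clinear g" "\<And>b a. f (ract b a) = g (ract b a)"
  shows "f x = g x"
proof -
  obtain y :: 'a where "left_int y \<noteq> 0"
    using left_integral_left_int by (auto simp: left_integral_def)
  then obtain s :: "('a, 'a) tensor" where s: "slice_left left_int s = x"
    using functional_slice_surj(2)[OF clinear_left_int] by blast
  have "f (slice_left left_int s) = g (slice_left left_int s)"
    by (rule canonical_eqI(2)[where t=s])
      ((rule clinear_compose[OF assms(1)] clinear_compose[OF assms(2)], intro clin)+,
        simp add: ract_dualL[symmetric] assms)
  then show ?thesis by (simp add: s)
qed

lemma lact_eqI: "(\<And>b. pairing x b = pairing a (b * d)) \<Longrightarrow> lact d a = x"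
  by (rule pairing_eqI) (simp add: pairing_times)

lemma counit_lact: "counit (lact b a) = pairing a b"
  by (simp add: lact_def counit_slice_T1 pairing_dual_rep)

text \<open>
  Associativity of the product of \<open>B\<close> is the fact that left and right translations commute.
\<close>

lemma dual_times_assoc: "(b * d) * e = b * (d * e)" for b d e :: "'a::algebraic_quantum_group dual"
  by (rule dual_eqI) (simp only: pairing_times[of _ "b * d" e] pairing_times'[of _ b] pairing_times[of _ d e] lact_ract)

instance dual :: (algebraic_quantum_group) nondegenerate_algebra
proof
  fix b d e :: "'a dual" and c
  note p = clinearD[OF clinear_pairing(2)[OF clinear_basic(1)]]
  show "b * d * e = b * (d * e)" by (rule dual_times_assoc)
  show "(b + d) * e = b * e + d * e"
    by (rule dual_eqI) (simp add: pairing_times p)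
  show "b * (d + e) = b * d + b * e"
    by (rule dual_eqI) (simp add: pairing_times' p)
  show "(c *\<^sub>C b) * d = c *\<^sub>C (b * d)"
    by (rule dual_eqI) (simp add: pairing_times p)
  show "b * (c *\<^sub>C d) = c *\<^sub>C (b * d)"
    by (rule dual_eqI) (simp add: pairing_times' p)
  show "b = 0" if "\<And>y. b * y = 0"
  proof (rule dual_eqI)
    fix a
    show "pairing a b = pairing a 0"
      unfolding p
      by (rule clinear_span_lact_eqI[where x=a]) (intro clin | simp add: pairing_times[symmetric] that p)+
  qed
  show "b = 0" if "\<And>y. y * b = 0"
  proof (rule dual_eqI)
    fix a
    show "pairing a b = pairing a 0"
      unfolding p
      by (rule ract_span_eqI[where x=a]) (intro clin | simp add: pairing_times'[symmetric] that p)+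
  qed
qed

lemma lact_times: "lact (b * d) a = lact b (lact d a)"
  by (rule lact_eqI) (simp add: pairing_times[symmetric] mult.assoc)

lemma lact_faithful: "(\<And>b. lact b a = 0) \<Longrightarrow> a = 0"
  by (rule pairing_nondegenerate) (metis counit_lact clinearD(3)[OF clinear_counit])

lemma lact_faithful_dual: "(\<And>a. lact b a = 0) \<Longrightarrow> b = 0"
  by (rule dual_eqI) (metis counit_lact clinearD(3)[OF clinear_counit] clinearD(3)[OF clinear_pairing(2)[OF clinear_basic(1)]])

text \<open>
  In \<open>dualR_times\<close> the tensor \<open>c \<otimes> d\<close> ranges over everything, hence so does the slice of its preimage under \<open>T3\<close>.
\<close>

lemma dual_mult_surj:
  fixes b :: "'a::algebraic_quantum_group dual"
  obtains t where "mu t = b"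
proof -
  obtain c where b: "b = dualR c" by (rule dualR_cases)
  obtain s :: "('a, 'a) tensor" where s: "slice_right left_int s = c" using slice_right_left_int_surj by blast
  have "mu (tensor_map dualR dualR t) = dualR (slice_right left_int (inv (tlift T3) t))" for t :: "('a, 'a) tensor"
    by (rule clinear_eq_tensor[where t=t])
      ((intro clin)+, simp add: tensor_map_tensor clin tlift_tensor dualR_times)
  from this[of "tlift T3 s"] show ?thesis using that unfolding canonical_inv s b by blast
qed

lemma act_alg_eq_lact: "b \<triangleright>\<^sub>A a = lact b a"
  unfolding act_alg_def
  by (rule the_equality) (simp add: pairing_times, rule pairing_eqI, simp add: pairing_times)

lemma pairing_act_dual: "pairing x (a \<triangleright>\<^sub>B b) = pairing (x * a) b"
proof -
  have "a \<triangleright>\<^sub>B b = dualR (a * dual_rep b)"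
    unfolding act_dual_def
  proof (rule the_equality)
    show *: "\<forall>x. pairing x (dualR (a * dual_rep b)) = pairing (x * a) b"
      by (simp add: pairing_dualR) (simp add: pairing_dual_rep mult.assoc)
    show "d = dualR (a * dual_rep b)" if "\<forall>x. pairing x d = pairing (x * a) b" for d
      by (rule dual_eqI) (simp only: * that)
  qed
  then show ?thesis by (simp add: pairing_dualR) (simp add: pairing_dual_rep mult.assoc)
qed

lemma act_dual_dualR: "a \<triangleright>\<^sub>B dualR c = dualR (a * c)"
  by (rule dual_eqI) (simp add: pairing_act_dual pairing_dualR mult.assoc)

section \<open>The coproduct of the dual\<close>

lemma tensor_pairing_tensor:
  "tensor_pairing (a \<otimes> a') t = tlift (\<lambda>b b'. pairing a b * pairing a' b') t"
  unfolding tensor_pairing_def by (rule tlift_tensor) (intro clin)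

lemma clinear_tensor_pairing [clin]:
  "clinear f \<Longrightarrow> clinear (\<lambda>x. tensor_pairing (f x) t)"
  "clinear g \<Longrightarrow> clinear (\<lambda>x. tensor_pairing s (g x))"
  unfolding tensor_pairing_def by (intro clin; assumption)+

lemma tensor_pairing_tensor_tensor:
  "tensor_pairing (a \<otimes> a') (b \<otimes> b') = pairing a b * pairing a' b'"
  unfolding tensor_pairing_tensor by (rule tlift_tensor) (intro clin)

lemma tensor_pairing_slice:
  "tensor_pairing s (b \<otimes> b') = pairing (slice_right (\<lambda>x. pairing x b') s) b"
  "tensor_pairing s (b \<otimes> b') = pairing (slice_left (\<lambda>x. pairing x b) s) b'"
  by (rule clinear_eq_tensor[where t=s]; (intro clin)?;
    simp add: tensor_pairing_tensor_tensor slice_tensor clin clinearD(2)[OF clinear_pairing(1)[OF clinear_basic(1)]] scaleC_complex_def mult.commute)+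

lemma dual_separated:
  fixes b :: "'a::algebraic_quantum_group dual"
  shows "(\<And>f. f \<in> range pairing \<Longrightarrow> f b = 0) \<Longrightarrow> b = 0"
  by (rule dual_eqI) (metis clinearD(3)[OF clinear_pairing(2)[OF clinear_basic(1)]] rangeI)

lemma alg_separated:
  fixes a :: "'a::algebraic_quantum_group"
  shows "(\<And>f. f \<in> range (\<lambda>b x. pairing x b) \<Longrightarrow> f a = 0) \<Longrightarrow> a = 0"
  by (rule pairing_nondegenerate) blast

lemma tensor_pairing_eqI:
  fixes s t :: "('a::algebraic_quantum_group dual, 'a dual) tensor"
  assumes "\<And>a a'. tensor_pairing (a \<otimes> a') s = tensor_pairing (a \<otimes> a') t"
  shows "s = t"
proof (rule tensor_functional_eqI[OF _ dual_separated _ dual_separated])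
  show "clinear f" if "f \<in> range pairing" for f :: "'a dual \<Rightarrow> complex" using that by (auto intro: clin)
  then show "clinear f" if "f \<in> range pairing" for f :: "'a dual \<Rightarrow> complex" using that .
  have "pairing a' (slice_left (pairing a) t) = tensor_pairing (a \<otimes> a') t" for a a' :: 'a and t
    unfolding tensor_pairing_tensor slice_left_def
    by (subst clinear_tlift_push[of "pairing a'"]) (auto intro: clin simp: clinearD(2)[OF clinear_pairing(2)[OF clinear_basic(1)]] scaleC_complex_def)
  then show "g (slice_left f s) = g (slice_left f t)" if "f \<in> range pairing" "g \<in> range pairing" for f g
    using that assms by auto
qed auto

lemma lact_times_fun: "lact (b * d) = (\<lambda>a. lact b (lact d a))"
  by (simp add: fun_eq_iff lact_times)

lemma cbilinear_lact [clin]: "cbilinear (lact :: 'a::algebraic_quantum_group dual \<Rightarrow> _)"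
  by (intro clin)

abbreviation lact2 :: "('a::algebraic_quantum_group dual, 'a dual) tensor \<Rightarrow> ('a, 'a) tensor \<Rightarrow> ('a, 'a) tensor"
  where "lact2 \<equiv> tact lact lact"

lemmas lact2_tensor = tact_tensor[OF cbilinear_lact cbilinear_lact]
  and clinear_lact2 = clinear_tact[OF cbilinear_lact cbilinear_lact]

lemma lact2_times: "lact2 (s * t) \<xi> = lact2 s (lact2 t \<xi>)"
  by (rule tact_times) (intro cbilinear_lact lact_times)+

lemma lact2_faithful: "(\<And>\<xi>. lact2 t \<xi> = 0) \<Longrightarrow> t = 0"
  by (rule tact_faithful[OF cbilinear_lact cbilinear_lact lact_faithful_dual lact_faithful_dual])

lemma lact2_eqI: "(\<And>\<xi>. lact2 s \<xi> = lact2 t \<xi>) \<Longrightarrow> s = t"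
  by (rule tact_eqI[OF cbilinear_lact cbilinear_lact lact_faithful_dual lact_faithful_dual])

text \<open>
  On \<open>A \<otimes> A\<close> the element \<open>V\<close> acts as \<open>T1\<close>, so the coproduct \<open>\<Delta>(b) = V\<^sup>-\<^sup>1 (1 \<otimes> b) V\<close> of the dual
  has to act as the following operator.
\<close>

definition dual_comult_op :: "'a::algebraic_quantum_group dual \<Rightarrow> ('a, 'a) tensor \<Rightarrow> ('a, 'a) tensor"
  where "dual_comult_op b \<xi> = inv (tlift T1) (tensor_map (\<lambda>x. x) (lact b) (tlift T1 \<xi>))"

lemma clinear_dual_comult_op [clin]: "clinear f \<Longrightarrow> clinear (\<lambda>x. dual_comult_op b (f x))"
  unfolding dual_comult_op_def by (intro clin; assumption)

text \<open>
  The element \<open>\<Delta>(b)(1 \<otimes> y)\<close>.  For \<open>b = \<phi>( \<cdot> c)\<close>, \<open>y = \<phi>( \<cdot> d)\<close> and \<open>c \<otimes> d = \<Sum> \<Delta>(p)(q \<otimes> 1)\<close>, left invariance shows that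
  it is \<open>\<Sum> \<phi>( \<cdot> q) \<otimes> \<phi>( \<cdot> p)\<close>.
\<close>

lemma dual_comult_right_exists:
  fixes b y :: "'a::algebraic_quantum_group dual"
  obtains s where "\<And>a a'. tensor_pairing (a \<otimes> a') s = pairing (a * lact y a') b"
proof -
  obtain c d where b: "b = dualR c" and y: "y = dualR d" by (metis dualR_cases)
  have *: "left_int (a * slice_right left_int (lapp (comult a') (tlift T3 v)))
      = tensor_pairing (a \<otimes> a') (tensor_map dualR dualR (tensor_flip v))" for a a' and v :: "('a, 'a) tensor"
    by (rule clinear_eq_tensor[where t=v])
      ((intro clin)+, simp add: canonical_tensor canonical_times left_int_invariant
        tensor_flip_tensor tensor_map_tensor clin tensor_pairing_tensor_tensor pairing_dualR mult_scaleC_right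
        clinearD(2)[OF clinear_left_int] scaleC_complex_def mult.commute)
  have "pairing (a * lact y a') b = left_int (a * slice_right left_int (lapp (comult a') (c \<otimes> d)))" for a a'
    by (simp add: b y pairing_dualR lact_dualR canonical_app(1) slice_leg(6)[OF clinear_left_int] mult.assoc)
  with * show ?thesis using that by (metis canonical_inv(3))
qed

text \<open>
  The element \<open>(x \<otimes> 1)\<Delta>(b)\<close>.  For \<open>x = \<psi>(d \<cdot> )\<close>, \<open>b = \<phi>(c \<cdot> )\<close> and \<open>d \<otimes> c = \<Sum> (1 \<otimes> q)\<Delta>(r)\<close>, right invariance shows
  that it is \<open>\<Sum> \<psi>(r \<cdot> ) \<otimes> \<phi>(q \<cdot> )\<close>.
\<close>

lemma dual_comult_left_exists:
  fixes b x :: "'a::algebraic_quantum_group dual"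
  obtains t where "\<And>a a'. tensor_pairing (a \<otimes> a') t = pairing (ract x a * a') b"
proof -
  obtain \<psi> :: "'a \<Rightarrow> complex" where psi: "right_integral comult \<psi>" using right_integral_exists by blast
  have p: "clinear \<psi>" using psi by (simp add: right_integral_def)
  obtain c where b: "b = dualL c" by (rule dualL_cases)
  have to_psi: "\<exists>d. \<forall>a. pairing a x = \<psi> (d * a)" for x :: "'a dual"
  proof -
    obtain d where "x = dualL d" by (rule dualL_cases)
    then show ?thesis using right_integral_left_int_same_side(2)[OF psi, of d] by (auto simp: pairing_dualL)
  qed
  have of_psi: "\<exists>x. \<forall>a. pairing a x = \<psi> (d * a)" for d :: 'a
    using right_integral_left_int_same_side(1)[OF psi, of d] by (metis pairing_dualL)
  obtain d where x: "\<And>a. pairing a x = \<psi> (d * a)" using to_psi by metis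
  have *: "\<exists>t. \<forall>a a'. left_int (slice_left \<psi> (rapp (tlift T4 v) (comult a)) * a') = tensor_pairing (a \<otimes> a') t" for v
  proof (induction v)
    case (tensor q r)
    obtain e where e: "\<And>a. pairing a e = \<psi> (r * a)" using of_psi by metis
    have "left_int (slice_left \<psi> (rapp (tlift T4 (q \<otimes> r)) (comult a)) * a') = tensor_pairing (a \<otimes> a') (e \<otimes> dualL q)" for a a'
      by (simp add: canonical_tensor canonical_times right_integral_invariant[OF psi] tensor_pairing_tensor_tensor e pairing_dualL
        mult_scaleC_left clinearD(2)[OF clinear_left_int] scaleC_complex_def)
    then show ?case by blast
  next
    case (add v w)
    then obtain s t where
      "\<And>a a'. left_int (slice_left \<psi> (rapp (tlift T4 v) (comult a)) * a') = tensor_pairing (a \<otimes> a') s"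
      "\<And>a a'. left_int (slice_left \<psi> (rapp (tlift T4 w) (comult a)) * a') = tensor_pairing (a \<otimes> a') t" by metis
    then have "left_int (slice_left \<psi> (rapp (tlift T4 (v + w)) (comult a)) * a') = tensor_pairing (a \<otimes> a') (s + t)" for a a'
      by (simp add: clinearD(1)[OF clinear_canonical_tlift(4)] clinearD(1)[OF multiplierD(2)] clinearD(1)[OF clinear_slice_left[OF p]]
        distrib_right clinearD(1)[OF clinear_left_int] clinearD(1)[OF clinear_tensor_pairing(2)[OF clinear_basic(1)]])
    then show ?case by blast
  qed
  have "pairing (ract x a * a') b = left_int (slice_left \<psi> (rapp (d \<otimes> c) (comult a)) * a')" for a a'
    using ract_T1_T4(2)[of x c a]
    by (simp add: b pairing_dualL canonical_app(3) slice_leg(1)[OF p] x mult.assoc)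
  with *[of "inv (tlift T4) (d \<otimes> c)"] show ?thesis using that by (auto simp: canonical_inv)
qed

text \<open>
  The action of \<open>\<Delta>(b)(1 \<otimes> y)\<close> on \<open>x \<otimes> z\<close>, followed by multiplication.  After multiplication by \<open>k\<close> from the
  right, both sides are obtained from \<open>\<Delta>(x)(\<iota> \<otimes> y)(\<Delta>(z)(k \<otimes> 1))\<close> by applying \<open>b\<close> to the second leg.
\<close>

lemma dual_comult_right_mult:
  assumes s: "\<And>a a'. tensor_pairing (a \<otimes> a') s = pairing (a * lact y a') b"
  shows "tlift (\<lambda>d e. lact d x * lact e z) s = lact b (x * lact y z)"
proof (rule nondegenerate_left_eqI)
  fix k
  have pb: "clinear (\<lambda>x. pairing x b)" for b :: "'a dual" by (intro clin)
  have key: "slice_right (\<lambda>x. pairing x b) (lapp (comult x) (g \<otimes> lact y h))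
      = tlift (\<lambda>d e. pairing h e *\<^sub>C (lact d x * g)) s" for g h
  proof -
    have "slice_right (\<lambda>x. pairing x b) (lapp (comult x) (g \<otimes> lact y h))
        = slice_right (\<lambda>l. pairing (l * lact y h) b) (T3 x g)"
      by (simp add: canonical_app(2) slice_leg(8)[OF pb])
    also have "(\<lambda>l. pairing (l * lact y h) b) = (\<lambda>l. tlift (\<lambda>d e. pairing l d * pairing h e) s)"
      by (simp add: fun_eq_iff s[symmetric] tensor_pairing_tensor)
    also have "slice_right \<dots> (T3 x g) = tlift (\<lambda>d e. slice_right (\<lambda>l. pairing l d * pairing h e) (T3 x g)) s"
    proof -
      have "slice_right (\<lambda>l. tlift (\<lambda>d e. pairing l d * pairing h e) s) (T3 x g)
          = tlift (\<lambda>u l. tlift (\<lambda>d e. (pairing l d * pairing h e) *\<^sub>C u) s) (T3 x g)"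
        unfolding slice_right_def by (simp add: clinear_tlift_push[OF clinear_scaleC_left[OF clinear_basic(1)]])
      also have "\<dots> = tlift (\<lambda>d e. tlift (\<lambda>u l. (pairing l d * pairing h e) *\<^sub>C u) (T3 x g)) s"
        by (rule tlift_swap)
      finally show ?thesis by (simp add: slice_right_def)
    qed
    also have "(\<lambda>d e. slice_right (\<lambda>l. pairing l d * pairing h e) (T3 x g)) = (\<lambda>d e. pairing h e *\<^sub>C (lact d x * g))"
    proof (intro ext)
      fix d e
      have "slice_right (\<lambda>l. pairing l d * pairing h e) t = pairing h e *\<^sub>C slice_right (\<lambda>l. pairing l d) t" for t :: "('a, 'a) tensor"
        unfolding slice_right_def
        by (simp add: clinear_tlift_push[OF clinear_basic(3)[OF clinear_basic(1)]] scaleC_scaleC mult.commute)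
      then show "slice_right (\<lambda>l. pairing l d * pairing h e) (T3 x g) = pairing h e *\<^sub>C (lact d x * g)"
        by (simp add: lact_T2_T3)
    qed
    finally show ?thesis .
  qed
  have T3: "T3 (lact y z) k = tensor_map (\<lambda>x. x) (lact y) (T3 z k)"
    unfolding lact_def by (rule coassoc_T3[symmetric]) (rule clinear_left_int)
  have c1: "clinear (\<lambda>t. slice_right (\<lambda>x. pairing x b) (lapp (comult x) t))" by (intro clin)
  have "lact b (x * lact y z) * k = slice_right (\<lambda>x. pairing x b) (lapp (comult x) (T3 (lact y z) k))"
    by (simp add: lact_T2_T3 canonical_times)
  also have "\<dots> = tlift (\<lambda>g h. slice_right (\<lambda>x. pairing x b) (lapp (comult x) (g \<otimes> lact y h))) (T3 z k)"
    unfolding T3 unfolding tensor_map_def by (rule clinear_tlift_push[OF c1])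
  also have "\<dots> = tlift (\<lambda>g h. tlift (\<lambda>d e. pairing h e *\<^sub>C (lact d x * g)) s) (T3 z k)"
    unfolding key ..
  also have "\<dots> = tlift (\<lambda>d e. tlift (\<lambda>g h. pairing h e *\<^sub>C (lact d x * g)) (T3 z k)) s"
    by (rule tlift_swap)
  also have "(\<lambda>d e. tlift (\<lambda>g h. pairing h e *\<^sub>C (lact d x * g)) (T3 z k)) = (\<lambda>d e. lact d x * lact e z * k)"
  proof (intro ext)
    fix d e
    have "lact d x * (lact e z * k) = lact d x * slice_right (\<lambda>x. pairing x e) (T3 z k)"
      by (simp add: lact_T2_T3)
    also have "\<dots> = tlift (\<lambda>g h. pairing h e *\<^sub>C (lact d x * g)) (T3 z k)"
      unfolding slice_right_def by (simp add: clinear_tlift_push[OF clinear_times(2)[OF clinear_basic(1)]] mult_scaleC_right)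
    finally show "tlift (\<lambda>g h. pairing h e *\<^sub>C (lact d x * g)) (T3 z k) = lact d x * lact e z * k"
      by (simp add: mult.assoc)
  qed
  also have "tlift \<dots> s = tlift (\<lambda>d e. lact d x * lact e z) s * k"
    by (rule clinear_tlift_push[symmetric]) (intro clin)
  finally show "tlift (\<lambda>d e. lact d x * lact e z) s * k = lact b (x * lact y z) * k" by simp
qed

lemma dual_comult_op_right:
  assumes s: "\<And>a a'. tensor_pairing (a \<otimes> a') s = pairing (a * lact y a') b"
  shows "dual_comult_op b (tensor_map (\<lambda>x. x) (lact y) \<xi>) = lact2 s \<xi>"
proof -
  have "tlift T1 (lact2 s \<xi>) = tensor_map (\<lambda>x. x) (lact b) (tlift T1 (tensor_map (\<lambda>x. x) (lact y) \<xi>))"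
  proof (rule clinear_eq_tensor[where t=\<xi>])
    fix x z :: 'a
    have "tlift T1 (lact2 s (x \<otimes> z)) = tensor_map (\<lambda>x. x) (lact b) (T1 x (lact y z))"
    proof (rule slice_left_eqI[of "range (\<lambda>b x. pairing x b)", OF _ alg_separated])
      show "clinear f" if "f \<in> range (\<lambda>b x. pairing x b)" for f :: "'a \<Rightarrow> complex" using that by (auto intro: clin)
      fix f :: "'a \<Rightarrow> complex" assume "f \<in> range (\<lambda>b x. pairing x b)"
      then obtain p where f: "f = (\<lambda>x. pairing x p)" by blast
      have cf: "clinear (\<lambda>x. pairing x p)" by (intro clin)
      have "slice_left f (tlift T1 (lact2 s (x \<otimes> z))) = tlift (\<lambda>d e. lact d (ract p x) * lact e z) s"
        by (simp add: f tact_def tensor_map_tensor clin clinear_tlift_push[OF clinear_canonical_tlift(1)] canonical_tensor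
          clinear_tlift_push[OF clinear_slice_left[OF cf]] ract_T1_T4 lact_ract)
      also have "\<dots> = lact b (ract p x * lact y z)"
        by (rule dual_comult_right_mult[OF s])
      also have "\<dots> = slice_left f (tensor_map (\<lambda>x. x) (lact b) (T1 x (lact y z)))"
        by (simp add: f slice_left_tensor_map clin cf ract_T1_T4)
      finally show "slice_left f (tlift T1 (lact2 s (x \<otimes> z))) = slice_left f (tensor_map (\<lambda>x. x) (lact b) (T1 x (lact y z)))" .
    qed blast
    then show "tlift T1 (lact2 s (x \<otimes> z)) = tensor_map (\<lambda>x. x) (lact b) (tlift T1 (tensor_map (\<lambda>x. x) (lact y) (x \<otimes> z)))"
      by (simp add: tensor_map_tensor clin canonical_tensor)
  qed (intro clin)+
  then show ?thesis unfolding dual_comult_op_def by (metis canonical_inv(5))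
qed

lemma tensor_span_lact_eqI:
  fixes f g :: "('a::algebraic_quantum_group, 'a) tensor \<Rightarrow> 'b::complex_vector"
  assumes "clinear f" "clinear g" "\<And>x b z. f (x \<otimes> lact b z) = g (x \<otimes> lact b z)"
  shows "f t = g t"
proof (rule clinear_eq_tensor[OF assms(1,2)])
  fix x y :: 'a
  show "f (x \<otimes> y) = g (x \<otimes> y)"
    by (rule clinear_span_lact_eqI[of "\<lambda>y. f (x \<otimes> y)" "\<lambda>y. g (x \<otimes> y)"])
      ((rule clinear_compose[OF assms(1)] clinear_compose[OF assms(2)], intro clin)+, rule assms(3))
qed

text \<open>
  The elements \<open>s = \<Delta>(b)(1 \<otimes> y)\<close> and \<open>t = (x \<otimes> 1)\<Delta>(b)\<close> satisfy \<open>(x \<otimes> 1) s = t (1 \<otimes> y)\<close>, as their pairings show;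
  this carries \<open>dual_comult_op_right\<close> over to the other side, since the \<open>y \<triangleright> z\<close> span \<open>A\<close>.
\<close>

lemma dual_comult_op_left:
  assumes t: "\<And>a a'. tensor_pairing (a \<otimes> a') t = pairing (ract x a * a') b"
  shows "tensor_map (lact x) (\<lambda>x. x) (dual_comult_op b \<xi>) = lact2 t \<xi>"
proof (rule tensor_span_lact_eqI[where t=\<xi>])
  fix u y z
  obtain s where s: "\<And>a a'. tensor_pairing (a \<otimes> a') s = pairing (a * lact y a') b"
    using dual_comult_right_exists[of y b] by blast
  have left: "tensor_pairing (a \<otimes> a') (tensor_map ((*) x) (\<lambda>x. x) s) = tensor_pairing (ract x a \<otimes> a') s" for a a'
    by (rule clinear_eq_tensor[where t=s])
      ((intro clin)+, simp add: tensor_map_tensor clin tensor_pairing_tensor_tensor pairing_times')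
  have right: "tensor_pairing (a \<otimes> a') (tensor_map (\<lambda>x. x) (\<lambda>q. q * y) t) = tensor_pairing (a \<otimes> lact y a') t" for a a'
    by (rule clinear_eq_tensor[where t=t])
      ((intro clin)+, simp add: tensor_map_tensor clin tensor_pairing_tensor_tensor pairing_times)
  have eq: "tensor_map ((*) x) (\<lambda>x. x) s = tensor_map (\<lambda>x. x) (\<lambda>q. q * y) t"
    by (rule tensor_pairing_eqI) (simp add: left right s t)
  have L: "tensor_map (lact x) (\<lambda>x. x) (lact2 s \<xi>) = lact2 (tensor_map ((*) x) (\<lambda>x. x) s) \<xi>" for \<xi>
    by (rule clinear_eq_tensor[where t=s])
      ((intro clin)+, simp add: lact2_tensor tensor_map_tensor clin tensor_map_compose lact_times_fun)
  have R: "lact2 t (tensor_map (\<lambda>x. x) (lact y) \<xi>) = lact2 (tensor_map (\<lambda>x. x) (\<lambda>q. q * y) t) \<xi>" for \<xi>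
    by (rule clinear_eq_tensor[where t=t])
      ((intro clin)+, simp add: lact2_tensor tensor_map_tensor clin tensor_map_compose lact_times_fun)
  have "tensor_map (lact x) (\<lambda>x. x) (dual_comult_op b (tensor_map (\<lambda>x. x) (lact y) (u \<otimes> z)))
      = lact2 t (tensor_map (\<lambda>x. x) (lact y) (u \<otimes> z))"
    unfolding dual_comult_op_right[OF s] L R eq ..
  then show "tensor_map (lact x) (\<lambda>x. x) (dual_comult_op b (u \<otimes> lact y z)) = lact2 t (u \<otimes> lact y z)"
    by (simp add: tensor_map_tensor clin)
qed (intro clin)+

lemma dual_comult_multiplier_exists:
  fixes b :: "'a::algebraic_quantum_group dual"
  obtains m where "\<And>n \<xi>. lact2 (lapp m n) \<xi> = dual_comult_op b (lact2 n \<xi>)"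
    "\<And>n \<xi>. lact2 (rapp n m) \<xi> = lact2 n (dual_comult_op b \<xi>)"
proof (rule multiplier_of_operator[of lact2 "dual_comult_op b"])
  note lin = clinearD(1)[OF clinear_lact2(1)[OF clinear_basic(1)]] clinearD(1)[OF clinear_dual_comult_op[OF clinear_basic(1)]]
  show "\<exists>n'. \<forall>\<xi>. lact2 n' \<xi> = dual_comult_op b (lact2 n \<xi>)" for n
  proof (induction n)
    case (tensor x y)
    obtain s where s: "\<And>a a'. tensor_pairing (a \<otimes> a') s = pairing (a * lact y a') b"
      using dual_comult_right_exists[of y b] by blast
    have "lact2 (tensor_map (\<lambda>u. u * x) (\<lambda>x. x) s) \<xi> = lact2 s (tensor_map (lact x) (\<lambda>x. x) \<xi>)" for \<xi>
      by (rule clinear_eq_tensor[where t=s])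
        ((intro clin)+, simp add: lact2_tensor tensor_map_tensor clin tensor_map_compose lact_times_fun)
    moreover have "lact2 (x \<otimes> y) \<xi> = tensor_map (\<lambda>x. x) (lact y) (tensor_map (lact x) (\<lambda>x. x) \<xi>)" for \<xi>
      by (simp add: lact2_tensor tensor_map_compose clin)
    ultimately show ?case by (metis dual_comult_op_right[OF s])
  next
    case (add s t)
    then show ?case by (metis lin)
  qed
  show "\<exists>n'. \<forall>\<xi>. lact2 n' \<xi> = lact2 n (dual_comult_op b \<xi>)" for n
  proof (induction n)
    case (tensor x y)
    obtain t where t: "\<And>a a'. tensor_pairing (a \<otimes> a') t = pairing (ract x a * a') b"
      using dual_comult_left_exists[of x b] by blast
    have "lact2 (tensor_map (\<lambda>x. x) ((*) y) t) \<xi> = tensor_map (\<lambda>x. x) (lact y) (lact2 t \<xi>)" for \<xi>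
      by (rule clinear_eq_tensor[where t=t])
        ((intro clin)+, simp add: lact2_tensor tensor_map_tensor clin tensor_map_compose lact_times_fun)
    moreover have "lact2 (x \<otimes> y) \<xi> = tensor_map (\<lambda>x. x) (lact y) (tensor_map (lact x) (\<lambda>x. x) \<xi>)" for \<xi>
      by (simp add: lact2_tensor tensor_map_compose clin)
    ultimately show ?case by (metis dual_comult_op_left[OF t])
  next
    case (add s t)
    then show ?case by (metis lin(1))
  qed
qed (intro clin lact2_times lact2_faithful | assumption | blast)+

text \<open>
  The multiplier found above has the defining property of \<open>\<Delta>(b)\<close>.  It is the only one: the property determines
  all \<open>(x \<otimes> 1)\<Delta>(b)\<close>, and \<open>B\<close> is spanned by products.
\<close>

lemma lact2_dual_comult: "lact2 (lapp (dual_comult b) n) \<xi> = dual_comult_op b (lact2 n \<xi>)"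
proof -
  obtain m where m: "\<And>n \<xi>. lact2 (lapp m n) \<xi> = dual_comult_op b (lact2 n \<xi>)"
    "\<And>n \<xi>. lact2 (rapp n m) \<xi> = lact2 n (dual_comult_op b \<xi>)"
    using dual_comult_multiplier_exists[of b] by blast
  have legs: "lact2 (lapp (of_alg x \<otimes>\<^sub>m 1) n) \<xi> = tensor_map (lact x) (\<lambda>x. x) (lact2 n \<xi>)"
    "lact2 (lapp (1 \<otimes>\<^sub>m of_alg x) n) \<xi> = tensor_map (\<lambda>x. x) (lact x) (lact2 n \<xi>)" for x n \<xi>
    by (rule clinear_eq_tensor[where t=n];
      (intro clin)?; simp add: lact2_tensor mult_tensor_app of_alg_app tensor_map_compose clin lact_times_fun)+
  have T1_pairing: "tensor_pairing (comult_right comult a a') (x \<otimes> b) = pairing (ract x a * a') b" for a a' x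
    unfolding T1_def[symmetric] by (simp add: tensor_pairing_slice(2) ract_T1_T4)
  have T2_pairing: "tensor_pairing (comult_left comult a a') (b \<otimes> y) = pairing (a * lact y a') b" for a a' y
    unfolding T2_def[symmetric] by (simp add: tensor_pairing_slice(1) lact_T2_T3)
  have left: "(of_alg x \<otimes>\<^sub>m 1) * m = of_alg t"
    if t: "\<And>a a'. tensor_pairing (a \<otimes> a') t = pairing (ract x a * a') b" for x t
    by (rule multiplier_eq_lappI, rule lact2_eqI)
      (simp add: legs m of_alg_app lact2_times dual_comult_op_left[OF t])
  have right: "m * (1 \<otimes>\<^sub>m of_alg y) = of_alg s"
    if s: "\<And>a a'. tensor_pairing (a \<otimes> a') s = pairing (a * lact y a') b" for y s
    by (rule multiplier_eq_lappI, rule lact2_eqI)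
      (simp add: legs m of_alg_app lact2_times dual_comult_op_right[OF s])
  have "dual_comult b = m"
    unfolding dual_comult_def T1_pairing T2_pairing
  proof (rule the_equality)
    show "\<forall>x. (\<exists>t. (of_alg x \<otimes>\<^sub>m 1) * m = of_alg t \<and> (\<forall>a a'. tensor_pairing (a \<otimes> a') t = pairing (ract x a * a') b)) \<and>
      (\<exists>t. m * (1 \<otimes>\<^sub>m of_alg x) = of_alg t \<and> (\<forall>a a'. tensor_pairing (a \<otimes> a') t = pairing (a * lact x a') b))"
    proof (intro allI conjI)
      fix x
      show "\<exists>t. (of_alg x \<otimes>\<^sub>m 1) * m = of_alg t \<and> (\<forall>a a'. tensor_pairing (a \<otimes> a') t = pairing (ract x a * a') b)"
        using left dual_comult_left_exists[of x b] by metis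
      show "\<exists>t. m * (1 \<otimes>\<^sub>m of_alg x) = of_alg t \<and> (\<forall>a a'. tensor_pairing (a \<otimes> a') t = pairing (a * lact x a') b)"
        using right dual_comult_right_exists[of x b] by metis
    qed
  next
    fix m'
    assume m': "\<forall>x. (\<exists>t. (of_alg x \<otimes>\<^sub>m 1) * m' = of_alg t \<and> (\<forall>a a'. tensor_pairing (a \<otimes> a') t = pairing (ract x a * a') b)) \<and>
      (\<exists>t. m' * (1 \<otimes>\<^sub>m of_alg x) = of_alg t \<and> (\<forall>a a'. tensor_pairing (a \<otimes> a') t = pairing (a * lact x a') b))"
    have eq: "(of_alg x \<otimes>\<^sub>m 1) * m' = (of_alg x \<otimes>\<^sub>m 1) * m" for x
      using m' left by metis
    have pure: "rapp ((d * x) \<otimes> y) m' = rapp ((d * x) \<otimes> y) m" for d x y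
      using arg_cong[OF eq[of x], of "rapp (d \<otimes> y)"] by (simp add: mult_tensor_app of_alg_app)
    have span: "rapp (mu t \<otimes> y) m' = rapp (mu t \<otimes> y) m" for t y
      by (rule clinear_eq_tensor[where t=t]) ((intro clin)+, simp add: tlift_tensor clin pure)
    have "rapp (x \<otimes> y) m' = rapp (x \<otimes> y) m" for x y
    proof -
      obtain t where "mu t = x" by (rule dual_mult_surj)
      then show ?thesis using span[of t y] by simp
    qed
    then have "rapp n m' = rapp n m" for n
      by (rule clinear_eq_tensor[OF multiplierD(2) multiplierD(2)])
    then show "m' = m" by (rule multiplier_eq_rappI)
  qed
  then show ?thesis by (simp add: m)
qed

section \<open>The Heisenberg algebra\<close>

lemma clinear_Abs_heisenberg [clin]: "clinear f \<Longrightarrow> clinear (\<lambda>x. Abs_heisenberg (f x))"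
  by (rule clinearI) (simp_all add: clinearD plus_heisenberg_def scaleC_heisenberg_def Abs_heisenberg_inverse)

lemma clinear_Rep_heisenberg [clin]: "clinear f \<Longrightarrow> clinear (\<lambda>x. Rep_heisenberg (f x))"
  by (rule clinear_compose[of Rep_heisenberg], rule clinearI)
    (simp_all add: plus_heisenberg_def scaleC_heisenberg_def Abs_heisenberg_inverse)

lemma Rep_Abs_heisenberg: "Rep_heisenberg (Abs_heisenberg t) = t"
  by (simp add: Abs_heisenberg_inverse)

lemma cross_pairing_tensor:
  "cross_pairing (b \<otimes> a) t = tlift (\<lambda>a' b'. pairing a' b * pairing a b') t"
  unfolding cross_pairing_def by (rule tlift_tensor) (intro clin)

lemma clinear_cross_pairing [clin]:
  "clinear f \<Longrightarrow> clinear (\<lambda>x. cross_pairing (f x) t)"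
  "clinear g \<Longrightarrow> clinear (\<lambda>x. cross_pairing s (g x))"
  unfolding cross_pairing_def by (intro clin; assumption)+

lemma cross_pairing_tensor_tensor:
  "cross_pairing (b \<otimes> a) (a' \<otimes> b') = pairing a' b * pairing a b'"
  unfolding cross_pairing_tensor by (rule tlift_tensor) (intro clin)

lemma cross_pairing_eqI:
  fixes s t :: "('a::algebraic_quantum_group, 'a dual) tensor"
  assumes "\<And>b a. cross_pairing (b \<otimes> a) s = cross_pairing (b \<otimes> a) t"
  shows "s = t"
proof (rule tensor_functional_eqI[OF _ alg_separated _ dual_separated])
  show "clinear f" if "f \<in> range (\<lambda>b x. pairing x b)" for f :: "'a \<Rightarrow> complex" using that by (auto intro: clin)
  show "clinear g" if "g \<in> range pairing" for g :: "'a dual \<Rightarrow> complex" using that by (auto intro: clin)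
  have "pairing a (slice_left (\<lambda>x. pairing x b) t) = cross_pairing (b \<otimes> a) t" for a :: 'a and b t
    unfolding cross_pairing_tensor slice_left_def
    by (subst clinear_tlift_push[of "pairing a"]) (auto intro: clin simp: clinearD(2)[OF clinear_pairing(2)[OF clinear_basic(1)]] scaleC_complex_def)
  then show "g (slice_left f s) = g (slice_left f t)" if "f \<in> range (\<lambda>b x. pairing x b)" "g \<in> range pairing" for f g
    using that assms by auto
qed auto

lemma heisenberg_twist_dualL: "heisenberg_twist a (dualL c) = tensor_map (\<lambda>x. x) dualL (T4 c a)"
proof -
  have cross: "cross_pairing (b' \<otimes> a') (tensor_map (\<lambda>x. x) dualL t) = pairing (slice_right left_int (rapp t (1 \<otimes>\<^sub>m of_alg a'))) b'" for a' b' t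
    by (rule clinear_eq_tensor[where t=t])
      ((intro clin)+, simp add: tensor_map_tensor clin cross_pairing_tensor_tensor pairing_dualL mult_tensor_app of_alg_app
        slice_tensor clinearD(2)[OF clinear_pairing(1)[OF clinear_basic(1)]] scaleC_complex_def mult.commute)
  have *: "cross_pairing (b' \<otimes> a') (tensor_map (\<lambda>x. x) dualL (T4 c a)) = tensor_pairing (comult_right comult a a') (b' \<otimes> dualL c)" for a' b'
    unfolding cross T1_def[symmetric] tensor_pairing_slice(1) pairing_dualL
    by (simp add: canonical_exchange(3)[symmetric] slice_leg(7)[OF clinear_left_int])
  show ?thesis
    unfolding heisenberg_twist_def
    by (rule the_equality) (simp_all add: * cross_pairing_eqI)
qed

lemma clinear_heisenberg_twist [clin]:
  fixes f :: "'b::complex_vector \<Rightarrow> 'a::algebraic_quantum_group" and g :: "'b \<Rightarrow> 'a dual"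
  shows "clinear f \<Longrightarrow> clinear (\<lambda>x. heisenberg_twist (f x) b)"
  "clinear g \<Longrightarrow> clinear (\<lambda>x. heisenberg_twist a (g x))"
proof -
  have l: "clinear (\<lambda>a. heisenberg_twist a b)" for b :: "'a dual"
  proof -
    obtain c where b: "b = dualL c" by (rule dualL_cases)
    show ?thesis unfolding b heisenberg_twist_dualL by (intro clin)
  qed
  have r: "clinear (\<lambda>b. heisenberg_twist a b)" for a :: 'a
  proof (rule clinearI)
    fix b d :: "'a dual" and z
    obtain c e where b: "b = dualL c" "d = dualL e" by (metis dualL_cases)
    have bd: "b + d = dualL (c + e)" "z *\<^sub>C b = dualL (z *\<^sub>C c)"
      by (simp_all add: b clinearD[OF clinear_dualL[OF clinear_basic(1)]])
    have lin: "clinear (\<lambda>c. tensor_map (\<lambda>x. x) dualL (T4 c a))" by (intro clin)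
    show "heisenberg_twist a (b + d) = heisenberg_twist a b + heisenberg_twist a d"
      unfolding bd unfolding b heisenberg_twist_dualL clinearD(1)[OF lin] ..
    show "heisenberg_twist a (z *\<^sub>C b) = z *\<^sub>C heisenberg_twist a b"
      unfolding bd unfolding b heisenberg_twist_dualL clinearD(2)[OF lin] ..
  qed
  show "clinear f \<Longrightarrow> clinear (\<lambda>x. heisenberg_twist (f x) b)" "clinear g \<Longrightarrow> clinear (\<lambda>x. heisenberg_twist a (g x))"
    by (rule clinear_compose[OF l], assumption) (rule clinear_compose[OF r], assumption)
qed

definition hact :: "'a::algebraic_quantum_group heisenberg \<Rightarrow> 'a \<Rightarrow> 'a"
  where "hact z x = tlift (\<lambda>a b. a * lact b x) (Rep_heisenberg z)"

lemma clinear_hact [clin]: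
  "clinear f \<Longrightarrow> clinear (\<lambda>x. hact (f x) y)" "clinear g \<Longrightarrow> clinear (\<lambda>x. hact z (g x))"
  unfolding hact_def by (intro clin; assumption)+

lemma hact_heis: "hact (heis a b) x = a * lact b x"
  unfolding hact_def heis_def Rep_Abs_heisenberg by (rule tlift_tensor) (intro clin)

lemma clinear_heis [clin]: "clinear f \<Longrightarrow> clinear (\<lambda>x. heis (f x) b)" "clinear g \<Longrightarrow> clinear (\<lambda>x. heis a (g x))"
  unfolding heis_def by (intro clin; assumption)+

lemma heisenberg_induct [case_names heis add]:
  assumes "\<And>a b. P (heis a b)" "\<And>y z. P y \<Longrightarrow> P z \<Longrightarrow> P (y + z)"
  shows "P z"
proof -
  have "P (Abs_heisenberg t)" for t
    by (induction t) (use assms in \<open>simp_all add: heis_def clinearD(1)[OF clinear_Abs_heisenberg[OF clinear_basic(1)]]\<close>)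
  from this[of "Rep_heisenberg z"] show ?thesis by (simp add: Rep_heisenberg_inverse)
qed

lemma clinear_eq_heisenberg:
  assumes "clinear f" "clinear g" "\<And>a b. f (heis a b) = g (heis a b)"
  shows "f z = g z"
  by (induction z rule: heisenberg_induct) (simp_all add: assms clinearD(1)[OF assms(1)] clinearD(1)[OF assms(2)])

text \<open>
  Writing \<open>a \<otimes> c = T2 p q\<close>, left invariance shows that \<open>a \<otimes> \<phi>(c \<cdot> )\<close> acts as the operator
  \<open>x \<mapsto> \<phi>(q x) p\<close> of rank one.  Thus the Heisenberg algebra is the algebra of all operators of finite
  rank built from the functionals \<open>\<phi>(q \<cdot> )\<close>, and its structural properties become transparent.
\<close>

definition rank_one :: "('a::algebraic_quantum_group, 'a) tensor \<Rightarrow> 'a heisenberg"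
  where "rank_one v = Abs_heisenberg (tensor_map (\<lambda>x. x) dualL (tlift T2 v))"

lemma clinear_rank_one [clin]: "clinear f \<Longrightarrow> clinear (\<lambda>x. rank_one (f x))"
  unfolding rank_one_def by (intro clin; assumption)

lemma lact_dualL_rapp:
  "tlift (\<lambda>a b. a * lact b x) (tensor_map (\<lambda>x. x) dualL t) = slice_right left_int (rapp t (comult x))"
  by (rule clinear_eq_tensor[where t=t])
    ((intro clin)+, simp add: tensor_map_tensor clin tlift_tensor lact_dualL canonical_app(3) slice_leg(5))

lemma hact_rank_one: "hact (rank_one (p \<otimes> q)) x = left_int (q * x) *\<^sub>C p"
  by (simp add: hact_def rank_one_def Rep_Abs_heisenberg lact_dualL_rapp canonical_tensor canonical_times left_int_invariant)

lemma rank_one_cases: obtains v where "z = rank_one v"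
proof -
  have "\<exists>t. s = tensor_map (\<lambda>x. x) dualL t" for s :: "('a, 'a dual) tensor"
  proof (induction s)
    case (tensor x b)
    obtain c where "b = dualL c" by (rule dualL_cases)
    then have "x \<otimes> b = tensor_map (\<lambda>x. x) dualL (x \<otimes> c)" by (simp add: tensor_map_tensor clin)
    then show ?case by blast
  next
    case (add s t)
    then obtain s' t' where "s = tensor_map (\<lambda>x. x) dualL s'" "t = tensor_map (\<lambda>x. x) dualL t'" by blast
    then have "s + t = tensor_map (\<lambda>x. x) dualL (s' + t')"
      by (simp add: clinearD(1)[OF clinear_tensor_map[OF clinear_basic(1) clinear_dualL[OF clinear_basic(1)]]])
    then show ?case by blast
  qed
  then obtain t where "Rep_heisenberg z = tensor_map (\<lambda>x. x) dualL t" by blast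
  then have "z = rank_one (inv (tlift T2) t)"
    by (simp add: rank_one_def canonical_inv) (metis Rep_heisenberg_inverse)
  then show ?thesis by (rule that)
qed

lemma hact_faithful:
  assumes "\<And>x. hact z x = 0"
  shows "z = 0"
proof -
  obtain v where z: "z = rank_one v" by (rule rank_one_cases)
  have l: "clinear (\<lambda>q. left_int (q * x))" for x :: 'a by (intro clin)
  have "slice_right (\<lambda>q. left_int (q * x)) v = hact (rank_one v) x" for v and x :: 'a
    by (rule clinear_eq_tensor[where t=v]) ((intro clin l)+, simp add: hact_rank_one slice_tensor l)
  then have "slice_right (\<lambda>q. left_int (q * x)) v = 0" for x
    using assms z by simp
  then have slices: "slice_right f v = 0" if "f \<in> range (\<lambda>x q. left_int (q * x))" for f
    using that by auto
  have "v = 0"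
  proof (rule slice_right_separates[OF _ _ slices])
    show "clinear f" if "f \<in> range (\<lambda>x q::'a. left_int (q * x))" for f using that l by auto
    show "q = 0" if "\<And>f. f \<in> range (\<lambda>x q::'a. left_int (q * x)) \<Longrightarrow> f q = 0" for q
      by (rule left_int_faithful_left) (use that in blast)
  qed
  then show ?thesis by (simp add: z clinearD(3)[OF clinear_rank_one[OF clinear_basic(1)]])
qed

lemma hact_eqI: "(\<And>x. hact y x = hact z x) \<Longrightarrow> y = z"
  using hact_faithful[of "y - z"] by (simp add: clinear_diff[OF clinear_hact(1)[OF clinear_basic(1)]])

text \<open>
  The twist expresses the commutation rule \<open>b a = \<Sum> p q\<close> of operators on \<open>A\<close>; hence \<open>hact\<close> is multiplicative.
\<close>

lemma hact_twist: "tlift (\<lambda>p q. p * lact q x) (heisenberg_twist a b) = lact b (a * x)"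
proof -
  obtain c where b: "b = dualL c" by (rule dualL_cases)
  show ?thesis
    by (simp add: b heisenberg_twist_dualL lact_dualL_rapp canonical_times lact_dualL)
qed

lemma hact_times: "hact (y * z) x = hact y (hact z x)"
proof -
  define F where "F s t = tlift (\<lambda>a b. tlift (\<lambda>a' b'. tlift (\<lambda>p q. (a * p) \<otimes> (q * b')) (heisenberg_twist a' b)) t) s"
    for s t :: "('a, 'a dual) tensor"
  let ?h = "\<lambda>t x. tlift (\<lambda>a b. a * lact b x) t :: 'a"
  have F: "clinear (F s)" "clinear (\<lambda>s. F s t)" for s t
    unfolding F_def by (intro clin)+
  have "?h (F s t) x = ?h s (?h t x)" for s t
  proof (rule clinear_eq_tensor[of "\<lambda>s. ?h (F s t) x" "\<lambda>s. ?h s (?h t x)"])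
    fix a b
    show "?h (F (a \<otimes> b) t) x = ?h (a \<otimes> b) (?h t x)"
    proof (rule clinear_eq_tensor[of "\<lambda>t. ?h (F (a \<otimes> b) t) x" "\<lambda>t. ?h (a \<otimes> b) (?h t x)"])
      fix a' b'
      have h: "clinear (\<lambda>t. ?h t x)" by (intro clin)
      have "F (a \<otimes> b) (a' \<otimes> b') = tlift (\<lambda>p q. (a * p) \<otimes> (q * b')) (heisenberg_twist a' b)"
        unfolding F_def by (subst tlift_tensor, intro clin)+ (rule refl)
      then have "?h (F (a \<otimes> b) (a' \<otimes> b')) x = tlift (\<lambda>p q. (a * p) * lact (q * b') x) (heisenberg_twist a' b)"
        by (simp add: clinear_tlift_push[OF h] tlift_tensor clin)
      also have "\<dots> = a * tlift (\<lambda>p q. p * lact q (lact b' x)) (heisenberg_twist a' b)"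
        by (simp add: clinear_tlift_push[OF clinear_times(2)[OF clinear_basic(1)]] lact_times mult.assoc)
      also have "\<dots> = ?h (a \<otimes> b) (?h (a' \<otimes> b') x)"
        by (simp add: hact_twist tlift_tensor clin)
      finally show "?h (F (a \<otimes> b) (a' \<otimes> b')) x = ?h (a \<otimes> b) (?h (a' \<otimes> b') x)" .
    qed (intro clin clinear_compose[OF _ F(1)] clinear_tlift clinear_compose[OF clinear_tlift F(1)])+
  qed (intro clin clinear_compose[OF clinear_tlift F(2)])+
  then show ?thesis
    unfolding hact_def times_heisenberg_def Rep_Abs_heisenberg F_def[symmetric] .
qed

lemma hact_nonzero: "\<exists>z. hact z x = (y :: 'a::algebraic_quantum_group)" if x: "x \<noteq> 0"
proof -
  obtain q where q: "left_int (q * x) \<noteq> 0" using left_int_faithful_right x by blast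
  have "hact (rank_one (((1 / left_int (q * x)) *\<^sub>C y) \<otimes> q)) x = y"
    using q by (simp add: hact_rank_one scaleC_scaleC scaleC_one)
  then show ?thesis by blast
qed

text \<open>
  As an algebra acting faithfully, the Heisenberg algebra inherits associativity from the composition of
  operators; it is non-degenerate because it contains enough operators of rank one.
\<close>

instance heisenberg :: (algebraic_quantum_group) nondegenerate_algebra
proof
  fix x y z :: "'a heisenberg" and c
  note h = clinearD[OF clinear_hact(1)[OF clinear_basic(1)]] clinearD[OF clinear_hact(2)[OF clinear_basic(1)]]
  show "x * y * z = x * (y * z)" by (rule hact_eqI) (simp add: hact_times)
  show "(x + y) * z = x * z + y * z" by (rule hact_eqI) (simp add: hact_times h)
  show "x * (y + z) = x * y + x * z" by (rule hact_eqI) (simp add: hact_times h)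
  show "(c *\<^sub>C x) * y = c *\<^sub>C (x * y)" by (rule hact_eqI) (simp add: hact_times h)
  show "x * (c *\<^sub>C y) = c *\<^sub>C (x * y)" by (rule hact_eqI) (simp add: hact_times h)
  show "x = 0" if *: "\<And>y. x * y = 0"
  proof (rule hact_faithful)
    fix w
    obtain u :: 'a where u: "u \<noteq> 0" using exists_nonzero by blast
    obtain y where "hact y u = w" using hact_nonzero[OF u] by blast
    then show "hact x w = 0" using *[of y] by (metis hact_times h(3))
  qed
  show "x = 0" if *: "\<And>y. y * x = 0"
  proof (rule hact_faithful, rule ccontr)
    fix w assume w: "hact x w \<noteq> 0"
    obtain y where "hact y (hact x w) = hact x w" using hact_nonzero[OF w] by blast
    then show False using *[of y] w by (metis hact_times h(3))
  qed
qed

text \<open>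
  The operators of rank one absorb the multiplication by \<open>a\<close> on either side, since \<open>\<phi>(q (a x)) = \<phi>((q a) x)\<close>; likewise
  they absorb the action of \<open>B\<close> from the left, while on the right \<open>(a b') b = a (b' b)\<close>.
\<close>

lemma heis_alg_multiplier:
  shows hact_lapp_heis_alg: "hact (lapp (heis_alg a) z) x = a * hact z x"
    and hact_rapp_heis_alg: "hact (rapp z (heis_alg a)) x = hact z (a * x)"
proof -
  obtain m where m: "\<And>n \<xi>. hact (lapp m n) \<xi> = a * hact n \<xi>" "\<And>n \<xi>. hact (rapp n m) \<xi> = hact n (a * \<xi>)"
  proof (rule multiplier_of_operator[of hact "(*) a"])
    show "\<exists>n'. \<forall>\<xi>. hact n' \<xi> = a * hact n \<xi>" for n
    proof -
      obtain v where n: "n = rank_one v" by (rule rank_one_cases)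
      have "hact (rank_one (tensor_map ((*) a) (\<lambda>x. x) v)) \<xi> = a * hact (rank_one v) \<xi>" for \<xi>
        by (rule clinear_eq_tensor[where t=v])
          ((intro clin)+, simp add: tensor_map_tensor clin hact_rank_one mult_scaleC_right)
      then show ?thesis unfolding n by blast
    qed
    show "\<exists>n'. \<forall>\<xi>. hact n' \<xi> = hact n (a * \<xi>)" for n
    proof -
      obtain v where n: "n = rank_one v" by (rule rank_one_cases)
      have "hact (rank_one (tensor_map (\<lambda>x. x) (\<lambda>q. q * a) v)) \<xi> = hact (rank_one v) (a * \<xi>)" for \<xi>
        by (rule clinear_eq_tensor[where t=v])
          ((intro clin)+, simp add: tensor_map_tensor clin hact_rank_one mult.assoc)
      then show ?thesis unfolding n by blast
    qed
  qed (intro clin hact_times hact_faithful | assumption | blast)+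
  have "heis_alg a = m"
    unfolding heis_alg_def
  proof (rule the_equality)
    show m': "\<forall>a' b'. lapp m (heis a' b') = heis (a * a') b'"
      by (intro allI hact_eqI) (simp add: m hact_heis mult.assoc)
    show "n = m" if "\<forall>a' b'. lapp n (heis a' b') = heis (a * a') b'" for n
      by (rule multiplier_eq_lappI, rule clinear_eq_heisenberg) (intro clin | simp add: that m')+
  qed
  then show "hact (lapp (heis_alg a) z) x = a * hact z x" "hact (rapp z (heis_alg a)) x = hact z (a * x)"
    by (simp_all add: m)
qed

lemma heis_dual_multiplier:
  shows hact_lapp_heis_dual: "hact (lapp (heis_dual b) z) x = lact b (hact z x)"
    and hact_rapp_heis_dual: "hact (rapp z (heis_dual b)) x = hact z (lact b x)"
proof -
  obtain m where m: "\<And>n \<xi>. hact (lapp m n) \<xi> = lact b (hact n \<xi>)" "\<And>n \<xi>. hact (rapp n m) \<xi> = hact n (lact b \<xi>)"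
  proof (rule multiplier_of_operator[of hact "lact b"])
    show "\<exists>n'. \<forall>\<xi>. hact n' \<xi> = lact b (hact n \<xi>)" for n
    proof -
      obtain v where n: "n = rank_one v" by (rule rank_one_cases)
      have "hact (rank_one (tensor_map (lact b) (\<lambda>x. x) v)) \<xi> = lact b (hact (rank_one v) \<xi>)" for \<xi>
        by (rule clinear_eq_tensor[where t=v])
          ((intro clin)+, simp add: tensor_map_tensor clin hact_rank_one clinearD(2)[OF clinear_lact(1)[OF clinear_basic(1)]])
      then show ?thesis unfolding n by blast
    qed
    show "\<exists>n'. \<forall>\<xi>. hact n' \<xi> = hact n (lact b \<xi>)" for n
    proof (induction n rule: heisenberg_induct)
      case (heis a d)
      have "hact (heis a (d * b)) \<xi> = hact (heis a d) (lact b \<xi>)" for \<xi>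
        by (simp add: hact_heis lact_times)
      then show ?case by blast
    next
      case (add y z)
      then show ?case by (metis clinearD(1)[OF clinear_hact(1)[OF clinear_basic(1)]])
    qed
  qed (intro clin hact_times hact_faithful | assumption | blast)+
  have "heis_dual b = m"
    unfolding heis_dual_def
  proof (rule the_equality)
    show m': "\<forall>a' b'. rapp (heis a' b') m = heis a' (b' * b)"
      by (intro allI hact_eqI) (simp add: m hact_heis lact_times)
    show "n = m" if "\<forall>a' b'. rapp (heis a' b') n = heis a' (b' * b)" for n
      by (rule multiplier_eq_rappI, rule clinear_eq_heisenberg) (intro clin | simp add: that m')+
  qed
  then show "hact (lapp (heis_dual b) z) x = lact b (hact z x)" "hact (rapp z (heis_dual b)) x = hact z (lact b x)"
    by (simp_all add: m)
qed

lemma surj_products: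
  "surj (mu :: ('a::algebraic_quantum_group, 'a) tensor \<Rightarrow> 'a)"
  "surj (mu :: ('a dual, 'a dual) tensor \<Rightarrow> 'a dual)"
  "surj (tlift lact :: ('a dual, 'a) tensor \<Rightarrow> 'a)"
proof -
  have "\<exists>v. y = mu v" for y :: 'a using mult_surj[of y] by auto
  then show "surj (mu :: ('a, 'a) tensor \<Rightarrow> 'a)" unfolding surj_def ..
  have "\<exists>v. y = mu v" for y :: "'a dual" using dual_mult_surj[of y] by auto
  then show "surj (mu :: ('a dual, 'a dual) tensor \<Rightarrow> 'a dual)" unfolding surj_def ..
  have "\<exists>v :: ('a dual, 'a) tensor. y = tlift lact v" for y :: 'a using lact_surj[of y] by auto
  then show "surj (tlift lact :: ('a dual, 'a) tensor \<Rightarrow> 'a)" unfolding surj_def ..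
qed

lemma nondegenerate_hom_alg: "nondegenerate_hom (of_alg :: 'a::algebraic_quantum_group \<Rightarrow> _)"
  by (rule nondegenerate_hom_of_alg) (rule surj_products)

lemma nondegenerate_hom_dual: "nondegenerate_hom (of_alg :: 'a::algebraic_quantum_group dual \<Rightarrow> _)"
  by (rule nondegenerate_hom_of_alg) (rule surj_products)

lemma heisenberg_spanI:
  fixes f :: "('c::complex_vector, 'a::algebraic_quantum_group heisenberg) tensor \<Rightarrow> 'a heisenberg"
  assumes "clinear f" "\<And>a b. \<exists>t. f t = heis a b"
  shows "surj f"
proof -
  have "\<exists>t. z = f t" for z
  proof (induction z rule: heisenberg_induct)
    case (heis a b)
    then show ?case using assms(2) by metis
  next
    case (add y z)
    then show ?case by (metis clinearD(1)[OF assms(1)])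
  qed
  then show ?thesis by blast
qed

lemma rank_one_spanI:
  fixes f :: "('c::complex_vector, 'a::algebraic_quantum_group heisenberg) tensor \<Rightarrow> 'a heisenberg"
  assumes "clinear f" "\<And>p q. \<exists>t. f t = rank_one (p \<otimes> q)"
  shows "surj f"
proof -
  have "\<exists>t. rank_one v = f t" for v
  proof (induction v)
    case (tensor p q)
    then show ?case using assms(2) by metis
  next
    case (add v w)
    then show ?case by (metis clinearD(1)[OF assms(1)] clinearD(1)[OF clinear_rank_one[OF clinear_basic(1)]])
  qed
  moreover have "\<exists>v. z = rank_one v" for z :: "'a heisenberg" using rank_one_cases[of z] by blast
  ultimately have "\<exists>t. z = f t" for z by metis
  then show ?thesis by blast
qed

context
  fixes h :: "'x::complex_algebra \<Rightarrow> 'a::algebraic_quantum_group heisenberg multiplier" and p :: "'x \<Rightarrow> 'a \<Rightarrow> 'a"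
  assumes p: "cbilinear p" and h: "\<And>x z \<xi>. hact (lapp (h x) z) \<xi> = p x (hact z \<xi>)"
begin

lemma clinear_heisenberg_hom: "clinear h"
proof -
  have p': "clinear (\<lambda>x. p x u)" for u using p by (simp add: cbilinear_def)
  show ?thesis
    by (rule clinearI; rule multiplier_eq_lappI; rule hact_eqI;
      simp add: h clinearD[OF p'] clinearD[OF clinear_hact(1)[OF clinear_basic(1)]])
qed

lemma nondegenerate_heisenberg_hom:
  assumes "\<And>x y u. p (x * y) u = p x (p y u)" "surj (tlift p)" "surj (tlift (\<lambda>x u. rapp u (h x)))"
  shows "nondegenerate_hom h"
proof -
  have p': "clinear (p x)" for x using p by (simp add: cbilinear_def)
  note lin = clinear_heisenberg_hom
  have b: "cbilinear (\<lambda>x u. lapp (h x) u)" by (intro clin lin)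
  have "surj (tlift (\<lambda>x u. lapp (h x) u))"
  proof (rule rank_one_spanI)
    fix y q
    obtain v where v: "y = tlift p v" using assms(2) by (meson surjD)
    have "tlift (\<lambda>x u. lapp (h x) u) (tensor_map (\<lambda>x. x) (\<lambda>y. rank_one (y \<otimes> q)) v) = rank_one (tlift p v \<otimes> q)" for v
      by (rule clinear_eq_tensor[where t=v])
        ((intro clin lin p)+, simp add: tensor_map_tensor clin tlift_tensor b p, rule hact_eqI,
          simp add: h hact_rank_one clinearD(2)[OF p'])
    then show "\<exists>t. tlift (\<lambda>x u. lapp (h x) u) t = rank_one (y \<otimes> q)" using v by blast
  qed (rule clinear_tlift[OF b])
  moreover have "h (x * y) = h x * h y" for x y
    by (rule multiplier_eq_lappI, rule hact_eqI) (simp add: h assms(1))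
  ultimately show ?thesis unfolding nondegenerate_hom_def using lin assms(3) by blast
qed

end

lemma nondegenerate_hom_heis_alg: "nondegenerate_hom (heis_alg :: 'a::algebraic_quantum_group \<Rightarrow> _)"
proof (rule nondegenerate_heisenberg_hom[OF cbilinear_mu hact_lapp_heis_alg mult.assoc surj_products(1)])
  have b: "cbilinear (\<lambda>x u. rapp u (heis_alg (x::'a)))"
    by (intro clin clinear_heisenberg_hom[OF cbilinear_mu hact_lapp_heis_alg])
  show "surj (tlift (\<lambda>x u. rapp u (heis_alg (x::'a))))"
  proof (rule rank_one_spanI)
    fix p q :: 'a
    obtain v where v: "mu v = q" using mult_surj by blast
    have "tlift (\<lambda>x u. rapp u (heis_alg x)) (tensor_map (\<lambda>x. x) (\<lambda>q. rank_one (p \<otimes> q)) (tensor_flip v)) = rank_one (p \<otimes> mu v)" for v :: "('a, 'a) tensor"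
      by (rule clinear_eq_tensor[where t=v])
        ((intro clin b)+, simp add: tensor_flip_tensor tensor_map_tensor clin tlift_tensor b,
          rule hact_eqI, simp add: hact_rapp_heis_alg hact_rank_one mult.assoc)
    then show "\<exists>t. tlift (\<lambda>x u. rapp u (heis_alg x)) t = rank_one (p \<otimes> q)" using v by blast
  qed (rule clinear_tlift[OF b])
qed

lemma nondegenerate_hom_heis_dual: "nondegenerate_hom (heis_dual :: 'a::algebraic_quantum_group dual \<Rightarrow> _)"
proof (rule nondegenerate_heisenberg_hom[OF cbilinear_lact hact_lapp_heis_dual lact_times surj_products(3)])
  have b: "cbilinear (\<lambda>x u. rapp u (heis_dual (x::'a dual)))"
    by (intro clin clinear_heisenberg_hom[OF cbilinear_lact hact_lapp_heis_dual])
  show "surj (tlift (\<lambda>x u. rapp u (heis_dual (x::'a dual))))"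
  proof (rule heisenberg_spanI)
    fix a :: 'a and d :: "'a dual"
    obtain v where v: "mu v = d" using dual_mult_surj by blast
    have "tlift (\<lambda>x u. rapp u (heis_dual x)) (tensor_map (\<lambda>x. x) (\<lambda>y. heis a y) (tensor_flip v)) = heis a (mu v)" for v :: "('a dual, 'a dual) tensor"
      by (rule clinear_eq_tensor[where t=v])
        ((intro clin b)+, simp add: tensor_flip_tensor tensor_map_tensor clin tlift_tensor b,
          rule hact_eqI, simp add: hact_rapp_heis_dual hact_heis lact_times)
    then show "\<exists>t. tlift (\<lambda>x u. rapp u (heis_dual x)) t = heis a d" using v by blast
  qed (rule clinear_tlift[OF b])
qed

section \<open>The canonical element\<close>

lemma bilinear_actions:
  "cbilinear (lact :: 'a::algebraic_quantum_group dual \<Rightarrow> _)" "cbilinear (hact :: 'a heisenberg \<Rightarrow> _)"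
  by (intro clin)+

lemma tact_lact_mult_surj: "surj (tlift (tact lact ((*) :: 'a::algebraic_quantum_group \<Rightarrow> _)))"
  by (rule tact_surj) (rule bilinear_actions cbilinear_mu surj_products)+

text \<open>
  The action of \<open>B \<otimes> A\<close> on \<open>A \<otimes> A\<close> is non-degenerate and hence extends to multipliers.  Since
  \<open>\<langle>b \<otimes> a, a' \<otimes> \<phi>( \<cdot> c)\<rangle> = (\<epsilon> \<otimes> \<phi>) ((b \<otimes> a) (a' \<otimes> c))\<close>, so does the pairing.
\<close>

lemma mult_cross_pairing_act:
  fixes V :: "('a::algebraic_quantum_group dual, 'a) tensor multiplier"
  shows "mult_cross_pairing V ((b \<triangleright>\<^sub>A a') \<otimes> (a \<triangleright>\<^sub>B b')) = cross_pairing (lapp V (b \<otimes> a)) (a' \<otimes> b')"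
proof -
  let ?s = "tact lact (*) :: ('a dual, 'a) tensor \<Rightarrow> ('a, 'a) tensor \<Rightarrow> ('a, 'a) tensor"
  note bm = bilinear_actions(1)[where ?'a='a] cbilinear_mu[where ?'a='a]
  have times: "?s (m * n) \<eta> = ?s m (?s n \<eta>)" for m n \<eta>
    by (rule tact_times) (intro bm | simp add: lact_times mult.assoc)+
  obtain X where X: "clinear X" "\<And>n \<eta>. X (?s n \<eta>) = ?s (lapp V n) \<eta>"
  proof (rule module_extension[of ?s "lapp V" "\<lambda>n. rapp n V"])
    show "cbilinear ?s" by (intro clin clinear_tact bm)
    show "\<eta> = 0" if "\<And>n. ?s n \<eta> = 0" for \<eta>
      by (rule tact_separates[OF bm]) (use that lact_faithful nondegenerate_right in auto)
  qed (simp_all add: multiplierD times[symmetric] tact_lact_mult_surj)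
  let ?e = "\<lambda>t. left_int (slice_left counit t) :: complex"
  have pure: "?e (?s n (a' \<otimes> c)) = cross_pairing n (a' \<otimes> dualR c)" for n :: "('a dual, 'a) tensor" and a' c
    by (rule clinear_eq_tensor[where t=n])
      ((intro clin clinear_tact bm)+, simp add: tact_tensor_tensor[OF bm] slice_tensor counit_lact
        clinearD(2)[OF clinear_left_int] cross_pairing_tensor_tensor pairing_dualR scaleC_complex_def)
  define F where "F t = ?e (X (tensor_map (\<lambda>x. x) dual_rep t))" for t :: "('a, 'a dual) tensor"
  have F: "clinear F" unfolding F_def by (intro clin clinear_compose[OF X(1)])
  have "F (lact b a' \<otimes> (a \<triangleright>\<^sub>B b')) = cross_pairing (lapp V (b \<otimes> a)) (a' \<otimes> b')" for a a' b b'
  proof -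
    obtain c where c: "b' = dualR c" by (rule dualR_cases)
    have "F (lact b a' \<otimes> (a \<triangleright>\<^sub>B b')) = ?e (X (?s (b \<otimes> a) (a' \<otimes> c)))"
      by (simp add: F_def tensor_map_tensor clin c act_dual_dualR dual_rep_dualR tact_tensor_tensor[OF bm])
    then show ?thesis by (simp add: X(2) pure c)
  qed
  then have F_act: "F ((b \<triangleright>\<^sub>A a') \<otimes> (a \<triangleright>\<^sub>B b')) = cross_pairing (lapp V (b \<otimes> a)) (a' \<otimes> b')" for a a' b b'
    by (simp add: act_alg_eq_lact)
  have "mult_cross_pairing V = F"
    unfolding mult_cross_pairing_def
  proof (rule the_equality)
    show "clinear F \<and> (\<forall>a a' b b'. F ((b \<triangleright>\<^sub>A a') \<otimes> (a \<triangleright>\<^sub>B b')) = cross_pairing (lapp V (b \<otimes> a)) (a' \<otimes> b'))"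
      using F F_act by blast
    fix G :: "('a, 'a dual) tensor \<Rightarrow> complex"
    assume G: "clinear G \<and> (\<forall>a a' b b'. G ((b \<triangleright>\<^sub>A a') \<otimes> (a \<triangleright>\<^sub>B b')) = cross_pairing (lapp V (b \<otimes> a)) (a' \<otimes> b'))"
    \<comment> \<open>uniqueness: \<open>A\<close> is spanned by the \<open>b \<triangleright> a'\<close>, and \<open>B\<close> by the \<open>a \<triangleright> b'\<close> because \<open>A\<close> is spanned by products\<close>
    have "G t = F t" for t
    proof (rule clinear_eq_tensor[where t=t])
      show "G (x \<otimes> d) = F (x \<otimes> d)" for x d
      proof (rule clinear_span_lact_eqI[of "\<lambda>x. G (x \<otimes> d)" "\<lambda>x. F (x \<otimes> d)"])
        fix b a'
        obtain c where d: "d = dualR c" by (rule dualR_cases)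
        obtain v where v: "mu v = c" using mult_surj by blast
        have "G (lact b a' \<otimes> dualR (mu v)) = F (lact b a' \<otimes> dualR (mu v))"
        proof (rule clinear_eq_tensor[where t=v])
          show "G (lact b a' \<otimes> dualR (mu (x \<otimes> y))) = F (lact b a' \<otimes> dualR (mu (x \<otimes> y)))" for x y
            using G F_act[of b a' x "dualR y"] by (simp add: tlift_tensor cbilinear_mu act_dual_dualR[symmetric] act_alg_eq_lact)
        qed (intro clinear_compose[OF conjunct1[OF G]] clinear_compose[OF F] clin)+
        then show "G (lact b a' \<otimes> d) = F (lact b a' \<otimes> d)" by (simp add: d v)
      qed (intro clinear_compose[OF conjunct1[OF G]] clinear_compose[OF F] clin)+
    qed (use G F in auto)
    then show "G = F" by blast
  qed
  then show ?thesis by (simp add: F_act)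
qed

lemma tensor_pairing_dual_eqI:
  fixes s t :: "('a::algebraic_quantum_group, 'a) tensor"
  assumes "\<And>b d. tensor_pairing s (b \<otimes> d) = tensor_pairing t (b \<otimes> d)"
  shows "s = t"
proof (rule slice_left_eqI[of "range (\<lambda>b x. pairing x b)", OF _ alg_separated])
  show "clinear f" if "f \<in> range (\<lambda>b x. pairing x b)" for f :: "'a \<Rightarrow> complex" using that by (auto intro: clin)
  show "slice_left f s = slice_left f t" if "f \<in> range (\<lambda>b x. pairing x b)" for f
    using that assms unfolding tensor_pairing_slice(2) by (auto intro: pairing_eqI)
qed

text \<open>The condition on the pairing of \<open>V\<close> says precisely that \<open>V\<close> acts on \<open>A \<otimes> A\<close> as \<open>T1\<close>.\<close>

lemma canonical_element_act:
  fixes V :: "('a::algebraic_quantum_group dual, 'a) tensor multiplier"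
  assumes V: "\<And>x y. mult_cross_pairing V (x \<otimes> y) = pairing x y"
  shows "tact lact (*) (lapp V t) \<eta> = tlift T1 (tact lact (*) t \<eta>)"
proof -
  note bm = bilinear_actions(1)[where ?'a='a] cbilinear_mu[where ?'a='a]
  have cross: "tensor_pairing (tact lact (*) s (x \<otimes> y)) (p \<otimes> f) = cross_pairing s (ract p x \<otimes> (y \<triangleright>\<^sub>B f))" for s and x y :: 'a and p f
    by (rule clinear_eq_tensor[where t=s])
      ((intro clin clinear_tact bm)+, simp add: tact_tensor_tensor[OF bm] tensor_pairing_tensor_tensor cross_pairing_tensor_tensor
        pairing_lact_ract pairing_act_dual)
  have pure: "tact lact (*) (lapp V (b \<otimes> a)) (x \<otimes> y) = tlift T1 (tact lact (*) (b \<otimes> a) (x \<otimes> y))" for b and a x y :: 'a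
  proof (rule tensor_pairing_dual_eqI)
    fix p f
    have "cross_pairing (lapp V (b \<otimes> a)) (ract p x \<otimes> (y \<triangleright>\<^sub>B f)) = pairing (lact b (ract p x)) (a \<triangleright>\<^sub>B (y \<triangleright>\<^sub>B f))"
      unfolding mult_cross_pairing_act[symmetric] V act_alg_eq_lact ..
    also have "\<dots> = pairing (ract p (lact b x) * (a * y)) f"
      by (simp add: pairing_act_dual lact_ract mult.assoc)
    also have "\<dots> = tensor_pairing (T1 (lact b x) (a * y)) (p \<otimes> f)"
      by (simp add: tensor_pairing_slice(2) ract_T1_T4)
    finally show "tensor_pairing (tact lact (*) (lapp V (b \<otimes> a)) (x \<otimes> y)) (p \<otimes> f)
        = tensor_pairing (tlift T1 (tact lact (*) (b \<otimes> a) (x \<otimes> y))) (p \<otimes> f)"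
      by (simp add: cross tact_tensor_tensor[OF bm] canonical_tensor)
  qed
  have "tact lact (*) (lapp V (b \<otimes> a)) \<eta> = tlift T1 (tact lact (*) (b \<otimes> a) \<eta>)" for b a
    by (rule clinear_eq_tensor[where t=\<eta>]) ((intro clin clinear_tact bm)+, rule pure)
  then show ?thesis
    by (rule clinear_eq_tensor[of "\<lambda>t. tact lact (*) (lapp V t) \<eta>" "\<lambda>t. tlift T1 (tact lact (*) t \<eta>)", rotated 2])
      (intro clin clinear_tact bm)+
qed

theorem proposition3p17:
  fixes V :: "('a::algebraic_quantum_group dual, 'a) tensor multiplier"
  assumes "\<And>x y. mult_cross_pairing V (x \<otimes> y) = pairing x y"
  shows "\<forall>(a :: 'a) (b :: 'a dual).
    mult_extend heis_alg of_alg (comult a) * mult_extend heis_dual of_alg V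
      = mult_extend heis_dual of_alg V * (heis_alg a \<otimes>\<^sub>m 1) \<and>
    mult_extend of_alg heis_alg V * mult_extend of_alg heis_dual (dual_comult b)
      = (1 \<otimes>\<^sub>m heis_dual b) * mult_extend of_alg heis_alg V"
proof (intro allI conjI)
  fix a :: 'a and b :: "'a dual"
  note bil = bilinear_actions(1)[where ?'a='a] bilinear_actions(2)[where ?'a='a] cbilinear_mu[where ?'a='a]
  note hom = nondegenerate_hom_alg[where ?'a='a] nondegenerate_hom_dual[where ?'a='a]
    nondegenerate_hom_heis_alg[where ?'a='a] nondegenerate_hom_heis_dual[where ?'a='a]
  note V = canonical_element_act[OF assms]
  have eqI1: "y = z" if "\<And>\<xi>. tact hact (*) y \<xi> = tact hact (*) z \<xi>" for y z :: "('a heisenberg, 'a) tensor"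
    by (rule tact_eqI[OF bil(2,3) hact_faithful nondegenerate_left]) (use that in auto)
  have eqI2: "y = z" if "\<And>\<xi>. tact lact hact y \<xi> = tact lact hact z \<xi>" for y z :: "('a dual, 'a heisenberg) tensor"
    by (rule tact_eqI[OF bil(1,2) lact_faithful_dual hact_faithful]) (use that in auto)
  have Delta: "tact hact (*) (lapp (mult_extend heis_alg of_alg (comult a)) z) \<xi> = lapp (comult a) (tact hact (*) z \<xi>)" for z \<xi>
    by (rule mult_extend_intertwine[OF hom(3,1) bil(2,3,3,3)])
      (simp_all add: hact_lapp_heis_alg of_alg_app mult.assoc multiplierD tact_mult)
  have V1: "tact hact (*) (lapp (mult_extend heis_dual of_alg V) z) \<xi> = tlift T1 (tact hact (*) z \<xi>)" for z \<xi>
    by (rule mult_extend_intertwine[OF hom(4,1) bil(2,3,1,3)])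
      (simp_all add: hact_lapp_heis_dual of_alg_app mult.assoc clinear_canonical_tlift V)
  have V2: "tact lact hact (lapp (mult_extend of_alg heis_alg V) z) \<xi> = tlift T1 (tact lact hact z \<xi>)" for z \<xi>
    by (rule mult_extend_intertwine[OF hom(2,3) bil(1,2,1,3)])
      (simp_all add: hact_lapp_heis_alg of_alg_app lact_times clinear_canonical_tlift V)
  have dual_Delta: "tact lact hact (lapp (mult_extend of_alg heis_dual (dual_comult b)) z) \<xi> = dual_comult_op b (tact lact hact z \<xi>)" for z \<xi>
    by (rule mult_extend_intertwine[OF hom(2,4) bil(1,2,1,1)])
      (simp_all add: hact_lapp_heis_dual of_alg_app lact_times clinear_dual_comult_op[OF clinear_basic(1)]
        lact2_dual_comult)
  have comp: "hact (lapp (heis_alg a) u) = (\<lambda>x. a * hact u x)" "hact (lapp (heis_dual b) u) = (\<lambda>x. lact b (hact u x))" for u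
    by (simp_all add: fun_eq_iff hact_lapp_heis_alg hact_lapp_heis_dual)
  have l: "lapp (of_alg a \<otimes>\<^sub>m 1) \<eta> = tensor_map ((*) a) (\<lambda>x. x) \<eta>" for \<eta> :: "('a, 'a) tensor"
    unfolding lapp_mult_tensor of_alg_app lapp_one ..
  have leg1: "tact hact (*) (lapp (heis_alg a \<otimes>\<^sub>m 1) z) \<xi> = lapp (of_alg a \<otimes>\<^sub>m 1) (tact hact (*) z \<xi>)" for z :: "('a heisenberg, 'a) tensor" and \<xi>
    by (rule clinear_eq_tensor[where t=z])
      ((intro clin clinear_tact bil)+, simp add: mult_tensor_app tact_tensor[OF bil(2,3)] l tensor_map_compose clin comp)
  have leg2: "tact lact hact (lapp (1 \<otimes>\<^sub>m heis_dual b) z) \<xi> = tensor_map (\<lambda>x. x) (lact b) (tact lact hact z \<xi>)" for z :: "('a dual, 'a heisenberg) tensor" and \<xi>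
    by (rule clinear_eq_tensor[where t=z])
      ((intro clin clinear_tact bil)+, simp add: mult_tensor_app tact_tensor[OF bil(1,2)] tensor_map_compose clin comp)
  have T1_left: "tlift T1 (lapp (of_alg a \<otimes>\<^sub>m 1) \<eta>) = lapp (comult a) (tlift T1 \<eta>)" for \<eta>
    by (rule clinear_eq_tensor[where t=\<eta>])
      ((intro clin)+, simp add: mult_tensor_app of_alg_app canonical_tensor canonical_times)
  show "mult_extend heis_alg of_alg (comult a) * mult_extend heis_dual of_alg V
      = mult_extend heis_dual of_alg V * (heis_alg a \<otimes>\<^sub>m 1)"
    by (rule multiplier_eq_lappI, rule eqI1) (simp add: Delta V1 leg1 T1_left)
  show "mult_extend of_alg heis_alg V * mult_extend of_alg heis_dual (dual_comult b)
      = (1 \<otimes>\<^sub>m heis_dual b) * mult_extend of_alg heis_alg V"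
    by (rule multiplier_eq_lappI, rule eqI2) (simp add: V2 dual_Delta leg2 dual_comult_op_def canonical_inv)
qed

end
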